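(* Assume (H2) below with constant $\alpha\in(0,1)$. Let $f\in\mathcal B_b(S^3)$ with $Pf=0$. Let $(b_n)$ be an increasing sequence of positive reals with $b_n/\sqrt n\to+\infty$ and such that: if $\alpha^2<1/2$, $b_n/n\to0$; if $\alpha^2=1/2$, $b_n\log n/n\to0$; if $\alpha^2>1/2$, $b_n\alpha^{r_n+1}/\sqrt n\to0$. Then $\big(\frac1{b_n}M^\pi_n(f)\big)_n$ satisfies a moderate deviation principle in $\mathbb R$ with speed $\frac{b_n^2}{n}$ and rate function $I(x)=\frac{x^2}{2(\mu,Pf^2)}$; that is, for every Borel $A\subset\mathbb R$, $$-\inf_{A^\circ}I\le\liminf_n\frac{n}{b_n^2}\log\mathbb P\Big(\frac{M^\pi_n(f)}{b_n}\in A\Big)\le\limsup_n\frac{n}{b_n^2}\log\mathbb P\Big(\frac{M^\pi_n(f)}{b_n}\in A\Big)\le-\inf_{\overline A}I.$$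
   Context: Binary tree: $\mathbb T=\mathbb N^*$, vertex $n$ having daughters $2n,2n+1$; $\mathbb G_r=\{2^r,\dots,2^{r+1}-1\}$, $\mathbb T_r=\bigcup_{q=0}^r\mathbb G_q$, $r_n=\lfloor\log_2n\rfloor$. $(S,\mathcal S)$ is a metric space with Borel $\sigma$-field; $\mathcal B_b(S^p)$ denotes bounded measurable real functions on $S^p$. A $\mathbb T$-transition probability $P$ is a Markov kernel from $S$ to $S^2$; $P_0(x,B)=P(x,B\times S)$, $P_1(x,B)=P(x,S\times B)$, $Q=(P_0+P_1)/2$, $Pf(x)=\int f(x,y,z)P(x,dy\,dz)$. $(X_n)_{n\in\mathbb T}$ is a bifurcating Markov chain with initial law $\nu$ and $\mathbb T$-transition probability $P$: with $\mathcal F_r=\sigma(X_i,i\in\mathbb T_r)$, $\mathcal L(X_1)=\nu$ and for every $r$ and every family $(f_n)_{n\in\mathbb G_r}\subset\mathcal B_b(S^3)$, $\mathbb E[\prod_{n\in\mathbb G_r}f_n(X_n,X_{2n},X_{2n+1})\mid\mathcal F_r]=\prod_{n\in\mathbb G_r}Pf_n(X_n)$. $\Delta_i=(X_i,X_{2i},X_{2i+1})$. $\pi$ is a random permutation of $\mathbb N^*$ leaving each $\mathbb G_r$ invariant, drawn uniformly among such permutations, independently of $X$. $M^\pi_n(f)=\sum_{i=1}^nf(\Delta_{\pi(i)})$. $\mu$ is a probability measure on $S$, $(\mu,g)=\int gd\mu$. Hypothesis (H2): there is $\alpha\in(0,1)$ such that for every $g\in\mathcal B_b(S)$ with $(\mu,g)=0$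 there exists $c>0$ with $|Q^rg(x)|\le c\alpha^r$ for all $r\in\mathbb N$, $x\in S$. *)

theory Defs
  imports "HOL-Probability.Probability"
begin

(* Binary tree: generations G_r = {2^r, ..., 2^(r+1)-1}, T_r = union of G_0..G_r *)
definition Gen :: "nat \<Rightarrow> nat set" where
  "Gen r = {2^r ..< 2^(Suc r)}"

definition Tr :: "nat \<Rightarrow> nat set" where
  "Tr r = (\<Union>q\<le>r. Gen q)"

definition rgen :: "nat \<Rightarrow> nat" where
  "rgen n = nat \<lfloor>log 2 (real n)\<rfloor>"

abbreviation S2 :: "('a::metric_space \<times> 'a) measure" where
  "S2 \<equiv> borel \<Otimes>\<^sub>M borel"

abbreviation S3 :: "('a::metric_space \<times> 'a \<times> 'a) measure" where
  "S3 \<equiv> borel \<Otimes>\<^sub>M (borel \<Otimes>\<^sub>M borel)"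

definition T_transition :: "('a::metric_space \<Rightarrow> ('a \<times> 'a) measure) \<Rightarrow> bool" where
  "T_transition P \<longleftrightarrow> P \<in> borel \<rightarrow>\<^sub>M prob_algebra S2"

definition Pop :: "('a \<Rightarrow> ('a \<times> 'a) measure) \<Rightarrow> ('a \<times> 'a \<times> 'a \<Rightarrow> real) \<Rightarrow> 'a \<Rightarrow> real" where
  "Pop P f x = (\<integral>yz. f (x, fst yz, snd yz) \<partial>(P x))"

definition Qop :: "('a \<Rightarrow> ('a \<times> 'a) measure) \<Rightarrow> ('a \<Rightarrow> real) \<Rightarrow> 'a \<Rightarrow> real" where
  "Qop P g x = ((\<integral>yz. g (fst yz) \<partial>(P x)) + (\<integral>yz. g (snd yz) \<partial>(P x))) / 2"

definition bounded_meas :: "'b measure \<Rightarrow> ('b \<Rightarrow> real) \<Rightarrow> bool" where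
  "bounded_meas N g \<longleftrightarrow> g \<in> borel_measurable N \<and> bounded (range g)"

definition H2 :: "('a::metric_space \<Rightarrow> ('a \<times> 'a) measure) \<Rightarrow> 'a measure \<Rightarrow> real \<Rightarrow> bool" where
  "H2 P \<mu> \<alpha> \<longleftrightarrow> 0 < \<alpha> \<and> \<alpha> < 1 \<and>
     (\<forall>g. bounded_meas borel g \<and> (\<integral>x. g x \<partial>\<mu>) = 0 \<longrightarrow>
        (\<exists>c>0. \<forall>r x. \<bar>(Qop P ^^ r) g x\<bar> \<le> c * \<alpha> ^ r))"

definition Delta :: "(nat \<Rightarrow> 'w \<Rightarrow> 'a) \<Rightarrow> nat \<Rightarrow> 'w \<Rightarrow> 'a \<times> 'a \<times> 'a" where
  "Delta X i \<omega> = (X i \<omega>, X (2*i) \<omega>, X (2*i+1) \<omega>)"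

definition gen_sigma :: "'w measure \<Rightarrow> (nat \<Rightarrow> 'w \<Rightarrow> 'a::topological_space) \<Rightarrow> nat set \<Rightarrow> 'w measure" where
  "gen_sigma M X I = sigma (space M) {X i -` B \<inter> space M | i B. i \<in> I \<and> B \<in> sets borel}"

definition BMC :: "'w measure \<Rightarrow> (nat \<Rightarrow> 'w \<Rightarrow> 'a::metric_space) \<Rightarrow> 'a measure
                     \<Rightarrow> ('a \<Rightarrow> ('a \<times> 'a) measure) \<Rightarrow> bool" where
  "BMC M X \<nu> P \<longleftrightarrow>
     (\<forall>i\<ge>1. X i \<in> M \<rightarrow>\<^sub>M borel) \<and>
     distr M borel (X 1) = \<nu> \<and>
     (\<forall>r (f :: nat \<Rightarrow> 'a \<times> 'a \<times> 'a \<Rightarrow> real).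
        (\<forall>n\<in>Gen r. bounded_meas S3 (f n)) \<longrightarrow>
        (AE \<omega> in M. real_cond_exp M (gen_sigma M X (Tr r))
                        (\<lambda>\<omega>. \<Prod>n\<in>Gen r. f n (Delta X n \<omega>)) \<omega>
                     = (\<Prod>n\<in>Gen r. Pop P (f n) (X n \<omega>))))"

(* pi: random permutation of N* leaving each G_r invariant, uniform among such
   permutations (i.e. independent uniform permutations of each G_r), independent of X *)
definition random_gen_perm :: "'w measure \<Rightarrow> (nat \<Rightarrow> 'w \<Rightarrow> 'a::topological_space)
                                 \<Rightarrow> ('w \<Rightarrow> nat \<Rightarrow> nat) \<Rightarrow> bool" where
  "random_gen_perm M X \<pi> \<longleftrightarrow>
     (\<forall>\<omega>\<in>space M. \<forall>r. bij_betw (\<pi> \<omega>) (Gen r) (Gen r)) \<and>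
     (\<forall>r \<sigma>. (\<forall>q\<le>r. bij_betw \<sigma> (Gen q) (Gen q)) \<longrightarrow>
        {\<omega>\<in>space M. \<forall>i\<in>Tr r. \<pi> \<omega> i = \<sigma> i} \<in> sets M \<and>
        (\<forall>A\<in>sets (gen_sigma M X {1..}).
           measure M ({\<omega>\<in>space M. \<forall>i\<in>Tr r. \<pi> \<omega> i = \<sigma> i} \<inter> A)
             = measure M A / (\<Prod>q\<le>r. fact (2^q))))"

definition Mpi :: "(nat \<Rightarrow> 'w \<Rightarrow> 'a) \<Rightarrow> ('w \<Rightarrow> nat \<Rightarrow> nat) \<Rightarrow> nat
                     \<Rightarrow> ('a \<times> 'a \<times> 'a \<Rightarrow> real) \<Rightarrow> 'w \<Rightarrow> real" where
  "Mpi X \<pi> n f \<omega> = (\<Sum>i=1..n. f (Delta X (\<pi> \<omega> i) \<omega>))"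

definition eln :: "real \<Rightarrow> ereal" where
  "eln p = (if p = 0 then MInfty else ereal (ln p))"

(* rate function x^2/(2 s), with the convention c/0 = +infinity for c > 0 *)
definition gauss_rate :: "real \<Rightarrow> real \<Rightarrow> ereal" where
  "gauss_rate v x = (if v = 0 then (if x = 0 then 0 else PInfty) else ereal (x^2 / (2 * v)))"

definition dev_principle :: "'w measure \<Rightarrow> (nat \<Rightarrow> 'w \<Rightarrow> real) \<Rightarrow> (nat \<Rightarrow> real)
                               \<Rightarrow> (real \<Rightarrow> ereal) \<Rightarrow> bool" where
  "dev_principle M Z v I \<longleftrightarrow>
     (\<forall>A\<in>sets (borel :: real measure).
        let L = (\<lambda>n. ereal (1 / v n) * eln (measure M {\<omega>\<in>space M. Z n \<omega> \<in> A})) in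
        - (INF x\<in>interior A. I x) \<le> liminf L \<and>
        liminf L \<le> limsup L \<and>
        limsup L \<le> - (INF x\<in>closure A. I x))"

end

theory Submission
  imports Defs
begin

text \<open>With \<open>\<theta> = \<lambda> b\<^sub>n / n\<close>, the variable \<open>\<theta> M\<^sub>n - \<Sum>\<^bsub>i\<le>n\<^esub> ln (P (exp (\<theta> f))) (X\<^bsub>\<pi> i\<^esub>)\<close> has exponential moment exactly 1,
  because the generations can be integrated out one after the other. As
  \<open>ln (P (exp (\<theta> f))) = \<theta>\<^sup>2 / 2 P f\<^sup>2 + o(\<theta>\<^sup>2)\<close> uniformly, the log-Laplace transform of \<open>M\<^sub>n\<close> is Gaussian up to the
  fluctuations of \<open>\<Sum>\<^bsub>i\<le>n\<^esub> g (X\<^bsub>\<pi> i\<^esub>)\<close>, \<open>g = P f\<^sup>2 - (\<mu>, P f\<^sup>2)\<close>, which Hoelder's inequality separates off.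
  For complete generations these are controlled by Hoeffding's lemma: integrating out generation
  \<open>q\<close> with weight \<open>h\<close> produces weight \<open>2 Q h\<close> on generation \<open>q - 1\<close>, and (H2) bounds the iterates.
  The incomplete last generation is a sample without replacement, reduced to the complete one by
  averaging over the random permutation. A Gaussian Gaertner--Ellis argument concludes.\<close>

section \<open>Moderate deviations from Gaussian log-Laplace transforms\<close>

text \<open>Hoelder's inequality is used with \<open>p\<close> only slightly above 1: the Gaussian
  constant may be spoilt by no more than a factor \<open>p\<close> or \<open>1 / p\<close>. The
  conjugate \<open>q\<close> is then huge, but it only multiplies the slope of the fluctuation term,
  whose log-Laplace transform is negligible against the speed at every fixed slope. The fluctuation
  term carries a weight \<kappa> of order (b_n/n)^2 per vertex. Applying Hoeffding's lemma j
  generations above the last one costs of order \<kappa>^2 2^r (2 \<beta>^2)^j in the exponent, so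
  after division by the speed b_n^2/n the error is (b_n/n)^2 times a geometric sum of ratio 2
  \<beta>^2. A ratio below, equal to or above 1 is what separates the three conditions on b_n. The
  accumulated means contribute \<beta>^(r_n) instead, which vanishes on its own. The variance
  (\<mu>, Pf^2) may be 0, the rate then being infinite off 0. The deviation bounds are therefore
  parametrised by slopes, never by a point divided by the variance.\<close>

lemma limsup_eln_le:
  fixes v p :: "nat \<Rightarrow> real" and K C :: real
  assumes v: "filterlim v at_top sequentially" and p: "\<And>n. p n \<ge> 0" and C: "C > 0"
    and le: "eventually (\<lambda>n. p n \<le> C * exp (- K * v n)) sequentially"
  shows "limsup (\<lambda>n. ereal (1 / v n) * eln (p n)) \<le> ereal (- K)"
proof -
  have vpos: "eventually (\<lambda>n. v n > 0) sequentially"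
    using v by (simp add: filterlim_at_top_dense)
  have "eventually (\<lambda>n. ereal (1 / v n) * eln (p n) \<le> ereal (ln C * inverse (v n) - K)) sequentially"
    using vpos le
  proof eventually_elim
    case (elim n)
    show ?case
    proof (cases "p n = 0")
      case True
      then show ?thesis using elim(1) by (simp add: eln_def)
    next
      case False
      then have pp: "p n > 0" using p[of n] by simp
      have "ln (p n) \<le> ln (C * exp (- K * v n))"
        using elim(2) pp C by (subst ln_le_cancel_iff) auto
      also have "\<dots> = ln C - K * v n" using C by (subst ln_mult) auto
      finally have "ln (p n) / v n \<le> (ln C - K * v n) / v n"
        using elim(1) by (simp add: divide_right_mono)
      also have "\<dots> = ln C * inverse (v n) - K" using elim(1) by (simp add: field_simps)
      finally show ?thesis using False by (simp add: eln_def)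
    qed
  qed
  then have "limsup (\<lambda>n. ereal (1 / v n) * eln (p n)) \<le> limsup (\<lambda>n. ereal (ln C * inverse (v n) - K))"
    by (rule Limsup_mono)
  \<comment> \<open>The prefactor \<open>C\<close> enters only through \<open>ln C\<close> over the
    speed, which vanishes.\<close>
  also have "(\<lambda>n. ln C * inverse (v n) - K) \<longlonglongrightarrow> ln C * 0 - K"
    by (intro tendsto_intros tendsto_inverse_0_at_top v)
  then have "(\<lambda>n. ereal (ln C * inverse (v n) - K)) \<longlonglongrightarrow> ereal (- K)" by simp
  then have "limsup (\<lambda>n. ereal (ln C * inverse (v n) - K)) = ereal (- K)"
    by (intro lim_imp_Limsup) auto
  finally show ?thesis .
qed

lemma liminf_eln_ge:
  fixes v p :: "nat \<Rightarrow> real" and K C :: real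
  assumes v: "filterlim v at_top sequentially" and C: "C > 0"
    and ge: "eventually (\<lambda>n. C * exp (- K * v n) \<le> p n) sequentially"
  shows "ereal (- K) \<le> liminf (\<lambda>n. ereal (1 / v n) * eln (p n))"
proof -
  have vpos: "eventually (\<lambda>n. v n > 0) sequentially"
    using v by (simp add: filterlim_at_top_dense)
  have "eventually (\<lambda>n. ereal (ln C * inverse (v n) - K) \<le> ereal (1 / v n) * eln (p n)) sequentially"
    using vpos ge
  proof eventually_elim
    case (elim n)
    have pp: "p n > 0" using elim(2) C by (smt (verit) exp_gt_zero mult_pos_pos)
    have "ln C - K * v n = ln (C * exp (- K * v n))" using C by (subst ln_mult) auto
    also have "\<dots> \<le> ln (p n)"
      using elim(2) pp C by (subst ln_le_cancel_iff) auto
    finally have "(ln C - K * v n) / v n \<le> ln (p n) / v n"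
      using elim(1) by (simp add: divide_right_mono)
    moreover have "(ln C - K * v n) / v n = ln C * inverse (v n) - K" using elim(1) by (simp add: field_simps)
    ultimately show ?case using pp by (simp add: eln_def)
  qed
  then have "liminf (\<lambda>n. ereal (ln C * inverse (v n) - K)) \<le> liminf (\<lambda>n. ereal (1 / v n) * eln (p n))"
    by (rule Liminf_mono)
  moreover have "(\<lambda>n. ln C * inverse (v n) - K) \<longlonglongrightarrow> ln C * 0 - K"
    by (intro tendsto_intros tendsto_inverse_0_at_top v)
  then have "(\<lambda>n. ereal (ln C * inverse (v n) - K)) \<longlonglongrightarrow> ereal (- K)" by simp
  then have "liminf (\<lambda>n. ereal (ln C * inverse (v n) - K)) = ereal (- K)"
    by (intro lim_imp_Liminf) auto
  ultimately show ?thesis by simp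
qed

lemma ln_ratio_tendsto_bounds:
  fixes E v :: "nat \<Rightarrow> real" and l \<epsilon> :: real
  assumes v: "filterlim v at_top sequentially" and E: "\<And>n. E n > 0"
    and lim: "(\<lambda>n. ln (E n) / v n) \<longlonglongrightarrow> l" and \<epsilon>: "\<epsilon> > 0"
  shows "eventually (\<lambda>n. exp ((l - \<epsilon>) * v n) \<le> E n \<and> E n \<le> exp ((l + \<epsilon>) * v n)) sequentially"
proof -
  have vpos: "eventually (\<lambda>n. v n > 0) sequentially"
    using v by (simp add: filterlim_at_top_dense)
  have "eventually (\<lambda>n. dist (ln (E n) / v n) l < \<epsilon>) sequentially"
    using lim \<epsilon> by (rule tendstoD)
  with vpos show ?thesis
  proof eventually_elim
    case (elim n)
    have "\<bar>ln (E n) / v n - l\<bar> < \<epsilon>" using elim(2) by (simp add: dist_real_def)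
    then have "l - \<epsilon> < ln (E n) / v n" "ln (E n) / v n < l + \<epsilon>" by linarith+
    then have "(l - \<epsilon>) * v n \<le> ln (E n)" "ln (E n) \<le> (l + \<epsilon>) * v n"
      using elim(1) by (auto simp: field_simps)
    then show ?case
      using E[of n] by (metis exp_le_cancel_iff exp_ln)
  qed
qed

lemma (in prob_space) expectation_exp_pos:
  fixes x :: "'a \<Rightarrow> real"
  assumes "integrable M (\<lambda>\<omega>. exp (x \<omega>))"
  shows "expectation (\<lambda>\<omega>. exp (x \<omega>)) > 0"
proof -
  have "0 \<le> expectation (\<lambda>\<omega>. exp (x \<omega>))" by simp
  moreover have "expectation (\<lambda>\<omega>. exp (x \<omega>)) \<noteq> 0"
    using assms by (subst integral_nonneg_eq_0_iff_AE) (auto simp: AE_False)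
  ultimately show ?thesis by linarith
qed

lemma (in prob_space) integrable_exp_cmult:
  fixes x :: "'a \<Rightarrow> real"
  assumes "x \<in> borel_measurable M" and B: "\<And>\<omega>. \<bar>x \<omega>\<bar> \<le> B"
  shows "integrable M (\<lambda>\<omega>. exp (c * x \<omega>))"
proof -
  have "c * x \<omega> \<le> \<bar>c\<bar> * B" for \<omega>
    by (rule order_trans[OF abs_ge_self]) (simp add: abs_mult mult_left_mono B)
  then show ?thesis
    using assms(1) by (intro integrable_const_bound[where B="exp (\<bar>c\<bar> * B)"]) auto
qed

context prob_space
begin

text \<open>Chernoff's bound at the two slopes \<open>l\<close> and \<open>- l\<close>, whence a
  prefactor 2. The premise \<open>2 * s * K \<le> \<rho>\<^sup>2\<close> says that \<open>K\<close>
  is at most the rate at \<open>\<rho>\<close>, freed of the division by \<open>s\<close>.\<close>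

lemma gauss_upper_tail:
  fixes Z :: "nat \<Rightarrow> 'a \<Rightarrow> real" and v :: "nat \<Rightarrow> real" and s K \<rho> :: real
  assumes v: "filterlim v at_top sequentially"
    and Z[measurable]: "\<And>n. Z n \<in> borel_measurable M"
    and int: "\<And>n c. integrable M (\<lambda>\<omega>. exp (c * Z n \<omega>))"
    and s: "s \<ge> 0"
    and lim: "\<And>l. (\<lambda>n. ln (expectation (\<lambda>\<omega>. exp (l * v n * Z n \<omega>))) / v n) \<longlonglongrightarrow> l\<^sup>2 * s / 2"
    and A: "A \<in> sets borel" "\<And>z. z \<in> A \<Longrightarrow> \<bar>z\<bar> \<ge> \<rho>"
    and \<rho>: "\<rho> > 0" "2 * s * K \<le> \<rho>\<^sup>2" and K: "K \<ge> 0"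
  shows "limsup (\<lambda>n. ereal (1 / v n) * eln (measure M {\<omega>\<in>space M. Z n \<omega> \<in> A})) \<le> ereal (- K)"
proof -
  \<comment> \<open>The slope \<open>\<rho> / s\<close> minimises
    \<open>l\<^sup>2 * s / 2 - l * \<rho>\<close>. For \<open>s = 0\<close> this expression is
    linear in \<open>l\<close>, and \<open>K / \<rho>\<close> is where it equals
    \<open>- K\<close>.\<close>
  define l where "l = (if s = 0 then K / \<rho> else \<rho> / s)"
  have l: "l \<ge> 0" "l\<^sup>2 * s / 2 - l * \<rho> \<le> - K"
  proof -
    show "l \<ge> 0" using \<rho> K s by (auto simp: l_def)
    show "l\<^sup>2 * s / 2 - l * \<rho> \<le> - K"
    proof (cases "s = 0")
      case True then show ?thesis using \<rho> by (simp add: l_def)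
    next
      case False
      then have sp: "s > 0" using s by simp
      have "l\<^sup>2 * s / 2 - l * \<rho> = - (\<rho>\<^sup>2 / (2 * s))"
        using False by (simp add: l_def field_simps power2_eq_square)
      also have "\<dots> \<le> - K" using \<rho>(2) sp by (simp add: field_simps)
      finally show ?thesis .
    qed
  qed
  have Epos: "expectation (\<lambda>\<omega>. exp (c * Z n \<omega>)) > 0" for c n
    by (rule expectation_exp_pos[OF int])
  have main: "limsup (\<lambda>n. ereal (1 / v n) * eln (measure M {\<omega>\<in>space M. Z n \<omega> \<in> A})) \<le> ereal (- (K - \<epsilon>))"
    if \<epsilon>: "\<epsilon> > 0" for \<epsilon>
  proof (rule limsup_eln_le[OF v, where C=2])
    have vpos: "eventually (\<lambda>n. v n > 0) sequentially"
      using v by (simp add: filterlim_at_top_dense)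
    have e1: "eventually (\<lambda>n. expectation (\<lambda>\<omega>. exp (l * v n * Z n \<omega>)) \<le> exp ((l\<^sup>2 * s / 2 + \<epsilon>) * v n)) sequentially"
      using ln_ratio_tendsto_bounds[OF v Epos lim \<epsilon>, of l] by (rule eventually_mono) auto
    have e2: "eventually (\<lambda>n. expectation (\<lambda>\<omega>. exp ((-l) * v n * Z n \<omega>)) \<le> exp ((l\<^sup>2 * s / 2 + \<epsilon>) * v n)) sequentially"
      using ln_ratio_tendsto_bounds[OF v Epos lim \<epsilon>, of "-l"] by (rule eventually_mono) auto
    show "eventually (\<lambda>n. measure M {\<omega>\<in>space M. Z n \<omega> \<in> A} \<le> 2 * exp (- (K - \<epsilon>) * v n)) sequentially"
      using vpos e1 e2
    proof eventually_elim
      case (elim n)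
      have lv: "l * v n \<ge> 0" using l elim(1) by simp
      let ?S = "{\<omega>\<in>space M. Z n \<omega> \<in> A}"
      have S: "?S \<in> sets M" using A by measurable
      have "measure M ?S = expectation (indicator ?S)" using S by simp
      also have "\<dots> \<le> expectation (\<lambda>\<omega>. exp (- (l * v n * \<rho>)) * (exp (l * v n * Z n \<omega>) + exp ((-l) * v n * Z n \<omega>)))"
      proof (rule integral_mono)
        show "integrable M (indicator ?S :: _ \<Rightarrow> real)" using S
          by (intro integrable_real_indicator) (auto simp: emeasure_eq_measure)
        show "integrable M (\<lambda>\<omega>. exp (- (l * v n * \<rho>)) * (exp (l * v n * Z n \<omega>) + exp ((-l) * v n * Z n \<omega>)))"
          by (intro integrable_mult_right Bochner_Integration.integrable_add int)
        fix \<omega> assume "\<omega> \<in> space M"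
        show "indicator ?S \<omega> \<le> exp (- (l * v n * \<rho>)) * (exp (l * v n * Z n \<omega>) + exp ((-l) * v n * Z n \<omega>))"
        proof (cases "\<omega> \<in> ?S")
          case True
          then have "\<rho> \<le> \<bar>Z n \<omega>\<bar>" using A(2) by auto
          then have "l * v n * \<rho> \<le> l * v n * \<bar>Z n \<omega>\<bar>" using lv by (rule mult_left_mono)
          then have "1 \<le> exp (- (l * v n * \<rho>)) * exp (l * v n * \<bar>Z n \<omega>\<bar>)" by (simp flip: exp_add)
          also have "\<dots> \<le> exp (- (l * v n * \<rho>)) * (exp (l * v n * Z n \<omega>) + exp ((-l) * v n * Z n \<omega>))"
            by (intro mult_left_mono) (auto simp: abs_if)
          finally show ?thesis using True by simp
        qed simp
      qed
      also have "\<dots> = exp (- (l * v n * \<rho>)) * (expectation (\<lambda>\<omega>. exp (l * v n * Z n \<omega>)) + expectation (\<lambda>\<omega>. exp ((-l) * v n * Z n \<omega>)))"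
        using int[of "l * v n" n] int[of "(-l) * v n" n] by simp
      also have "\<dots> \<le> exp (- (l * v n * \<rho>)) * (2 * exp ((l\<^sup>2 * s / 2 + \<epsilon>) * v n))"
        using elim(2,3) by (intro mult_left_mono) auto
      also have "\<dots> = 2 * exp ((l\<^sup>2 * s / 2 - l * \<rho> + \<epsilon>) * v n)"
        by (simp add: algebra_simps flip: exp_add)
      also have "\<dots> \<le> 2 * exp (- (K - \<epsilon>) * v n)"
        using l(2) elim(1) by (simp add: mult_right_mono)
      finally show ?case .
    qed
  qed auto
  show ?thesis
  proof (rule ereal_le_epsilon2)
    fix e :: real assume "0 < e"
    from main[OF this] show "limsup (\<lambda>n. ereal (1 / v n) * eln (measure M {\<omega>\<in>space M. Z n \<omega> \<in> A})) \<le> ereal (- K) + ereal e"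
      by simp
  qed
qed

text \<open>A substitute for tilting the measure. The centre \<open>l * s\<close> is the derivative
  of \<open>l\<^sup>2 * s / 2\<close>, so changing the slope \<open>l\<close> slightly to either
  side shows that the parts of the exponential moment above and below the ball are exponentially
  smaller than the whole; the ball must carry the rest. Naming the centre by its slope covers
  \<open>s = 0\<close>, where it is 0.\<close>

lemma gauss_lower_ball:
  fixes Z :: "nat \<Rightarrow> 'a \<Rightarrow> real" and v :: "nat \<Rightarrow> real" and s l \<delta> :: real
  assumes v: "filterlim v at_top sequentially"
    and Z[measurable]: "\<And>n. Z n \<in> borel_measurable M"
    and int: "\<And>n c. integrable M (\<lambda>\<omega>. exp (c * Z n \<omega>))"
    and s: "s \<ge> 0"
    and lim: "\<And>l. (\<lambda>n. ln (expectation (\<lambda>\<omega>. exp (l * v n * Z n \<omega>))) / v n) \<longlonglongrightarrow> l\<^sup>2 * s / 2"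
    and A: "A \<in> sets borel" "\<And>z. \<bar>z - l * s\<bar> < \<delta> \<Longrightarrow> z \<in> A"
    and \<delta>: "\<delta> > 0"
  shows "ereal (- (l\<^sup>2 * s / 2 + \<bar>l\<bar> * \<delta> + \<delta>\<^sup>2)) \<le> liminf (\<lambda>n. ereal (1 / v n) * eln (measure M {\<omega>\<in>space M. Z n \<omega> \<in> A}))"
proof -
  define x where "x = l * s"
  \<comment> \<open>Small enough that the second-order term \<open>t\<^sup>2 * s / 2\<close> is at
    most a quarter of the first-order gain \<open>t * \<delta>\<close>; the summand 1 keeps the
    denominator positive when \<open>s = 0\<close>.\<close>
  define t where "t = \<delta> / (2 * (s + 1))"
  \<comment> \<open>In this unit \<open>t * \<delta>\<close> is 8 and
    \<open>t\<^sup>2 * s / 2\<close> at most 2, so with an error of 1 the exponent on either side of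
    the ball is at most \<open>l\<^sup>2 * s / 2 - 5 * \<epsilon>\<close>.\<close>
  define \<epsilon> where "\<epsilon> = t * \<delta> / 8"
  have t: "t > 0" "t \<le> \<delta>" "t\<^sup>2 * s / 2 \<le> t * \<delta> / 4"
  proof -
    show tp: "t > 0" using \<delta> s by (simp add: t_def)
    show "t \<le> \<delta>" using \<delta> s unfolding t_def by (simp add: field_simps)
    have "t * s \<le> t * (s + 1)" using tp by simp
    also have "\<dots> = \<delta> / 2" using s by (simp add: t_def field_simps)
    finally have "t * (t * s) \<le> t * (\<delta> / 2)" using tp by (intro mult_left_mono) auto
    then show "t\<^sup>2 * s / 2 \<le> t * \<delta> / 4" by (simp add: power2_eq_square field_simps)
  qed
  have \<epsilon>: "\<epsilon> > 0" using t \<delta> by (simp add: \<epsilon>_def)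
  have Epos: "expectation (\<lambda>\<omega>. exp (c * Z n \<omega>)) > 0" for c n
    by (rule expectation_exp_pos[OF int])
  have vpos: "eventually (\<lambda>n. v n > 0) sequentially"
    using v by (simp add: filterlim_at_top_dense)
  \<comment> \<open>Makes \<open>exp (- (4 * \<epsilon> * v n))\<close> at most 1/4, so that the two
    sides together take at most half of the lower bound for the whole moment.\<close>
  have vbig: "eventually (\<lambda>n. v n > ln 4 / (4 * \<epsilon>)) sequentially"
    using v by (simp add: filterlim_at_top_dense)
  let ?E = "\<lambda>c n. expectation (\<lambda>\<omega>. exp (c * v n * Z n \<omega>))"
  have e0: "eventually (\<lambda>n. exp ((l\<^sup>2 * s / 2 - \<epsilon>) * v n) \<le> ?E l n) sequentially"
    using ln_ratio_tendsto_bounds[OF v Epos lim \<epsilon>, of l] by (rule eventually_mono) auto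
  have e1: "eventually (\<lambda>n. ?E (l + t) n \<le> exp (((l + t)\<^sup>2 * s / 2 + \<epsilon>) * v n)) sequentially"
    using ln_ratio_tendsto_bounds[OF v Epos lim \<epsilon>, of "l + t"] by (rule eventually_mono) auto
  have e2: "eventually (\<lambda>n. ?E (l - t) n \<le> exp (((l - t)\<^sup>2 * s / 2 + \<epsilon>) * v n)) sequentially"
    using ln_ratio_tendsto_bounds[OF v Epos lim \<epsilon>, of "l - t"] by (rule eventually_mono) auto
  have "eventually (\<lambda>n. (1/2) * exp (- (l\<^sup>2 * s / 2 + \<bar>l\<bar> * \<delta> + \<epsilon>) * v n) \<le> measure M {\<omega>\<in>space M. Z n \<omega> \<in> A}) sequentially"
    using vpos vbig e0 e1 e2
  proof eventually_elim
    case (elim n)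
    let ?S = "{\<omega>\<in>space M. Z n \<omega> \<in> A}"
    let ?c = "exp (v n * (l * x + \<bar>l\<bar> * \<delta>))"
    have S: "?S \<in> sets M" using A by measurable
    have I1: "integrable M (indicat_real ?S)"
      using S by (intro integrable_real_indicator) (auto simp: emeasure_eq_measure)
    note vn = elim(1)
    have "?E l n \<le> expectation (\<lambda>\<omega>. indicator ?S \<omega> * ?c + exp (- (t * v n * (x + \<delta>))) * exp ((l + t) * v n * Z n \<omega>)
        + exp (t * v n * (x - \<delta>)) * exp ((l - t) * v n * Z n \<omega>))"
    proof (rule integral_mono)
      show "integrable M (\<lambda>\<omega>. exp (l * v n * Z n \<omega>))" by (rule int)
      show "integrable M (\<lambda>\<omega>. indicator ?S \<omega> * ?c + exp (- (t * v n * (x + \<delta>))) * exp ((l + t) * v n * Z n \<omega>)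
        + exp (t * v n * (x - \<delta>)) * exp ((l - t) * v n * Z n \<omega>))"
        using S by (intro Bochner_Integration.integrable_add integrable_mult_right integrable_mult_left int
            integrable_real_indicator) (auto simp: emeasure_eq_measure)
      fix \<omega> assume w: "\<omega> \<in> space M"
      \<comment> \<open>Inside the ball the integrand is at most \<open>?c\<close>; above it the
        slope \<open>l + t\<close> dominates, below it the slope \<open>l - t\<close>.\<close>
      consider "\<bar>Z n \<omega> - x\<bar> < \<delta>" | "Z n \<omega> \<ge> x + \<delta>" | "Z n \<omega> \<le> x - \<delta>" by linarith
      then show "exp (l * v n * Z n \<omega>) \<le> indicator ?S \<omega> * ?c + exp (- (t * v n * (x + \<delta>))) * exp ((l + t) * v n * Z n \<omega>)
        + exp (t * v n * (x - \<delta>)) * exp ((l - t) * v n * Z n \<omega>)"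
      proof cases
        case 1
        then have "\<omega> \<in> ?S" using A(2) w by (simp add: x_def)
        have "l * (Z n \<omega> - x) \<le> \<bar>l\<bar> * \<bar>Z n \<omega> - x\<bar>" by (metis abs_ge_self abs_mult)
        also have "\<dots> \<le> \<bar>l\<bar> * \<delta>" using 1 by (intro mult_left_mono) auto
        finally have "v n * (l * Z n \<omega>) \<le> v n * (l * x + \<bar>l\<bar> * \<delta>)" using vn
          by (intro mult_left_mono) (auto simp: algebra_simps)
        then have "exp (l * v n * Z n \<omega>) \<le> ?c" by (simp add: mult_ac)
        also have "\<dots> = indicator ?S \<omega> * ?c" using \<open>\<omega> \<in> ?S\<close> by simp
        finally show ?thesis by (smt (verit, best) exp_gt_zero mult_pos_pos)
      next
        case 2
        then have "0 \<le> t * v n * (Z n \<omega> - (x + \<delta>))" using t vn by simp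
        then have "exp (l * v n * Z n \<omega>) \<le> exp (- (t * v n * (x + \<delta>))) * exp ((l + t) * v n * Z n \<omega>)"
          by (simp add: algebra_simps flip: exp_add)
        moreover have "0 \<le> indicator ?S \<omega> * ?c" "0 \<le> exp (t * v n * (x - \<delta>)) * exp ((l - t) * v n * Z n \<omega>)" by auto
        ultimately show ?thesis by linarith
      next
        case 3
        then have "0 \<le> t * v n * (x - \<delta> - Z n \<omega>)" using t vn by simp
        then have "exp (l * v n * Z n \<omega>) \<le> exp (t * v n * (x - \<delta>)) * exp ((l - t) * v n * Z n \<omega>)"
          by (simp add: algebra_simps flip: exp_add)
        moreover have "0 \<le> indicator ?S \<omega> * ?c" "0 \<le> exp (- (t * v n * (x + \<delta>))) * exp ((l + t) * v n * Z n \<omega>)" by auto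
        ultimately show ?thesis by linarith
      qed
    qed
    also have "\<dots> = measure M ?S * ?c + exp (- (t * v n * (x + \<delta>))) * ?E (l + t) n + exp (t * v n * (x - \<delta>)) * ?E (l - t) n"
      using I1 S int[of "(l + t) * v n" n] int[of "(l - t) * v n" n] by simp
    also have "exp (- (t * v n * (x + \<delta>))) * ?E (l + t) n \<le> exp (- (t * v n * (x + \<delta>))) * exp (((l + t)\<^sup>2 * s / 2 + \<epsilon>) * v n)"
      using elim(4) by (intro mult_left_mono) auto
    also have "\<dots> = exp ((l\<^sup>2 * s / 2 + t\<^sup>2 * s / 2 - t * \<delta> + \<epsilon>) * v n)"
      by (simp add: x_def power2_eq_square algebra_simps add_divide_distrib flip: exp_add)
    also have "exp (t * v n * (x - \<delta>)) * ?E (l - t) n \<le> exp (t * v n * (x - \<delta>)) * exp (((l - t)\<^sup>2 * s / 2 + \<epsilon>) * v n)"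
      using elim(5) by (intro mult_left_mono) auto
    also have "\<dots> = exp ((l\<^sup>2 * s / 2 + t\<^sup>2 * s / 2 - t * \<delta> + \<epsilon>) * v n)"
      by (simp add: x_def power2_eq_square algebra_simps add_divide_distrib diff_divide_distrib flip: exp_add)
    also have "exp ((l\<^sup>2 * s / 2 + t\<^sup>2 * s / 2 - t * \<delta> + \<epsilon>) * v n) \<le> exp ((l\<^sup>2 * s / 2 - \<epsilon>) * v n - 4 * \<epsilon> * v n)"
    proof -
      have "l\<^sup>2 * s / 2 + t\<^sup>2 * s / 2 - t * \<delta> + \<epsilon> \<le> l\<^sup>2 * s / 2 - \<epsilon> - 4 * \<epsilon>"
        using t(3) unfolding \<epsilon>_def by linarith
      from mult_right_mono[OF this, of "v n"] vn show ?thesis by (simp add: algebra_simps)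
    qed
    also have "\<dots> = exp ((l\<^sup>2 * s / 2 - \<epsilon>) * v n) * exp (- (4 * \<epsilon> * v n))" by (simp flip: exp_add)
    also have "\<dots> \<le> exp ((l\<^sup>2 * s / 2 - \<epsilon>) * v n) * (1/4)"
    proof (intro mult_left_mono)
      have "ln 4 \<le> 4 * \<epsilon> * v n" using elim(2) \<epsilon> by (simp add: field_simps)
      then have "exp (ln 4) \<le> exp (4 * \<epsilon> * v n)" by (subst exp_le_cancel_iff)
      then have "4 \<le> exp (4 * \<epsilon> * v n)" by simp
      then show "exp (- (4 * \<epsilon> * v n)) \<le> 1/4" by (simp add: exp_minus field_simps)
    qed simp
    finally have "?E l n \<le> measure M ?S * ?c + exp ((l\<^sup>2 * s / 2 - \<epsilon>) * v n) * (1/4) + exp ((l\<^sup>2 * s / 2 - \<epsilon>) * v n) * (1/4)"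
      by simp
    with elim(3) have "(1/2) * exp ((l\<^sup>2 * s / 2 - \<epsilon>) * v n) \<le> measure M ?S * ?c" by linarith
    then have "(1/2) * exp ((l\<^sup>2 * s / 2 - \<epsilon>) * v n) / ?c \<le> measure M ?S"
      by (subst pos_divide_le_eq) auto
    also have "(1/2) * exp ((l\<^sup>2 * s / 2 - \<epsilon>) * v n) / ?c = (1/2) * exp ((l\<^sup>2 * s / 2 - \<epsilon>) * v n - v n * (l * x + \<bar>l\<bar> * \<delta>))"
      by (simp add: exp_diff)
    also have "(l\<^sup>2 * s / 2 - \<epsilon>) * v n - v n * (l * x + \<bar>l\<bar> * \<delta>) = - (l\<^sup>2 * s / 2 + \<bar>l\<bar> * \<delta> + \<epsilon>) * v n"
      by (simp add: x_def algebra_simps power2_eq_square)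
    finally show ?case .
  qed
  then have "ereal (- (l\<^sup>2 * s / 2 + \<bar>l\<bar> * \<delta> + \<epsilon>)) \<le> liminf (\<lambda>n. ereal (1 / v n) * eln (measure M {\<omega>\<in>space M. Z n \<omega> \<in> A}))"
    by (intro liminf_eln_ge[OF v, where C="1/2"]) auto
  moreover have "\<epsilon> \<le> \<delta>\<^sup>2"
  proof -
    have "t * \<delta> \<le> \<delta> * \<delta>" using t \<delta> by (intro mult_right_mono) auto
    moreover have "0 \<le> \<delta> * \<delta>" by simp
    ultimately show ?thesis unfolding \<epsilon>_def power2_eq_square by linarith
  qed
  ultimately show ?thesis
    by (meson add_left_mono ereal_less_eq(3) neg_le_iff_le order_trans)
qed

text \<open>For the lower bound, balls shrink around each point of the interior. For the upper bound
  only the distance of the closure from 0 matters, as the rate is even and nondecreasing in the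
  modulus.\<close>

lemma gauss_dev_principle:
  fixes Z :: "nat \<Rightarrow> 'a \<Rightarrow> real" and v :: "nat \<Rightarrow> real" and s :: real
  assumes v: "filterlim v at_top sequentially"
    and Z: "\<And>n. Z n \<in> borel_measurable M"
    and int: "\<And>n c. integrable M (\<lambda>\<omega>. exp (c * Z n \<omega>))"
    and s: "s \<ge> 0"
    and lim: "\<And>l. (\<lambda>n. ln (expectation (\<lambda>\<omega>. exp (l * v n * Z n \<omega>))) / v n) \<longlonglongrightarrow> l\<^sup>2 * s / 2"
  shows "dev_principle M Z v (gauss_rate s)"
  unfolding dev_principle_def Let_def
proof (intro ballI conjI)
  fix A :: "real set" assume A: "A \<in> sets borel"
  define L where "L = (\<lambda>n. ereal (1 / v n) * eln (measure M {\<omega> \<in> space M. Z n \<omega> \<in> A}))"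
  show "liminf (\<lambda>n. ereal (1 / v n) * eln (measure M {\<omega> \<in> space M. Z n \<omega> \<in> A}))
        \<le> limsup (\<lambda>n. ereal (1 / v n) * eln (measure M {\<omega> \<in> space M. Z n \<omega> \<in> A}))"
    by (intro Liminf_le_Limsup) simp
  have "- liminf L \<le> (INF x\<in>interior A. gauss_rate s x)"
  proof (rule INF_greatest)
    fix x assume x: "x \<in> interior A"
    show "- liminf L \<le> gauss_rate s x"
    proof (cases "s = 0 \<and> x \<noteq> 0")
      case True then show ?thesis by (simp add: gauss_rate_def)
    next
      case False
      define l where "l = (if s = 0 then 0 else x / s)"
      have xl: "x = l * s" using False by (auto simp: l_def)
      have rate: "gauss_rate s x = ereal (l\<^sup>2 * s / 2)"
        using False by (auto simp: gauss_rate_def l_def power2_eq_square)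
      obtain d where d: "d > 0" "ball x d \<subseteq> A" using x mem_interior by blast
      have "eventually (\<lambda>\<delta>. ereal (- (l\<^sup>2 * s / 2 + \<bar>l\<bar> * \<delta> + \<delta>\<^sup>2)) \<le> liminf L) (at_right 0)"
        unfolding eventually_at_right_field
      proof (intro exI[of _ d] conjI allI impI)
        show "d > 0" by fact
        fix \<delta> assume \<delta>: "0 < \<delta>" "\<delta> < d"
        show "ereal (- (l\<^sup>2 * s / 2 + \<bar>l\<bar> * \<delta> + \<delta>\<^sup>2)) \<le> liminf L" unfolding L_def
          using d \<delta> by (intro gauss_lower_ball[OF v Z int s lim A]) (auto simp: xl dist_real_def subset_iff abs_minus_commute)
      qed
      moreover have "((\<lambda>\<delta>. ereal (- (l\<^sup>2 * s / 2 + \<bar>l\<bar> * \<delta> + \<delta>\<^sup>2))) \<longlongrightarrow> ereal (- (l\<^sup>2 * s / 2 + \<bar>l\<bar> * 0 + 0\<^sup>2))) (at_right 0)"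
        by (intro tendsto_intros)
      ultimately have "ereal (- (l\<^sup>2 * s / 2 + \<bar>l\<bar> * 0 + 0\<^sup>2)) \<le> liminf L"
        by (intro tendsto_upperbound) auto
      then have "- liminf L \<le> - ereal (- (l\<^sup>2 * s / 2))"
        by (subst ereal_minus_le_minus) simp
      then show ?thesis by (simp add: rate)
    qed
  qed
  then show "- (INF x\<in>interior A. gauss_rate s x) \<le> liminf (\<lambda>n. ereal (1 / v n) * eln (measure M {\<omega> \<in> space M. Z n \<omega> \<in> A}))"
    unfolding L_def[symmetric] by (simp add: ereal_uminus_le_reorder)
  \<comment> \<open>Probabilities are at most 1; this settles every nonnegative \<open>z\<close>
    below.\<close>
  have nonpos: "limsup L \<le> ereal (- 0)" unfolding L_def
    by (rule limsup_eln_le[OF v, where C=1]) auto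
  have "limsup L \<le> - (INF x\<in>closure A. gauss_rate s x)"
  \<comment> \<open>Comparing with real \<open>z\<close> only also covers an infinite
    infimum.\<close>
  proof (rule ereal_le_real)
    fix z assume z: "- (INF x\<in>closure A. gauss_rate s x) \<le> ereal z"
    define K where "K = - z"
    have K: "ereal K \<le> (INF x\<in>closure A. gauss_rate s x)"
      using z by (subst ereal_minus_le_minus[symmetric]) (simp add: K_def)
    show "limsup L \<le> ereal z"
    proof (cases "K \<le> 0")
      case True
      then have "ereal (- 0) \<le> ereal z" by (simp add: K_def)
      with nonpos show ?thesis by (rule order_trans)
    next
      case False
      have ge: "ereal K \<le> gauss_rate s z" if "z \<in> closure A" for z
        using K that by (meson INF_lower order_trans)
      have "gauss_rate s 0 = 0" by (simp add: gauss_rate_def)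
      then have "0 \<notin> closure A" using ge[of 0] False by (auto simp: zero_ereal_def)
      then obtain c where c: "c > 0" "ball 0 c \<subseteq> - closure A"
        using open_contains_ball[of "- closure A"] by blast
      \<comment> \<open>Two lower bounds for the modulus on \<open>A\<close>: the distance
        \<open>c\<close> of its closure from 0, which keeps \<open>\<rho>\<close> positive even for
        \<open>s = 0\<close>, and the bound that the rate being at least \<open>K\<close>
        forces.\<close>
      define \<rho> where "\<rho> = max c (sqrt (2 * s * K))"
      have "limsup L \<le> ereal (- K)" unfolding L_def
      proof (rule gauss_upper_tail[OF v Z int s lim A])
        show "\<rho> > 0" using c by (simp add: \<rho>_def)
        have "2 * s * K = (sqrt (2 * s * K))\<^sup>2" using s False by simp
        also have "\<dots> \<le> \<rho>\<^sup>2" using s False by (intro power_mono) (auto simp: \<rho>_def)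
        finally show "2 * s * K \<le> \<rho>\<^sup>2" .
        show "K \<ge> 0" using False by simp
        fix z assume "z \<in> A"
        then have z: "z \<in> closure A" using closure_subset by blast
        then have "\<not> dist 0 z < c" using c by (auto simp: subset_iff)
        then have 1: "c \<le> \<bar>z\<bar>" by (simp add: dist_real_def)
        have "2 * s * K \<le> z\<^sup>2"
          using ge[OF z] s by (auto simp: gauss_rate_def field_simps split: if_splits)
        then have "sqrt (2 * s * K) \<le> sqrt (z\<^sup>2)" by (rule real_sqrt_le_mono)
        with 1 show "\<rho> \<le> \<bar>z\<bar>" by (simp add: \<rho>_def)
      qed
      then show ?thesis by (simp add: K_def)
    qed
  qed
  then show "limsup (\<lambda>n. ereal (1 / v n) * eln (measure M {\<omega> \<in> space M. Z n \<omega> \<in> A})) \<le> - (INF x\<in>closure A. gauss_rate s x)"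
    unfolding L_def[symmetric] .
qed

end

section \<open>Generation-preserving permutations\<close>

lemma Tr_eq: "Tr r = {1..<2 ^ Suc r}"
proof (induction r)
  case 0
  then show ?case by (auto simp: Tr_def Gen_def)
next
  case (Suc r)
  have "Tr (Suc r) = Tr r \<union> Gen (Suc r)" by (auto simp: Tr_def le_Suc_eq)
  also have "\<dots> = {1..<2 ^ Suc (Suc r)}"
    unfolding Suc Gen_def by (rule ivl_disj_un_two(3)) (auto intro: power_increasing)
  finally show ?case .
qed

lemma Gen_unique: "i \<in> Gen q \<Longrightarrow> i \<in> Gen q' \<Longrightarrow> q = q'"
proof (induction q q' rule: linorder_wlog)
  case (le q q')
  show ?case
  proof (rule ccontr)
    assume "q \<noteq> q'"
    with le have "Suc q \<le> q'" by simp
    then have "(2::nat) ^ Suc q \<le> 2 ^ q'" by (intro power_increasing) auto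
    with le show False by (auto simp: Gen_def)
  qed
qed auto

lemma finite_Gen [simp]: "finite (Gen q)" and card_Gen [simp]: "card (Gen q) = 2 ^ q"
  by (auto simp: Gen_def)

lemma finite_Tr [simp]: "finite (Tr r)"
  by (simp add: Tr_eq)

text \<open>Fixing every vertex outside \<open>Tr r\<close> makes the set finite and gives each
  restriction of the random permutation to \<open>Tr r\<close> exactly one representative.\<close>

definition gen_perms :: "nat \<Rightarrow> (nat \<Rightarrow> nat) set" where
  "gen_perms r = {\<sigma>. (\<forall>q\<le>r. bij_betw \<sigma> (Gen q) (Gen q)) \<and> (\<forall>i. i \<notin> Tr r \<longrightarrow> \<sigma> i = i)}"

lemma gen_perms_permutes:
  assumes "\<sigma> \<in> gen_perms r" shows "\<sigma> permutes Tr r"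
proof (rule bij_imp_permutes)
  have b: "bij_betw \<sigma> (Gen q) (Gen q)" if "q \<le> r" for q using assms that by (auto simp: gen_perms_def)
  show "bij_betw \<sigma> (Tr r) (Tr r)"
    unfolding bij_betw_def
  proof
    show "inj_on \<sigma> (Tr r)"
    proof (rule inj_onI)
      fix i j assume ij: "i \<in> Tr r" "j \<in> Tr r" "\<sigma> i = \<sigma> j"
      then obtain q q' where q: "q \<le> r" "i \<in> Gen q" "q' \<le> r" "j \<in> Gen q'" by (auto simp: Tr_def)
      then have "\<sigma> i \<in> Gen q" "\<sigma> j \<in> Gen q'" using b by (auto simp: bij_betw_def)
      then have "q = q'" using ij Gen_unique by metis
      with q ij b[of q] show "i = j" by (auto simp: bij_betw_def inj_on_def)
    qed
    show "\<sigma> ` Tr r = Tr r"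
      unfolding Tr_def image_UN using b by (auto simp: bij_betw_def)
  qed
qed (use assms in \<open>auto simp: gen_perms_def\<close>)

lemma finite_gen_perms [simp]: "finite (gen_perms r)"
  by (rule finite_subset[OF _ finite_permutations[of "Tr r"]]) (auto intro: gen_perms_permutes)

lemma id_gen_perms: "id \<in> gen_perms r"
  by (auto simp: gen_perms_def)

lemma card_gen_perms_pos: "card (gen_perms r) > 0"
  using id_gen_perms by (auto simp: card_gt_0_iff)

section \<open>Hoeffding's lemma and sampling without replacement\<close>

lemma (in prob_space) expectation_exp_le_Hoeffding:
  fixes g :: "'a \<Rightarrow> real"
  assumes g: "g \<in> borel_measurable M" and bd: "\<And>x. x \<in> space M \<Longrightarrow> g x \<in> {l..u}"
  shows "expectation (\<lambda>x. exp (g x)) \<le> exp (expectation g + (u - l)\<^sup>2 / 8)"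
proof -
  interpret interval_bounded_random_variable M g l u
    using g bd by unfold_locales auto
  let ?e = "expectation g"
  have int: "integrable M (\<lambda>x. exp (g x))"
    using bd by (intro integrable_const_bound[where B="exp u"]) (auto intro!: AE_I2)
  have "ennreal (expectation (\<lambda>x. exp (g x - ?e))) = (\<integral>\<^sup>+ x. exp (1 * (g x - ?e)) \<partial>M)"
    using int by (subst nn_integral_eq_integral) (auto simp: exp_diff)
  also have "\<dots> \<le> ennreal (exp ((u - l)\<^sup>2 / 8))"
    using Hoeffdings_lemma_nn_integral[of 1] by simp
  finally have "expectation (\<lambda>x. exp (g x - ?e)) \<le> exp ((u - l)\<^sup>2 / 8)" by simp
  then have "exp ?e * expectation (\<lambda>x. exp (g x - ?e)) \<le> exp ?e * exp ((u - l)\<^sup>2 / 8)"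
    by (intro mult_left_mono) auto
  then show ?thesis using int by (simp add: exp_diff exp_add)
qed

lemma sum_exp_le_Hoeffding:
  fixes a :: "'b \<Rightarrow> real"
  assumes J: "finite J" "J \<noteq> {}" and a: "\<And>j. j \<in> J \<Longrightarrow> a j \<in> {l..u}"
  shows "(\<Sum>j\<in>J. exp (a j)) \<le> card J * exp ((\<Sum>j\<in>J. a j) / card J + (u - l)\<^sup>2 / 8)"
proof -
  \<comment> \<open>The space of a \<open>pmf\<close> is the whole type, so the range condition has
    to hold off \<open>J\<close> too; \<open>l\<close> is a harmless default there.\<close>
  define b where "b j = (if j \<in> J then a j else l)" for j
  obtain j0 where "j0 \<in> J" using J by auto
  then have lu: "l \<le> u" using a[of j0] by auto
  have eq: "(\<Sum>j\<in>J. h (b j)) = (\<Sum>j\<in>J. h (a j))" for h :: "real \<Rightarrow> real"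
    by (intro sum.cong) (auto simp: b_def)
  have "measure_pmf.expectation (pmf_of_set J) (\<lambda>j. exp (b j))
      \<le> exp (measure_pmf.expectation (pmf_of_set J) b + (u - l)\<^sup>2 / 8)"
    using a lu by (intro measure_pmf.expectation_exp_le_Hoeffding) (auto simp: b_def)
  then have "(\<Sum>j\<in>J. exp (a j)) / card J \<le> exp ((\<Sum>j\<in>J. a j) / card J + (u - l)\<^sup>2 / 8)"
    using eq[of exp] eq[of "\<lambda>x. x"] J by (simp add: integral_pmf_of_set)
  then show ?thesis using J by (simp add: field_simps card_gt_0_iff)
qed

text \<open>The source of exchangeability: composing with a swap of two last-generation positions is
  an involution of \<open>gen_perms r\<close>, so it may be used to reindex sums over this
  set.\<close>

lemma gen_perms_transpose:
  assumes \<sigma>: "\<sigma> \<in> gen_perms r" and ij: "i \<in> Gen r" "j \<in> Gen r"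
  shows "\<sigma> \<circ> Transposition.transpose i j \<in> gen_perms r"
  unfolding gen_perms_def
proof (intro CollectI conjI allI impI)
  fix q assume q: "q \<le> r"
  have "Transposition.transpose i j permutes Gen q \<or> q \<noteq> r"
    using ij by (auto intro: permutes_swap_id)
  moreover have "bij_betw (Transposition.transpose i j) (Gen q) (Gen q)" if "q \<noteq> r"
  proof -
    have "i \<notin> Gen q" "j \<notin> Gen q" using ij Gen_unique that by metis+
    then show ?thesis by (intro bij_betw_cong[THEN iffD2, OF _ bij_betw_id]) (auto simp: Transposition.transpose_def split: if_splits)
  qed
  ultimately have "bij_betw (Transposition.transpose i j) (Gen q) (Gen q)"
    by (auto intro: permutes_imp_bij)
  moreover have "bij_betw \<sigma> (Gen q) (Gen q)" using \<sigma> q by (auto simp: gen_perms_def)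
  ultimately show "bij_betw (\<sigma> \<circ> Transposition.transpose i j) (Gen q) (Gen q)" by (rule bij_betw_trans)
next
  fix k assume k: "k \<notin> Tr r"
  then have "k \<noteq> i" "k \<noteq> j" using ij by (auto simp: Tr_def)
  then show "(\<sigma> \<circ> Transposition.transpose i j) k = k"
    using \<sigma> k by (auto simp: gen_perms_def Transposition.transpose_def)
qed

text \<open>Sampling without replacement is handled one draw at a time: by exchangeability the next
  draw is uniform among the remaining indices, so its conditional mean is a negative multiple of
  the partial sum already drawn, which only shrinks the exponent.\<close>

lemma gen_perms_exp_sum_centered:
  fixes a :: "nat \<Rightarrow> real"
  assumes a: "\<And>i. i \<in> Gen r \<Longrightarrow> a i \<in> {l..u}" and a0: "(\<Sum>i\<in>Gen r. a i) = 0"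
    and k: "k \<le> 2 ^ r"
  shows "(\<Sum>\<sigma>\<in>gen_perms r. exp (\<kappa> * (\<Sum>i=2^r..<2^r+k. a (\<sigma> i))))
    \<le> card (gen_perms r) * exp (k * \<kappa>\<^sup>2 * (u - l)\<^sup>2 / 8)"
  using k
proof (induction k arbitrary: \<kappa>)
  case 0
  then show ?case by simp
next
  case (Suc k)
  define T where "T \<sigma> = (\<Sum>i=2^r..<2^r+k. a (\<sigma> i))" for \<sigma> :: "nat \<Rightarrow> nat"
  define J :: "nat set" where "J = {2^r+k..<2^Suc r}"
  let ?j0 = "2^r+k"
  have J: "finite J" "J \<noteq> {}" "?j0 \<in> J" "J \<subseteq> Gen r" using Suc.prems by (auto simp: J_def Gen_def)
  have cJ: "real (card J) \<ge> 1" using J by (metis One_nat_def Suc_leI card_gt_0_iff of_nat_1 of_nat_le_iff)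
  let ?W = "\<Sum>\<sigma>\<in>gen_perms r. exp (\<kappa> * (\<Sum>i=2^r..<2^r+Suc k. a (\<sigma> i)))"
  have W: "?W = (\<Sum>\<sigma>\<in>gen_perms r. exp (\<kappa> * T \<sigma>) * exp (\<kappa> * a (\<sigma> j)))" if j: "j \<in> J" for j
  proof -
    let ?t = "Transposition.transpose ?j0 j"
    have jG: "?j0 \<in> Gen r" "j \<in> Gen r" using j J by auto
    have Tt: "T (\<sigma> \<circ> ?t) = T \<sigma>" for \<sigma>
      unfolding T_def using j by (intro sum.cong) (auto simp: Transposition.transpose_def J_def)
    have "?W = (\<Sum>\<sigma>\<in>gen_perms r. exp (\<kappa> * T \<sigma>) * exp (\<kappa> * a (\<sigma> ?j0)))"
      by (simp add: T_def algebra_simps exp_add)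
    also have "\<dots> = (\<Sum>\<sigma>\<in>gen_perms r. exp (\<kappa> * T \<sigma>) * exp (\<kappa> * a (\<sigma> j)))"
      by (rule sum.reindex_bij_witness[where i="\<lambda>\<sigma>. \<sigma> \<circ> ?t" and j="\<lambda>\<sigma>. \<sigma> \<circ> ?t"])
        (use gen_perms_transpose[OF _ jG] in \<open>auto simp: Tt comp_assoc\<close>)
    finally show ?thesis .
  qed
  have sumJ: "(\<Sum>j\<in>J. a (\<sigma> j)) = - T \<sigma>" if \<sigma>: "\<sigma> \<in> gen_perms r" for \<sigma>
  proof -
    have "(\<Sum>i\<in>Gen r. a (\<sigma> i)) = (\<Sum>i\<in>Gen r. a i)"
      using \<sigma> by (intro sum.reindex_bij_betw) (auto simp: gen_perms_def)
    moreover have "(\<Sum>i\<in>Gen r. a (\<sigma> i)) = T \<sigma> + (\<Sum>j\<in>J. a (\<sigma> j))"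
      unfolding T_def J_def Gen_def using Suc.prems by (subst sum.atLeastLessThan_concat) auto
    ultimately show ?thesis using a0 by simp
  qed
  \<comment> \<open>The slope left on \<open>T \<sigma>\<close> once the mean
    \<open>- T \<sigma> / card J\<close> of the next draw is added. The induction hypothesis is
    applied at this smaller slope, which is why \<open>\<kappa>\<close> is kept arbitrary.\<close>
  let ?\<kappa> = "\<kappa> * (1 - 1 / card J)"
  let ?v = "\<kappa>\<^sup>2 * (u - l)\<^sup>2 / 8"
  have \<kappa>2: "?\<kappa>\<^sup>2 \<le> \<kappa>\<^sup>2"
  proof -
    have "(1 - 1 / real (card J))\<^sup>2 \<le> 1" using cJ by (intro power_le_one) (auto simp: field_simps)
    then show ?thesis using mult_left_mono[of "(1 - 1 / real (card J))\<^sup>2" 1 "\<kappa>\<^sup>2"] by (simp add: power_mult_distrib)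
  qed
  have "card J * ?W = (\<Sum>j\<in>J. ?W)" by simp
  also have "\<dots> = (\<Sum>j\<in>J. \<Sum>\<sigma>\<in>gen_perms r. exp (\<kappa> * T \<sigma>) * exp (\<kappa> * a (\<sigma> j)))"
    by (rule sum.cong[OF refl]) (rule W)
  also have "\<dots> = (\<Sum>\<sigma>\<in>gen_perms r. exp (\<kappa> * T \<sigma>) * (\<Sum>j\<in>J. exp (\<kappa> * a (\<sigma> j))))"
    by (subst sum.swap) (simp add: sum_distrib_left)
  also have "\<dots> \<le> (\<Sum>\<sigma>\<in>gen_perms r. exp (\<kappa> * T \<sigma>) * (card J * exp (- \<kappa> * T \<sigma> / card J + ?v)))"
  proof (intro sum_mono mult_left_mono)
    fix \<sigma> assume \<sigma>: "\<sigma> \<in> gen_perms r"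
    have in_lu: "a (\<sigma> j) \<in> {l..u}" if "j \<in> J" for j
    proof -
      have "\<sigma> j \<in> Gen r" using \<sigma> that J by (auto simp: gen_perms_def bij_betw_def)
      then show ?thesis by (rule a)
    qed
    have "(\<Sum>j\<in>J. exp (\<kappa> * a (\<sigma> j))) \<le> card J * exp ((\<Sum>j\<in>J. \<kappa> * a (\<sigma> j)) / card J
        + (max (\<kappa> * l) (\<kappa> * u) - min (\<kappa> * l) (\<kappa> * u))\<^sup>2 / 8)"
    proof (rule sum_exp_le_Hoeffding[OF J(1,2)])
      fix j assume "j \<in> J"
      from in_lu[OF this] show "\<kappa> * a (\<sigma> j) \<in> {min (\<kappa> * l) (\<kappa> * u)..max (\<kappa> * l) (\<kappa> * u)}"
        by (cases "\<kappa> \<ge> 0") (auto simp: mult_left_mono mult_left_mono_neg min_le_iff_disj le_max_iff_disj)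
    qed
    also have "(max (\<kappa> * l) (\<kappa> * u) - min (\<kappa> * l) (\<kappa> * u))\<^sup>2 = \<kappa>\<^sup>2 * (u - l)\<^sup>2"
      by (auto simp: max_def min_def power2_eq_square algebra_simps)
    also have "(\<Sum>j\<in>J. \<kappa> * a (\<sigma> j)) = - \<kappa> * T \<sigma>"
      using sumJ[OF \<sigma>] by (simp flip: sum_distrib_left)
    finally show "(\<Sum>j\<in>J. exp (\<kappa> * a (\<sigma> j))) \<le> card J * exp (- \<kappa> * T \<sigma> / card J + ?v)" .
  qed simp
  also have "\<dots> = card J * (exp ?v * (\<Sum>\<sigma>\<in>gen_perms r. exp (?\<kappa> * T \<sigma>)))"
    unfolding sum_distrib_left by (intro sum.cong) (auto simp: algebra_simps simp flip: exp_add)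
  finally have "?W \<le> exp ?v * (\<Sum>\<sigma>\<in>gen_perms r. exp (?\<kappa> * T \<sigma>))"
    using cJ by (subst (asm) mult_le_cancel_left) auto
  also have "\<dots> \<le> exp ?v * (card (gen_perms r) * exp (k * ?\<kappa>\<^sup>2 * (u - l)\<^sup>2 / 8))"
    unfolding T_def using Suc.prems by (intro mult_left_mono Suc.IH) auto
  also have "\<dots> \<le> exp ?v * (card (gen_perms r) * exp (k * \<kappa>\<^sup>2 * (u - l)\<^sup>2 / 8))"
    using \<kappa>2 by (intro mult_left_mono) (auto intro!: mult_left_mono mult_right_mono divide_right_mono)
  also have "\<dots> = card (gen_perms r) * exp (Suc k * \<kappa>\<^sup>2 * (u - l)\<^sup>2 / 8)"
    by (simp add: algebra_simps add_divide_distrib flip: exp_add)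
  finally show ?case .
qed

text \<open>Centring by the generation mean \<open>m\<close> reduces to the previous bound, and
  putting \<open>k * m\<close> back gives the sampled fraction \<open>k / 2 ^ r\<close> of the full
  sum. The range has width \<open>2 * B\<close>, and (2B)^2 / 8 = B^2 / 2.\<close>

lemma gen_perms_exp_sum:
  fixes a :: "nat \<Rightarrow> real"
  assumes a: "\<And>i. i \<in> Gen r \<Longrightarrow> \<bar>a i\<bar> \<le> B" and k: "k \<le> 2 ^ r"
  shows "(\<Sum>\<sigma>\<in>gen_perms r. exp (\<kappa> * (\<Sum>i=2^r..<2^r+k. a (\<sigma> i))))
    \<le> card (gen_perms r) * exp (\<kappa> * (k / 2 ^ r) * (\<Sum>i\<in>Gen r. a i) + k * \<kappa>\<^sup>2 * B\<^sup>2 / 2)"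
proof -
  define m where "m = (\<Sum>i\<in>Gen r. a i) / 2 ^ r"
  have "(\<Sum>\<sigma>\<in>gen_perms r. exp (\<kappa> * (\<Sum>i=2^r..<2^r+k. a (\<sigma> i) - m)))
    \<le> card (gen_perms r) * exp (k * \<kappa>\<^sup>2 * ((B - m) - (- B - m))\<^sup>2 / 8)"
  proof (rule gen_perms_exp_sum_centered[OF _ _ k])
    show "a i - m \<in> {- B - m..B - m}" if "i \<in> Gen r" for i using a[OF that] by auto
    show "(\<Sum>i\<in>Gen r. a i - m) = 0" by (simp add: sum_subtractf m_def)
  qed
  then have *: "exp (\<kappa> * k * m) * (\<Sum>\<sigma>\<in>gen_perms r. exp (\<kappa> * (\<Sum>i=2^r..<2^r+k. a (\<sigma> i) - m)))
    \<le> exp (\<kappa> * k * m) * (card (gen_perms r) * exp (k * \<kappa>\<^sup>2 * ((B - m) - (- B - m))\<^sup>2 / 8))"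
    by (rule mult_left_mono) simp
  have eq1: "exp (\<kappa> * k * m) * (\<Sum>\<sigma>\<in>gen_perms r. exp (\<kappa> * (\<Sum>i=2^r..<2^r+k. a (\<sigma> i) - m)))
     = (\<Sum>\<sigma>\<in>gen_perms r. exp (\<kappa> * (\<Sum>i=2^r..<2^r+k. a (\<sigma> i))))"
    unfolding sum_distrib_left by (intro sum.cong) (auto simp: algebra_simps sum_subtractf simp flip: exp_add)
  have eq2: "exp (\<kappa> * k * m) * (card (gen_perms r) * exp (k * \<kappa>\<^sup>2 * ((B - m) - (- B - m))\<^sup>2 / 8))
    = card (gen_perms r) * exp (\<kappa> * (k / 2 ^ r) * (\<Sum>i\<in>Gen r. a i) + k * \<kappa>\<^sup>2 * B\<^sup>2 / 2)"
    by (simp add: m_def power2_eq_square exp_add)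
  show ?thesis using * unfolding eq1 eq2 .
qed

section \<open>Conditioning on the random permutation\<close>

definition restrict_perm :: "nat \<Rightarrow> (nat \<Rightarrow> nat) \<Rightarrow> nat \<Rightarrow> nat" where
  "restrict_perm r p i = (if i \<in> Tr r then p i else i)"

lemma space_gen_sigma [simp]: "space (gen_sigma M X I) = space M"
  by (simp add: gen_sigma_def space_measure_of_conv)

lemma subalgebra_gen_sigma:
  assumes "\<And>i. i \<in> I \<Longrightarrow> X i \<in> M \<rightarrow>\<^sub>M borel"
  shows "subalgebra M (gen_sigma M X I)"
proof -
  have "{X i -` B \<inter> space M | i B. i \<in> I \<and> B \<in> sets borel} \<subseteq> sets M"
    using assms by (auto intro: measurable_sets)
  moreover have "{X i -` B \<inter> space M | i B. i \<in> I \<and> B \<in> sets borel} \<subseteq> Pow (space M)" by auto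
  ultimately show ?thesis
    unfolding subalgebra_def gen_sigma_def
    by (simp add: space_measure_of_conv sets_measure_of sets.sigma_sets_subset)
qed

lemma measurable_gen_sigma:
  fixes X :: "nat \<Rightarrow> 'w \<Rightarrow> 'b::topological_space"
  assumes "i \<in> I" shows "X i \<in> gen_sigma M X I \<rightarrow>\<^sub>M borel"
proof (rule measurableI)
  have sub: "{X i -` B \<inter> space M | i B. i \<in> I \<and> B \<in> sets borel} \<subseteq> Pow (space M)" by auto
  fix B :: "'b set" assume "B \<in> sets borel"
  then show "X i -` B \<inter> space (gen_sigma M X I) \<in> sets (gen_sigma M X I)"
    using assms unfolding gen_sigma_def sets_measure_of[OF sub] space_measure_of_conv
    by (intro sigma_sets.Basic) auto
qed simp

text \<open>Independence of \<open>E\<close> from the sets of \<open>F\<close> means that the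
  conditional expectation of its indicator is the constant \<open>prob E\<close>; pulling the
  \<open>F\<close>-measurable \<open>h\<close> through replaces a monotone class argument.\<close>

lemma (in prob_space) integral_indicator_indep_subalgebra:
  fixes h :: "'a \<Rightarrow> real"
  assumes F: "subalgebra M F" and E: "E \<in> events"
    and ind: "\<And>A. A \<in> sets F \<Longrightarrow> prob (E \<inter> A) = prob E * prob A"
    and h: "h \<in> borel_measurable F" and bd: "\<And>x. \<bar>h x\<bar> \<le> B"
  shows "expectation (\<lambda>x. indicator E x * h x) = prob E * expectation h"
proof -
  interpret finite_measure_subalgebra M F using F by unfold_locales
  have hM: "h \<in> borel_measurable M" using measurable_from_subalg[OF F h] .
  have FM: "A \<in> events" if "A \<in> sets F" for A using F that by (auto simp: subalgebra_def)
  have "AE x in M. real_cond_exp M F (indicator E) x = prob E"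
  proof (rule real_cond_exp_charact)
    fix A assume A: "A \<in> sets F"
    have "(\<integral>x\<in>A. indicat_real E x \<partial>M) = prob (E \<inter> A)"
      using E FM[OF A] by (simp add: set_lebesgue_integral_def Int_commute flip: indicator_inter_arith)
    moreover have "(\<integral>x\<in>A. prob E \<partial>M) = prob E * prob A"
      using FM[OF A] by (simp add: set_lebesgue_integral_def)
    ultimately show "(\<integral>x\<in>A. indicat_real E x \<partial>M) = (\<integral>x\<in>A. prob E \<partial>M)" using ind[OF A] by simp
  qed (use E in \<open>auto intro!: integrable_real_indicator simp: emeasure_eq_measure\<close>)
  then have "expectation (\<lambda>x. h x * real_cond_exp M F (indicator E) x) = expectation (\<lambda>x. h x * prob E)"
    by (intro integral_cong_AE) (use hM in \<open>auto elim!: eventually_mono\<close>)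
  moreover have "expectation (\<lambda>x. h x * real_cond_exp M F (indicator E) x) = expectation (\<lambda>x. h x * indicator E x)"
  proof (rule real_cond_exp_intg(2))
    show "integrable M (\<lambda>x. h x * indicat_real E x)"
      using hM E bd by (intro integrable_const_bound[where B=B]) (auto simp: indicator_def intro!: AE_I2 order_trans[OF abs_ge_zero bd])
  qed (use h E in auto)
  ultimately show ?thesis by (simp add: mult.commute)
qed

locale random_perm = prob_space M for M :: "'w measure" +
  fixes X :: "nat \<Rightarrow> 'w \<Rightarrow> 'a::metric_space" and \<pi> :: "'w \<Rightarrow> nat \<Rightarrow> nat"
  assumes X_meas: "i \<ge> 1 \<Longrightarrow> X i \<in> M \<rightarrow>\<^sub>M borel"
    and rgp: "random_gen_perm M X \<pi>"
begin

definition perm_event :: "nat \<Rightarrow> (nat \<Rightarrow> nat) \<Rightarrow> 'w set" where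
  "perm_event r \<sigma> = {\<omega>\<in>space M. \<forall>i\<in>Tr r. \<pi> \<omega> i = \<sigma> i}"

lemma sub_all: "subalgebra M (gen_sigma M X {1..})"
  using X_meas by (intro subalgebra_gen_sigma) auto

lemma perm_event:
  assumes "\<sigma> \<in> gen_perms r"
  shows "perm_event r \<sigma> \<in> events"
    and "A \<in> sets (gen_sigma M X {1..}) \<Longrightarrow>
      prob (perm_event r \<sigma> \<inter> A) = prob A / (\<Prod>q\<le>r. fact (2^q))"
  using rgp assms unfolding random_gen_perm_def perm_event_def gen_perms_def by blast+

lemma prob_perm_event:
  assumes "\<sigma> \<in> gen_perms r" shows "prob (perm_event r \<sigma>) = 1 / (\<Prod>q\<le>r. fact (2^q))"
proof -
  have "space M \<in> sets (gen_sigma M X {1..})" using sets.top[of "gen_sigma M X {1..}"] by simp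
  from perm_event(2)[OF assms this] show ?thesis
    using sets.sets_into_space[OF perm_event(1)[OF assms]] by (simp add: Int_absorb2 prob_space)
qed

lemma restrict_perm_in:
  assumes "\<omega> \<in> space M" shows "restrict_perm r (\<pi> \<omega>) \<in> gen_perms r"
proof -
  have "bij_betw (restrict_perm r (\<pi> \<omega>)) (Gen q) (Gen q)" if "q \<le> r" for q
  proof -
    have "bij_betw (\<pi> \<omega>) (Gen q) (Gen q)" using rgp assms by (auto simp: random_gen_perm_def)
    moreover have "Gen q \<subseteq> Tr r" using that by (auto simp: Tr_def)
    ultimately show ?thesis
      by (subst bij_betw_cong[where g="\<pi> \<omega>"]) (auto simp: restrict_perm_def)
  qed
  then show ?thesis by (auto simp: gen_perms_def restrict_perm_def)
qed

lemma in_perm_event_iff: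
  assumes "\<omega> \<in> space M" "\<sigma> \<in> gen_perms r"
  shows "\<omega> \<in> perm_event r \<sigma> \<longleftrightarrow> restrict_perm r (\<pi> \<omega>) = \<sigma>"
  using assms by (auto simp: perm_event_def restrict_perm_def fun_eq_iff gen_perms_def)

text \<open>The finitely many events \<open>perm_event r \<sigma>\<close> partition the space, so a
  quantity evaluated at the random permutation splits into terms with a fixed one. Measurability and
  expectations are both read off from this sum.\<close>

lemma perm_decomp:
  fixes h :: "(nat \<Rightarrow> nat) \<Rightarrow> 'w \<Rightarrow> real"
  assumes "\<omega> \<in> space M"
  shows "h (restrict_perm r (\<pi> \<omega>)) \<omega> = (\<Sum>\<sigma>\<in>gen_perms r. indicator (perm_event r \<sigma>) \<omega> * h \<sigma> \<omega>)"
proof -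
  have "(\<Sum>\<sigma>\<in>gen_perms r. indicator (perm_event r \<sigma>) \<omega> * h \<sigma> \<omega>)
     = (\<Sum>\<sigma>\<in>gen_perms r. if \<sigma> = restrict_perm r (\<pi> \<omega>) then h \<sigma> \<omega> else 0)"
    using in_perm_event_iff[OF assms] by (intro sum.cong) (auto simp: indicator_def)
  also have "\<dots> = h (restrict_perm r (\<pi> \<omega>)) \<omega>"
    using restrict_perm_in[OF assms] by simp
  finally show ?thesis ..
qed

lemma measurable_perm:
  fixes h :: "(nat \<Rightarrow> nat) \<Rightarrow> 'w \<Rightarrow> real"
  assumes "\<And>\<sigma>. \<sigma> \<in> gen_perms r \<Longrightarrow> h \<sigma> \<in> borel_measurable M"
  shows "(\<lambda>\<omega>. h (restrict_perm r (\<pi> \<omega>)) \<omega>) \<in> borel_measurable M"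
proof -
  have "(\<lambda>\<omega>. \<Sum>\<sigma>\<in>gen_perms r. indicator (perm_event r \<sigma>) \<omega> * h \<sigma> \<omega>) \<in> borel_measurable M"
    using assms perm_event(1)
    by (intro borel_measurable_sum borel_measurable_times borel_measurable_indicator) auto
  then show ?thesis by (subst measurable_cong[OF perm_decomp])
qed

text \<open>No counting is involved: the events \<open>perm_event r \<sigma>\<close> partition the
  space and have equal known probabilities, so total mass 1 yields their number.\<close>

lemma card_gen_perms_eq: "(\<Prod>q\<le>r. fact (2^q)) = real (card (gen_perms r))"
proof -
  have "expectation (\<lambda>\<omega>. \<Sum>\<sigma>\<in>gen_perms r. indicat_real (perm_event r \<sigma>) \<omega>) = expectation (\<lambda>\<omega>. 1 :: real)"
    using perm_decomp[where h="\<lambda>_ _. 1", of _ r, symmetric]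
    by (intro Bochner_Integration.integral_cong) auto
  then have "1 = expectation (\<lambda>\<omega>. \<Sum>\<sigma>\<in>gen_perms r. indicat_real (perm_event r \<sigma>) \<omega>)"
    by (simp add: prob_space)
  also have "\<dots> = (\<Sum>\<sigma>\<in>gen_perms r. prob (perm_event r \<sigma>))"
    using perm_event(1) by (subst Bochner_Integration.integral_sum)
      (auto intro!: integrable_real_indicator simp: emeasure_eq_measure)
  also have "\<dots> = card (gen_perms r) / (\<Prod>q\<le>r. fact (2^q))" by (simp add: prob_perm_event)
  finally show ?thesis by (simp add: field_simps)
qed

text \<open>Integrates out the permutation: since it is uniform and independent of the chain, what
  remains is the plain average over deterministic \<open>\<sigma>\<close>, for which the Markov
  property is available.\<close>

lemma expectation_perm:
  fixes h :: "(nat \<Rightarrow> nat) \<Rightarrow> 'w \<Rightarrow> real"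
  assumes h: "\<And>\<sigma>. \<sigma> \<in> gen_perms r \<Longrightarrow> h \<sigma> \<in> borel_measurable (gen_sigma M X {1..})"
    and bd: "\<And>\<sigma> \<omega>. \<bar>h \<sigma> \<omega>\<bar> \<le> B"
  shows "expectation (\<lambda>\<omega>. h (restrict_perm r (\<pi> \<omega>)) \<omega>) = (\<Sum>\<sigma>\<in>gen_perms r. expectation (h \<sigma>)) / card (gen_perms r)"
proof -
  have hM: "h \<sigma> \<in> borel_measurable M" if "\<sigma> \<in> gen_perms r" for \<sigma>
    using measurable_from_subalg[OF sub_all h[OF that]] .
  have int: "integrable M (\<lambda>\<omega>. indicator (perm_event r \<sigma>) \<omega> * h \<sigma> \<omega>)" if "\<sigma> \<in> gen_perms r" for \<sigma>
    using hM[OF that] perm_event(1)[OF that] bd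
    by (intro integrable_const_bound[where B=B]) (auto simp: indicator_def intro!: AE_I2 order_trans[OF abs_ge_zero bd])
  have "expectation (\<lambda>\<omega>. h (restrict_perm r (\<pi> \<omega>)) \<omega>)
      = expectation (\<lambda>\<omega>. \<Sum>\<sigma>\<in>gen_perms r. indicator (perm_event r \<sigma>) \<omega> * h \<sigma> \<omega>)"
    by (intro Bochner_Integration.integral_cong refl perm_decomp)
  also have "\<dots> = (\<Sum>\<sigma>\<in>gen_perms r. expectation (\<lambda>\<omega>. indicator (perm_event r \<sigma>) \<omega> * h \<sigma> \<omega>))"
    using int by (intro Bochner_Integration.integral_sum) auto
  also have "\<dots> = (\<Sum>\<sigma>\<in>gen_perms r. prob (perm_event r \<sigma>) * expectation (h \<sigma>))"
    using perm_event h bd prob_perm_event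
    by (intro sum.cong refl integral_indicator_indep_subalgebra[OF sub_all]) auto
  also have "\<dots> = (\<Sum>\<sigma>\<in>gen_perms r. expectation (h \<sigma>)) / card (gen_perms r)"
    by (simp add: prob_perm_event card_gen_perms_eq sum_divide_distrib)
  finally show ?thesis .
qed

end

section \<open>The bifurcating Markov chain\<close>

lemma bounded_measE:
  assumes "bounded_meas N g"
  obtains B where "B \<ge> 0" "\<And>x. \<bar>g x\<bar> \<le> B" "g \<in> borel_measurable N"
proof -
  from assms obtain B where "\<And>x. \<bar>g x\<bar> \<le> B"
    unfolding bounded_meas_def bounded_iff by auto
  moreover from this[of undefined] have "B \<ge> 0" by linarith
  ultimately show thesis using assms that by (auto simp: bounded_meas_def)
qed

lemma bounded_measI:
  "g \<in> borel_measurable N \<Longrightarrow> (\<And>x. \<bar>g x\<bar> \<le> B) \<Longrightarrow> bounded_meas N g"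
  unfolding bounded_meas_def bounded_iff by auto

lemma bounded_meas_add:
  assumes "bounded_meas N f" "bounded_meas N g" shows "bounded_meas N (\<lambda>x. f x + g x)"
proof -
  obtain A where A: "\<And>x. \<bar>f x\<bar> \<le> A" by (rule bounded_measE[OF assms(1)]) blast
  obtain B where B: "\<And>x. \<bar>g x\<bar> \<le> B" by (rule bounded_measE[OF assms(2)]) blast
  have "\<bar>f x + g x\<bar> \<le> A + B" for x using A[of x] B[of x] by linarith
  then show ?thesis using assms by (intro bounded_measI) (auto simp: bounded_meas_def)
qed

lemma bounded_meas_cmult:
  assumes "bounded_meas N f" shows "bounded_meas N (\<lambda>x. c * f x)"
proof -
  obtain A where "\<And>x. \<bar>f x\<bar> \<le> A" by (rule bounded_measE[OF assms]) blast
  then have "\<bar>c * f x\<bar> \<le> \<bar>c\<bar> * A" for x by (simp add: abs_mult mult_left_mono)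
  then show ?thesis using assms by (intro bounded_measI) (auto simp: bounded_meas_def)
qed

lemma bounded_meas_const: "bounded_meas N (\<lambda>x. c)"
  by (rule bounded_measI[where B="\<bar>c\<bar>"]) auto

lemma bounded_meas_exp:
  assumes "bounded_meas N f" shows "bounded_meas N (\<lambda>x. exp (f x))"
proof -
  obtain A where "\<And>x. \<bar>f x\<bar> \<le> A" by (rule bounded_measE[OF assms]) blast
  then have "\<bar>exp (f x)\<bar> \<le> exp A" for x by (simp add: abs_le_iff)
  then show ?thesis using assms by (intro bounded_measI) (auto simp: bounded_meas_def)
qed

lemma bounded_meas_compose:
  assumes "bounded_meas N g" "T \<in> N' \<rightarrow>\<^sub>M N" shows "bounded_meas N' (\<lambda>x. g (T x))"
proof -
  obtain A where "\<And>x. \<bar>g x\<bar> \<le> A" by (rule bounded_measE[OF assms(1)]) blast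
  then show ?thesis using assms by (intro bounded_measI) (auto simp: bounded_meas_def)
qed

lemma bounded_meas_daughters:
  fixes h :: "'a::metric_space \<Rightarrow> real"
  assumes "bounded_meas borel h"
  shows "bounded_meas S3 (\<lambda>t. h (fst (snd t)))" "bounded_meas S3 (\<lambda>t. h (snd (snd t)))"
    "bounded_meas S3 (\<lambda>t. h (fst t))"
  using assms by (auto intro!: bounded_meas_compose[OF assms])

section \<open>Operators of the transition kernel\<close>

locale transition =
  fixes P :: "'a::metric_space \<Rightarrow> ('a \<times> 'a) measure"
  assumes T_transition: "T_transition P"
begin

lemma P_kernel [measurable]: "P \<in> borel \<rightarrow>\<^sub>M prob_algebra S2"
  using T_transition by (simp add: T_transition_def)

lemma P_prob: "prob_space (P x)" and sets_P [measurable_cong]: "sets (P x) = sets S2"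
proof -
  have "P x \<in> space (prob_algebra S2)" using measurable_space[OF P_kernel, of x] by simp
  then show "prob_space (P x)" "sets (P x) = sets S2" by (auto simp: space_prob_algebra)
qed

lemma measurable_section:
  fixes f :: "'a \<times> 'a \<times> 'a \<Rightarrow> real"
  assumes "f \<in> borel_measurable S3"
  shows "(\<lambda>yz. f (x, fst yz, snd yz)) \<in> borel_measurable (P x)"
proof -
  have [measurable]: "f \<in> borel_measurable S3" by fact
  have "(\<lambda>yz. f (x, fst yz, snd yz)) \<in> borel_measurable S2" by measurable
  then show ?thesis by (simp cong: measurable_cong_sets add: sets_P)
qed

lemma integrable_section:
  assumes "bounded_meas S3 f" shows "integrable (P x) (\<lambda>yz. f (x, fst yz, snd yz))"
proof -
  interpret prob_space "P x" by (rule P_prob)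
  obtain B where "\<And>t. \<bar>f t\<bar> \<le> B" "f \<in> borel_measurable S3" by (rule bounded_measE[OF assms]) blast
  then show ?thesis using measurable_section by (intro integrable_const_bound[where B=B]) auto
qed

text \<open>Pushing \<open>P x\<close> forward under \<open>Pair x\<close> turns it into a kernel on
  triples, so that the dependence on \<open>x\<close> moves from the integrand into the measure,
  where measurability of kernel integrals applies.\<close>

lemma Pop_measurable:
  assumes f[measurable]: "f \<in> borel_measurable S3" shows "Pop P f \<in> borel_measurable borel"
proof -
  have [measurable]: "P \<in> borel \<rightarrow>\<^sub>M subprob_algebra S2" by (rule measurable_prob_algebraD[OF P_kernel])
  have eq: "Pop P f x = integral\<^sup>L (distr (P x) S3 (\<lambda>yz. (x, yz))) f" for x
    unfolding Pop_def by (subst integral_distr) auto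
  show ?thesis unfolding eq[abs_def]
  proof (rule measurable_compose[OF _ integral_measurable_subprob_algebra])
    show "(\<lambda>x. distr (P x) S3 (Pair x)) \<in> borel \<rightarrow>\<^sub>M subprob_algebra S3"
      by (rule measurable_distr2[where M=S2 and f=Pair]) auto
  qed fact
qed

lemma Pop_bound:
  assumes "bounded_meas S3 f" "\<And>t. \<bar>f t\<bar> \<le> B" shows "\<bar>Pop P f x\<bar> \<le> B"
proof -
  interpret prob_space "P x" by (rule P_prob)
  have "B \<ge> 0" using assms(2)[of undefined] by linarith
  have "\<bar>Pop P f x\<bar> \<le> (\<integral>yz. \<bar>f (x, fst yz, snd yz)\<bar> \<partial>P x)" unfolding Pop_def by (rule integral_abs_bound)
  also have "\<dots> \<le> (\<integral>yz. B \<partial>P x)"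
    using integrable_section[OF assms(1)] assms(2) by (intro integral_mono) auto
  finally show ?thesis by (simp add: prob_space)
qed

lemma bounded_meas_Pop:
  assumes "bounded_meas S3 f" shows "bounded_meas borel (Pop P f)"
proof -
  obtain B where "\<And>t. \<bar>f t\<bar> \<le> B" "f \<in> borel_measurable S3" by (rule bounded_measE[OF assms]) blast
  then show ?thesis using Pop_measurable Pop_bound[OF assms] by (intro bounded_measI[where B=B]) auto
qed

lemma Pop_mono:
  assumes "bounded_meas S3 f" "bounded_meas S3 f'" "\<And>y z. f (x, y, z) \<le> f' (x, y, z)"
  shows "Pop P f x \<le> Pop P f' x"
  unfolding Pop_def using assms integrable_section by (intro integral_mono) auto

lemma Pop_add:
  assumes "bounded_meas S3 f" "bounded_meas S3 f'"
  shows "Pop P (\<lambda>t. f t + f' t) x = Pop P f x + Pop P f' x"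
  unfolding Pop_def using assms integrable_section by (intro Bochner_Integration.integral_add) auto

lemma Pop_cmult: "Pop P (\<lambda>t. c * f t) x = c * Pop P f x"
  unfolding Pop_def by simp

lemma Pop_parent_mult: "Pop P (\<lambda>t. u (fst t) * f t) x = u x * Pop P f x"
  unfolding Pop_def by simp

lemma Pop_const [simp]: "Pop P (\<lambda>t. c) x = c"
  unfolding Pop_def using P_prob[of x] by (simp add: prob_space.prob_space)

lemma Qop_eq_Pop:
  "Qop P g x = (Pop P (\<lambda>t. g (fst (snd t))) x + Pop P (\<lambda>t. g (snd (snd t))) x) / 2"
  by (simp add: Qop_def Pop_def)

lemma bounded_meas_Qop:
  assumes "bounded_meas borel g" shows "bounded_meas borel (Qop P g)"
  unfolding Qop_eq_Pop[abs_def]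
  using bounded_meas_cmult[OF bounded_meas_add[OF bounded_meas_daughters(1,2)[OF assms, THEN bounded_meas_Pop]], of "1/2"]
  by simp

lemma bounded_meas_Qop_funpow:
  "bounded_meas borel g \<Longrightarrow> bounded_meas borel ((Qop P ^^ l) g)"
  by (induction l) (auto intro: bounded_meas_Qop)

lemma Qop_add:
  assumes "bounded_meas borel g" "bounded_meas borel h"
  shows "Qop P (\<lambda>x. g x + h x) x = Qop P g x + Qop P h x"
  unfolding Qop_eq_Pop using bounded_meas_daughters[OF assms(1)] bounded_meas_daughters[OF assms(2)]
  by (simp add: Pop_add add_divide_distrib)

lemma Qop_cmult: "Qop P (\<lambda>x. c * g x) x = c * Qop P g x"
  unfolding Qop_eq_Pop by (simp add: Pop_cmult algebra_simps)

lemma Qop_sum: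
  assumes "\<And>l. bounded_meas borel (G l)"
  shows "bounded_meas borel (\<lambda>x. \<Sum>l<j::nat. G l x)"
    and "Qop P (\<lambda>x. \<Sum>l<j. G l x) x = (\<Sum>l<j. Qop P (G l) x)"
proof (induction j)
  case 0
  show "bounded_meas borel (\<lambda>x. \<Sum>l<0::nat. G l x)" by (simp add: bounded_meas_const)
  show "Qop P (\<lambda>x. \<Sum>l<0. G l x) x = (\<Sum>l<0. Qop P (G l) x)" by (simp add: Qop_def)
next
  case (Suc j)
  then show "bounded_meas borel (\<lambda>x. \<Sum>l<Suc j. G l x)"
    "Qop P (\<lambda>x. \<Sum>l<Suc j. G l x) x = (\<Sum>l<Suc j. Qop P (G l) x)"
    using assms by (auto intro: bounded_meas_add simp: Qop_add)
qed

text \<open>Hoeffding's lemma for the sum over both daughters taken as a single variable, whatever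
  their dependence. It ranges over an interval of length 4H, and (4H)^2 / 8 = 2 H^2; its mean given
  the mother is \<open>2 * Qop P h x\<close>.\<close>

lemma Pop_exp_daughters_le:
  assumes h: "bounded_meas borel h" and H: "\<And>x. \<bar>h x\<bar> \<le> H"
  shows "Pop P (\<lambda>t. exp (h (fst (snd t)) + h (snd (snd t)))) x \<le> exp (2 * Qop P h x + 2 * H\<^sup>2)"
proof -
  interpret prob_space "P x" by (rule P_prob)
  let ?g = "\<lambda>t :: 'a \<times> 'a \<times> 'a. h (fst (snd t)) + h (snd (snd t))"
  have b: "bounded_meas S3 ?g" by (intro bounded_meas_add bounded_meas_daughters h)
  have "expectation (\<lambda>yz. exp (?g (x, fst yz, snd yz)))
      \<le> exp (expectation (\<lambda>yz. ?g (x, fst yz, snd yz)) + (2 * H - (- (2 * H)))\<^sup>2 / 8)"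
  proof (rule expectation_exp_le_Hoeffding)
    show "(\<lambda>yz. ?g (x, fst yz, snd yz)) \<in> borel_measurable (P x)"
      using b by (intro measurable_section) (simp add: bounded_meas_def)
    show "?g (x, fst yz, snd yz) \<in> {- (2 * H)..2 * H}" for yz
      using H[of "fst yz"] H[of "snd yz"] by auto
  qed
  also have "expectation (\<lambda>yz. ?g (x, fst yz, snd yz)) = Pop P ?g x" by (simp add: Pop_def)
  also have "\<dots> = 2 * Qop P h x"
    by (subst Pop_add) (auto intro: bounded_meas_daughters h simp: Qop_eq_Pop)
  also have "(2 * H - (- (2 * H)))\<^sup>2 / 8 = 2 * H\<^sup>2" by (simp add: power2_eq_square)
  finally show ?thesis by (simp add: Pop_def)
qed

text \<open>Integrating out the last generation turns its weight \<open>h\<close> into the weight \<open>g + 2 Q h\<close> on the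
  generation above it.\<close>

definition Uop :: "('a \<Rightarrow> real) \<Rightarrow> ('a \<Rightarrow> real) \<Rightarrow> 'a \<Rightarrow> real" where
  "Uop g h x = g x + 2 * Qop P h x"

lemma bounded_meas_Uop:
  "bounded_meas borel g \<Longrightarrow> bounded_meas borel h \<Longrightarrow> bounded_meas borel (Uop g h)"
  unfolding Uop_def[abs_def] by (intro bounded_meas_add bounded_meas_cmult bounded_meas_Qop)

text \<open>The initial weight \<open>\<kappa> * \<tau> * g\<close> on the last generation models
  the sampling of only a fraction \<open>\<tau>\<close> of it; full generations carry
  \<open>\<kappa> * g\<close>. Each step doubles and applies \<open>Qop P\<close>, shifting every
  index by one and freeing the term \<open>l = 0\<close> for the new \<open>g\<close>.\<close>

lemma Uop_funpow:
  assumes g: "bounded_meas borel g"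
  shows "(Uop (\<lambda>x. \<kappa> * g x) ^^ j) (\<lambda>x. \<kappa> * \<tau> * g x)
    = (\<lambda>x. \<kappa> * ((\<Sum>l<j. 2 ^ l * (Qop P ^^ l) g x) + \<tau> * 2 ^ j * (Qop P ^^ j) g x))"
proof (induction j)
  case 0
  then show ?case by (simp add: mult.assoc)
next
  case (Suc j)
  let ?G = "\<lambda>l. (Qop P ^^ l) g"
  note b = bounded_meas_Qop_funpow[OF g]
  show ?case
  proof
    fix x
    have "(Uop (\<lambda>x. \<kappa> * g x) ^^ Suc j) (\<lambda>x. \<kappa> * \<tau> * g x) x
      = \<kappa> * g x + 2 * Qop P (\<lambda>x. \<kappa> * ((\<Sum>l<j. 2 ^ l * ?G l x) + \<tau> * 2 ^ j * ?G j x)) x"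
      by (simp add: Suc Uop_def)
    also have "Qop P (\<lambda>x. \<kappa> * ((\<Sum>l<j. 2 ^ l * ?G l x) + \<tau> * 2 ^ j * ?G j x)) x
      = \<kappa> * ((\<Sum>l<j. 2 ^ l * ?G (Suc l) x) + \<tau> * 2 ^ j * ?G (Suc j) x)"
      using Qop_sum[of "\<lambda>l x. 2 ^ l * ?G l x"] b
      by (simp add: Qop_cmult Qop_add bounded_meas_cmult)
    also have "\<kappa> * g x + 2 * (\<kappa> * ((\<Sum>l<j. 2 ^ l * ?G (Suc l) x) + \<tau> * 2 ^ j * ?G (Suc j) x))
       = \<kappa> * ((g x + (\<Sum>l<j. 2 ^ Suc l * ?G (Suc l) x)) + \<tau> * 2 ^ Suc j * ?G (Suc j) x)"
      by (simp add: sum_distrib_left algebra_simps)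
    also have "g x + (\<Sum>l<j. 2 ^ Suc l * ?G (Suc l) x) = (\<Sum>l<Suc j. 2 ^ l * ?G l x)"
      by (subst sum.lessThan_Suc_shift) simp
    finally show "(Uop (\<lambda>x. \<kappa> * g x) ^^ Suc j) (\<lambda>x. \<kappa> * \<tau> * g x) x
      = \<kappa> * ((\<Sum>l<Suc j. 2 ^ l * ?G l x) + \<tau> * 2 ^ Suc j * ?G (Suc j) x)" .
  qed
qed

text \<open>As \<open>\<tau> \<le> 1\<close>, the last term joins the sum as its term of index
  \<open>j\<close>. The condition \<open>1/2 < \<beta>\<close> makes the ratio
  \<open>2 * \<beta>\<close> exceed 1, so the geometric sum is at most
  \<open>2 * \<beta> / (2 * \<beta> - 1)\<close> times its largest term.\<close>

lemma Uop_funpow_bound: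
  assumes g: "bounded_meas borel g" and c: "\<And>l x. \<bar>(Qop P ^^ l) g x\<bar> \<le> c * \<beta> ^ l"
    and \<beta>: "1/2 < \<beta>" and \<tau>: "0 \<le> \<tau>" "\<tau> \<le> 1"
  shows "\<bar>(Uop (\<lambda>x. \<kappa> * g x) ^^ j) (\<lambda>x. \<kappa> * \<tau> * g x) x\<bar> \<le> \<bar>\<kappa>\<bar> * (c * 2 * \<beta> / (2 * \<beta> - 1)) * (2 * \<beta>) ^ j"
proof -
  have c0: "c \<ge> 0" using c[of 0 undefined] by simp
  have "\<bar>(\<Sum>l<j. 2 ^ l * (Qop P ^^ l) g x) + \<tau> * 2 ^ j * (Qop P ^^ j) g x\<bar>
    \<le> (\<Sum>l<j. \<bar>2 ^ l * (Qop P ^^ l) g x\<bar>) + \<bar>\<tau> * 2 ^ j * (Qop P ^^ j) g x\<bar>"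
    by (intro order_trans[OF abs_triangle_ineq] add_mono sum_abs order_refl)
  also have "\<dots> \<le> (\<Sum>l<j. 2 ^ l * (c * \<beta> ^ l)) + 1 * 2 ^ j * (c * \<beta> ^ j)"
    unfolding abs_mult using \<tau> c by (intro add_mono sum_mono mult_mono) auto
  also have "\<dots> = (\<Sum>l<Suc j. 2 ^ l * (c * \<beta> ^ l))" by simp
  also have "\<dots> = c * (\<Sum>l<Suc j. (2 * \<beta>) ^ l)" unfolding sum_distrib_left by (intro sum.cong) (auto simp: power_mult_distrib)
  also have "(\<Sum>l<Suc j. (2 * \<beta>) ^ l) = ((2 * \<beta>) ^ Suc j - 1) / (2 * \<beta> - 1)"
    using \<beta> by (intro geometric_sum) auto
  also have "c * \<dots> \<le> c * ((2 * \<beta>) ^ Suc j / (2 * \<beta> - 1))"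
    using c0 \<beta> by (intro mult_left_mono divide_right_mono) auto
  finally have "\<bar>\<kappa>\<bar> * \<bar>(\<Sum>l<j. 2 ^ l * (Qop P ^^ l) g x) + \<tau> * 2 ^ j * (Qop P ^^ j) g x\<bar>
     \<le> \<bar>\<kappa>\<bar> * (c * ((2 * \<beta>) ^ Suc j / (2 * \<beta> - 1)))" by (rule mult_left_mono) simp
  then show ?thesis unfolding Uop_funpow[OF g] abs_mult[of \<kappa>] by (simp add: mult_ac)
qed

end

section \<open>Exponential moments of the chain, one generation at a time\<close>

locale bmc = prob_space M + transition P for M :: "'w measure" and P :: "'a::metric_space \<Rightarrow> ('a \<times> 'a) measure" +
  fixes X :: "nat \<Rightarrow> 'w \<Rightarrow> 'a" and \<nu> :: "'a measure"
  assumes BMC: "BMC M X \<nu> P"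
begin

lemma X_measurable: "i \<ge> 1 \<Longrightarrow> X i \<in> M \<rightarrow>\<^sub>M borel"
  using BMC by (auto simp: BMC_def)

lemma Delta_measurable:
  assumes "i \<in> I" "2 * i \<in> I" "2 * i + 1 \<in> I"
  shows "Delta X i \<in> gen_sigma M X I \<rightarrow>\<^sub>M S3"
  unfolding Delta_def[abs_def]
  by (intro measurable_Pair measurable_gen_sigma) (use assms in auto)

lemma Delta_measurable': "i \<ge> 1 \<Longrightarrow> Delta X i \<in> M \<rightarrow>\<^sub>M S3"
  unfolding Delta_def[abs_def] by (intro measurable_Pair X_measurable) auto

lemma sub_Tr: "subalgebra M (gen_sigma M X (Tr r))"
  using X_measurable by (intro subalgebra_gen_sigma) (auto simp: Tr_eq)

text \<open>The defining conditional expectation tested against a bounded function \<open>h\<close>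
  of the generations up to \<open>r\<close>. Every use below reads it as integrating out generation
  r + 1.\<close>

lemma one_generation:
  assumes h: "h \<in> borel_measurable (gen_sigma M X (Tr r))" and hB: "\<And>\<omega>. \<bar>h \<omega>\<bar> \<le> B"
    and f: "\<And>n. n \<in> Gen r \<Longrightarrow> bounded_meas S3 (f n)"
  shows "expectation (\<lambda>\<omega>. h \<omega> * (\<Prod>n\<in>Gen r. f n (Delta X n \<omega>)))
    = expectation (\<lambda>\<omega>. h \<omega> * (\<Prod>n\<in>Gen r. Pop P (f n) (X n \<omega>)))"
proof -
  let ?F = "gen_sigma M X (Tr r)" and ?g = "\<lambda>\<omega>. \<Prod>n\<in>Gen r. f n (Delta X n \<omega>)"
  interpret finite_measure_subalgebra M ?F using sub_Tr by unfold_locales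
  have G1: "n \<ge> 1" if "n \<in> Gen r" for n using that by (auto simp: Gen_def Suc_le_eq)
  have hM: "h \<in> borel_measurable M" using measurable_from_subalg[OF sub_Tr h] .
  have fm: "f n \<in> borel_measurable S3" if "n \<in> Gen r" for n using f[OF that] by (simp add: bounded_meas_def)
  have gM: "?g \<in> borel_measurable M"
    by (intro borel_measurable_prod measurable_compose[OF Delta_measurable' fm] G1)
  have pM: "(\<lambda>\<omega>. \<Prod>n\<in>Gen r. Pop P (f n) (X n \<omega>)) \<in> borel_measurable M"
    by (intro borel_measurable_prod measurable_compose[OF X_measurable Pop_measurable] G1 fm)
  have "\<exists>C. n \<in> Gen r \<longrightarrow> (\<forall>t. \<bar>f n t\<bar> \<le> C)" for n
    using f[of n] by (metis bounded_measE)
  then obtain C where C: "\<And>n t. n \<in> Gen r \<Longrightarrow> \<bar>f n t\<bar> \<le> C n" by metis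
  have gB: "\<bar>?g \<omega>\<bar> \<le> (\<Prod>n\<in>Gen r. C n)" for \<omega>
    unfolding abs_prod using C by (intro prod_mono) auto
  have "expectation (\<lambda>\<omega>. h \<omega> * ?g \<omega>) = expectation (\<lambda>\<omega>. h \<omega> * real_cond_exp M ?F ?g \<omega>)"
  proof (rule real_cond_exp_intg(2)[symmetric])
    show "integrable M (\<lambda>\<omega>. h \<omega> * ?g \<omega>)"
      using hM gM by (intro integrable_const_bound[where B="B * (\<Prod>n\<in>Gen r. C n)"])
        (auto simp: abs_mult intro!: AE_I2 mult_mono hB gB order_trans[OF abs_ge_zero hB] simp del: abs_prod)
  qed (use h gM in auto)
  also have "\<dots> = expectation (\<lambda>\<omega>. h \<omega> * (\<Prod>n\<in>Gen r. Pop P (f n) (X n \<omega>)))"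
  proof (rule integral_cong_AE)
    have "AE \<omega> in M. real_cond_exp M ?F ?g \<omega> = (\<Prod>n\<in>Gen r. Pop P (f n) (X n \<omega>))"
      using BMC f unfolding BMC_def by blast
    then show "AE \<omega> in M. h \<omega> * real_cond_exp M ?F ?g \<omega> = h \<omega> * (\<Prod>n\<in>Gen r. Pop P (f n) (X n \<omega>))"
      by eventually_elim simp
  qed (use hM pM in auto)
  finally show ?thesis .
qed

text \<open>Peeling off the last generation of mothers leaves the same statement for the earlier
  ones. The set \<open>D\<close> is arbitrary because a permuted initial segment meets the last
  generation in an arbitrary subset.\<close>

lemma expectation_prod_Delta_eq_1:
  assumes \<phi>: "bounded_meas S3 \<phi>" and P1: "\<And>x. Pop P \<phi> x = 1"
  shows "D \<subseteq> {1..<2 ^ r} \<Longrightarrow> expectation (\<lambda>\<omega>. \<Prod>i\<in>D. \<phi> (Delta X i \<omega>)) = 1"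
proof (induction r arbitrary: D)
  case 0
  then show ?case by (simp add: prob_space)
next
  case (Suc r)
  define D1 where "D1 = D \<inter> {1..<2 ^ r}"
  define D2 where "D2 = D \<inter> Gen r"
  have D: "D = D1 \<union> D2" "D1 \<inter> D2 = {}" using Suc.prems by (auto simp: D1_def D2_def Gen_def)
  have fin: "finite D1" "finite D2" by (auto simp: D1_def D2_def)
  obtain B where B: "\<And>t. \<bar>\<phi> t\<bar> \<le> B" "\<phi> \<in> borel_measurable S3" by (rule bounded_measE[OF \<phi>]) blast
  let ?h = "\<lambda>\<omega>. \<Prod>i\<in>D1. \<phi> (Delta X i \<omega>)"
  \<comment> \<open>The Markov property concerns whole generations; the missing vertices get the
    factor 1, whose image under \<open>Pop P\<close> is 1 as well.\<close>
  let ?f = "\<lambda>n. if n \<in> D2 then \<phi> else (\<lambda>_. 1)"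
  have split: "(\<Prod>i\<in>D. \<phi> (Delta X i \<omega>)) = ?h \<omega> * (\<Prod>n\<in>Gen r. ?f n (Delta X n \<omega>))" for \<omega>
  proof -
    have "(\<Prod>n\<in>Gen r. ?f n (Delta X n \<omega>)) = (\<Prod>n\<in>D2. \<phi> (Delta X n \<omega>))"
      by (rule prod.mono_neutral_cong_right) (auto simp: D2_def)
    then show ?thesis using D fin by (simp add: prod.union_disjoint)
  qed
  have "expectation (\<lambda>\<omega>. ?h \<omega> * (\<Prod>n\<in>Gen r. ?f n (Delta X n \<omega>)))
      = expectation (\<lambda>\<omega>. ?h \<omega> * (\<Prod>n\<in>Gen r. Pop P (?f n) (X n \<omega>)))"
  proof (rule one_generation)
    \<comment> \<open>Triangles rooted strictly before generation \<open>r\<close> involve only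
      vertices of \<open>Tr r\<close>.\<close>
    show "?h \<in> borel_measurable (gen_sigma M X (Tr r))"
      by (intro borel_measurable_prod measurable_compose[OF Delta_measurable B(2)]) (auto simp: D1_def Tr_eq)
    show "\<bar>?h \<omega>\<bar> \<le> (\<Prod>i\<in>D1. B)" for \<omega> unfolding abs_prod using B by (intro prod_mono) auto
  qed (use \<phi> bounded_meas_const in auto)
  also have "\<dots> = expectation ?h"
    by (intro Bochner_Integration.integral_cong refl) (simp add: P1 if_distrib[of "Pop P"] if_distribR cong: if_cong)
  also have "\<dots> = 1" by (rule Suc.IH) (auto simp: D1_def)
  finally show ?case unfolding split .
qed

lemma bounded_sum_exp:
  assumes g: "bounded_meas borel g"
  shows "\<exists>C. \<forall>\<omega>. exp (\<Sum>i\<in>I. g (X i \<omega>)) \<le> C"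
proof -
  obtain B where "\<And>t. \<bar>g t\<bar> \<le> B" by (rule bounded_measE[OF g]) blast
  then have "g t \<le> B" for t by (simp add: abs_le_iff)
  then have "(\<Sum>i\<in>I. g (X i \<omega>)) \<le> of_nat (card I) * B" for \<omega> by (intro sum_bounded_above) auto
  then show ?thesis by (intro exI[of _ "exp (of_nat (card I) * B)"]) auto
qed

lemma Gen_Suc_sum: "(\<Sum>i\<in>Gen (Suc r). a i) = (\<Sum>i\<in>Gen r. a (2 * i) + a (2 * i + 1))"
  for a :: "nat \<Rightarrow> real"
proof -
  have "(\<Sum>i\<in>{m..<m+k}. a (2 * i) + a (2 * i + 1)) = (\<Sum>i\<in>{2*m..<2*m+2*k}. a i)" for m k
    by (induction k) (auto simp: add_ac)
  from this[of "2^r" "2^r"] show ?thesis by (simp add: Gen_def mult_2)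
qed

text \<open>Works from the leaves up to the root. Integrating out a generation replaces its weight
  by the next \<open>Uop\<close>-iterate on the mothers, and Hoeffding charges each mother twice the
  squared sup norm of the weight; after \<open>j\<close> steps there are 2^(r-1-j) mothers. At the
  root only \<open>H r\<close> is left.\<close>

lemma tree_exp_bound:
  assumes g: "bounded_meas borel g" and h: "bounded_meas borel h"
    and H: "\<And>j x. \<bar>(Uop g ^^ j) h x\<bar> \<le> H j"
  shows "expectation (\<lambda>\<omega>. exp ((\<Sum>i\<in>{1..<2^r}. g (X i \<omega>)) + (\<Sum>i\<in>Gen r. h (X i \<omega>))))
    \<le> exp (H r + (\<Sum>j<r. 2 ^ (r - j) * (H j)\<^sup>2))"
  using h H
proof (induction r arbitrary: h H)
  case 0
  have hm: "h \<in> borel_measurable borel" using 0(1) by (simp add: bounded_meas_def)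
  have "expectation (\<lambda>\<omega>. exp (h (X 1 \<omega>))) \<le> expectation (\<lambda>\<omega>. exp (H 0))"
  proof (rule integral_mono)
    have le: "exp (h x) \<le> exp (H 0)" for x using 0(2)[of 0 x] by (simp add: abs_le_iff)
    show "integrable M (\<lambda>\<omega>. exp (h (X 1 \<omega>)))"
      using le by (intro integrable_const_bound[where B="exp (H 0)"])
        (auto intro!: borel_measurable_exp[THEN measurable_compose[rotated]] measurable_compose[OF X_measurable hm])
    show "exp (h (X 1 \<omega>)) \<le> exp (H 0)" for \<omega> by (rule le)
  qed simp
  moreover have "Gen 0 = {1}" by (auto simp: Gen_def)
  ultimately show ?case by (simp add: prob_space)
next
  case (Suc r)
  have Xm: "X i \<in> M \<rightarrow>\<^sub>M borel" if "i \<in> {1..<2^r} \<or> i \<in> Gen r" for i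
    using that by (intro X_measurable) (auto simp: Gen_def Suc_le_eq)
  have gm: "g \<in> borel_measurable borel" using g by (simp add: bounded_meas_def)
  have split: "{1..<2^Suc r} = {1..<2^r} \<union> Gen r" "{1..<2^r} \<inter> Gen r = {}"
    by (auto simp: Gen_def)
  let ?f = "\<lambda>t :: 'a \<times> 'a \<times> 'a. exp (h (fst (snd t)) + h (snd (snd t)))"
  let ?e = "\<lambda>\<omega>. exp (\<Sum>i\<in>{1..<2^Suc r}. g (X i \<omega>))"
  have f: "bounded_meas S3 ?f"
    by (intro bounded_meas_exp bounded_meas_add bounded_meas_daughters Suc.prems)
  have U: "bounded_meas borel (Uop g h)" by (intro bounded_meas_Uop g Suc.prems)
  obtain C where C: "\<And>\<omega>. ?e \<omega> \<le> C" using bounded_sum_exp[OF g, of "{1..<2^Suc r}"] by metis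
  have em: "?e \<in> borel_measurable (gen_sigma M X (Tr r))"
    by (intro borel_measurable_exp[THEN measurable_compose[rotated]] borel_measurable_sum
        measurable_compose[OF measurable_gen_sigma gm]) (simp add: Tr_eq)
  have eM: "?e \<in> borel_measurable M" using measurable_from_subalg[OF sub_Tr em] .
  have "expectation (\<lambda>\<omega>. exp ((\<Sum>i\<in>{1..<2^Suc r}. g (X i \<omega>)) + (\<Sum>i\<in>Gen (Suc r). h (X i \<omega>))))
     = expectation (\<lambda>\<omega>. ?e \<omega> * (\<Prod>n\<in>Gen r. ?f (Delta X n \<omega>)))"
    \<comment> \<open>The leaves are grouped by mothers, so that each pair becomes one function of
      \<open>Delta\<close>.\<close>
    by (simp only: Gen_Suc_sum exp_add exp_sum[OF finite_Gen] Delta_def fst_conv snd_conv)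
  also have "\<dots> = expectation (\<lambda>\<omega>. ?e \<omega> * (\<Prod>n\<in>Gen r. Pop P ?f (X n \<omega>)))"
    by (rule one_generation[OF em _ f, where B=C]) (simp only: abs_exp_cancel C)
  also have "\<dots> \<le> expectation (\<lambda>\<omega>. exp (2 ^ Suc r * (H 0)\<^sup>2) *
      exp ((\<Sum>i\<in>{1..<2^r}. g (X i \<omega>)) + (\<Sum>i\<in>Gen r. Uop g h (X i \<omega>))))"
  proof (rule integral_mono)
    obtain K where K: "K \<ge> 0" "\<And>t. \<bar>Pop P ?f t\<bar> \<le> K" "Pop P ?f \<in> borel_measurable borel"
      by (rule bounded_measE[OF bounded_meas_Pop[OF f]]) blast
    have pK: "\<bar>\<Prod>n\<in>Gen r. Pop P ?f (X n \<omega>)\<bar> \<le> (\<Prod>n\<in>Gen r. K)" for \<omega>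
      unfolding abs_prod using K by (intro prod_mono) auto
    show "integrable M (\<lambda>\<omega>. ?e \<omega> * (\<Prod>n\<in>Gen r. Pop P ?f (X n \<omega>)))"
    proof (rule integrable_const_bound[where B="C * (\<Prod>n\<in>Gen r. K)"])
      show "AE \<omega> in M. norm (?e \<omega> * (\<Prod>n\<in>Gen r. Pop P ?f (X n \<omega>))) \<le> C * (\<Prod>n\<in>Gen r. K)"
        unfolding real_norm_def abs_mult abs_exp_cancel
        by (intro AE_I2 mult_mono C pK order_trans[OF exp_ge_zero C] abs_ge_zero)
      show "(\<lambda>\<omega>. ?e \<omega> * (\<Prod>n\<in>Gen r. Pop P ?f (X n \<omega>))) \<in> borel_measurable M"
        by (intro borel_measurable_times eM borel_measurable_prod measurable_compose[OF Xm K(3)]) auto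
    qed
    obtain C1 where C1: "\<And>\<omega>. exp (\<Sum>i\<in>{1..<2^r}. g (X i \<omega>)) \<le> C1"
      using bounded_sum_exp[OF g, of "{1..<2^r}"] by metis
    obtain C2 where C2: "\<And>\<omega>. exp (\<Sum>i\<in>Gen r. Uop g h (X i \<omega>)) \<le> C2"
      using bounded_sum_exp[OF U, of "Gen r"] by metis
    have Um: "Uop g h \<in> borel_measurable borel" using U by (simp add: bounded_meas_def)
    have "integrable M (\<lambda>\<omega>. exp ((\<Sum>i\<in>{1..<2^r}. g (X i \<omega>)) + (\<Sum>i\<in>Gen r. Uop g h (X i \<omega>))))"
    proof (rule integrable_const_bound[where B="C1 * C2"])
      show "AE \<omega> in M. norm (exp ((\<Sum>i\<in>{1..<2^r}. g (X i \<omega>)) + (\<Sum>i\<in>Gen r. Uop g h (X i \<omega>)))) \<le> C1 * C2"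
        unfolding real_norm_def exp_add abs_mult abs_exp_cancel
        by (intro AE_I2 mult_mono C1 C2 order_trans[OF exp_ge_zero C1] exp_ge_zero)
      show "(\<lambda>\<omega>. exp ((\<Sum>i\<in>{1..<2^r}. g (X i \<omega>)) + (\<Sum>i\<in>Gen r. Uop g h (X i \<omega>)))) \<in> borel_measurable M"
        by (intro borel_measurable_exp[THEN measurable_compose[rotated]] borel_measurable_add borel_measurable_sum
            measurable_compose[OF Xm gm] measurable_compose[OF Xm Um]) auto
    qed
    then show "integrable M (\<lambda>\<omega>. exp (2 ^ Suc r * (H 0)\<^sup>2) *
      exp ((\<Sum>i\<in>{1..<2^r}. g (X i \<omega>)) + (\<Sum>i\<in>Gen r. Uop g h (X i \<omega>))))" by simp
    fix \<omega>
    have "(\<Prod>n\<in>Gen r. Pop P ?f (X n \<omega>)) \<le> (\<Prod>n\<in>Gen r. exp (2 * Qop P h (X n \<omega>) + 2 * (H 0)\<^sup>2))"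
    proof (intro prod_mono conjI)
      fix n
      show "0 \<le> Pop P ?f (X n \<omega>)" unfolding Pop_def by simp
      show "Pop P ?f (X n \<omega>) \<le> exp (2 * Qop P h (X n \<omega>) + 2 * (H 0)\<^sup>2)"
        using Suc.prems(2)[of 0] by (intro Pop_exp_daughters_le Suc.prems) auto
    qed
    also have "\<dots> = exp (2 ^ Suc r * (H 0)\<^sup>2) * exp (\<Sum>n\<in>Gen r. 2 * Qop P h (X n \<omega>))"
      by (simp only: exp_sum[OF finite_Gen, symmetric] exp_add[symmetric]) (simp add: sum.distrib add.commute)
    finally have "?e \<omega> * (\<Prod>n\<in>Gen r. Pop P ?f (X n \<omega>))
      \<le> ?e \<omega> * (exp (2 ^ Suc r * (H 0)\<^sup>2) * exp (\<Sum>n\<in>Gen r. 2 * Qop P h (X n \<omega>)))"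
      by (rule mult_left_mono) simp
    also have "\<dots> = exp (2 ^ Suc r * (H 0)\<^sup>2) *
      exp ((\<Sum>i\<in>{1..<2^r}. g (X i \<omega>)) + (\<Sum>i\<in>Gen r. Uop g h (X i \<omega>)))"
      unfolding split(1) by (subst sum.union_disjoint) (use split(2) in \<open>auto simp: Uop_def sum.distrib exp_add\<close>)
    finally show "?e \<omega> * (\<Prod>n\<in>Gen r. Pop P ?f (X n \<omega>)) \<le> exp (2 ^ Suc r * (H 0)\<^sup>2) *
      exp ((\<Sum>i\<in>{1..<2^r}. g (X i \<omega>)) + (\<Sum>i\<in>Gen r. Uop g h (X i \<omega>)))" .
  qed
  also have "\<dots> = exp (2 ^ Suc r * (H 0)\<^sup>2) * expectation (\<lambda>\<omega>.
      exp ((\<Sum>i\<in>{1..<2^r}. g (X i \<omega>)) + (\<Sum>i\<in>Gen r. Uop g h (X i \<omega>))))" by simp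
  also have "\<dots> \<le> exp (2 ^ Suc r * (H 0)\<^sup>2) * exp (H (Suc r) + (\<Sum>j<r. 2 ^ (r - j) * (H (Suc j))\<^sup>2))"
  \<comment> \<open>The new leaf weight is \<open>Uop g h\<close>, whose iterates are those of
    \<open>h\<close> with the index shifted; hence \<open>h\<close> and \<open>H\<close> vary in the
    induction.\<close>
  proof (intro mult_left_mono Suc.IH[of "Uop g h" "\<lambda>j. H (Suc j)"] U)
    show "\<bar>(Uop g ^^ j) (Uop g h) x\<bar> \<le> H (Suc j)" for j x
      using Suc.prems(2)[of "Suc j" x] by (simp add: funpow_swap1)
  qed simp
  also have "\<dots> = exp (H (Suc r) + (\<Sum>j<Suc r. 2 ^ (Suc r - j) * (H j)\<^sup>2))"
    by (subst sum.lessThan_Suc_shift) (simp flip: exp_add)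
  finally show ?case .
qed

text \<open>Here the threshold 1/2 for the squared rate appears: 2^(r-j) mothers or leaves against
  weights squared, (2 \<beta>)^(2j), give 2^r (2 \<beta>^2)^j.\<close>

lemma tree_exp_bound_geometric:
  assumes g: "bounded_meas borel g" and c: "\<And>l x. \<bar>(Qop P ^^ l) g x\<bar> \<le> c * \<beta> ^ l"
    and \<beta>: "1/2 < \<beta>" and \<tau>: "0 \<le> \<tau>" "\<tau> \<le> 1"
  defines "c' \<equiv> c * 2 * \<beta> / (2 * \<beta> - 1)"
  shows "expectation (\<lambda>\<omega>. exp (\<kappa> * (\<Sum>i\<in>{1..<2^r}. g (X i \<omega>)) + \<kappa> * \<tau> * (\<Sum>i\<in>Gen r. g (X i \<omega>))))
    \<le> exp (\<bar>\<kappa>\<bar> * c' * (2 * \<beta>) ^ r + \<kappa>\<^sup>2 * c'\<^sup>2 * 2 ^ r * (\<Sum>j<r. (2 * \<beta>\<^sup>2) ^ j))"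
proof -
  have "expectation (\<lambda>\<omega>. exp ((\<Sum>i\<in>{1..<2^r}. \<kappa> * g (X i \<omega>)) + (\<Sum>i\<in>Gen r. \<kappa> * \<tau> * g (X i \<omega>))))
    \<le> exp (\<bar>\<kappa>\<bar> * c' * (2 * \<beta>) ^ r + (\<Sum>j<r. 2 ^ (r - j) * (\<bar>\<kappa>\<bar> * c' * (2 * \<beta>) ^ j)\<^sup>2))"
    unfolding c'_def
    by (intro tree_exp_bound bounded_meas_cmult g Uop_funpow_bound c \<beta> \<tau>)
  also have "(\<Sum>j<r. 2 ^ (r - j) * (\<bar>\<kappa>\<bar> * c' * (2 * \<beta>) ^ j)\<^sup>2) = (\<Sum>j<r. \<kappa>\<^sup>2 * c'\<^sup>2 * 2 ^ r * (2 * \<beta>\<^sup>2) ^ j)"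
  proof (intro sum.cong refl)
    fix j assume "j \<in> {..<r}"
    then have "(2::real) ^ r = 2 ^ (r - j) * 2 ^ j" by (simp flip: power_add)
    moreover have "((2 * \<beta>) ^ j)\<^sup>2 = 2 ^ j * (2 * \<beta>\<^sup>2) ^ j"
      by (simp only: power2_eq_square power_mult_distrib mult_ac)
    ultimately show "2 ^ (r - j) * (\<bar>\<kappa>\<bar> * c' * (2 * \<beta>) ^ j)\<^sup>2 = \<kappa>\<^sup>2 * c'\<^sup>2 * 2 ^ r * (2 * \<beta>\<^sup>2) ^ j"
      by (simp only: power_mult_distrib power2_abs mult_ac)
  qed
  finally show ?thesis by (simp only: sum_distrib_left)
qed

end

section \<open>Log-Laplace asymptotics along the random order\<close>

lemma rgen_bounds:
  assumes "n \<ge> 1" shows "2 ^ rgen n \<le> n" "n < 2 ^ Suc (rgen n)"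
proof -
  have l: "log 2 (real n) \<ge> 0" using assms by simp
  then have r: "real (rgen n) = of_int \<lfloor>log 2 (real n)\<rfloor>" by (simp add: rgen_def)
  have n: "2 powr (log 2 (real n)) = real n" using assms by simp
  have "2 powr real (rgen n) \<le> 2 powr (log 2 (real n))" unfolding r by simp
  then have "real (2 ^ rgen n) \<le> real n" unfolding n by (simp add: powr_realpow)
  then show "2 ^ rgen n \<le> n" by (simp only: of_nat_le_iff)
  have "2 powr (log 2 (real n)) < 2 powr (real (Suc (rgen n)))" using r by simp linarith
  then have "real n < real (2 ^ Suc (rgen n))" unfolding n by (simp add: powr_realpow del: of_nat_Suc power_Suc)
  then show "n < 2 ^ Suc (rgen n)" by (simp only: of_nat_less_iff)
qed

lemma rgen_at_top: "filterlim rgen at_top sequentially"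
  unfolding filterlim_at_top
proof
  fix K
  show "eventually (\<lambda>n. K \<le> rgen n) sequentially"
    using eventually_ge_at_top[of "2 ^ K"]
  proof eventually_elim
    case (elim n)
    have "n \<ge> 1" using elim by (metis le_trans one_le_numeral one_le_power)
    from rgen_bounds(2)[OF this] elim have "(2::nat) ^ K < 2 ^ Suc (rgen n)" by linarith
    then have "K < Suc (rgen n)" by (subst (asm) power_strict_increasing_iff) auto
    then show ?case by simp
  qed
qed

text \<open>Complete generations are only reshuffled internally, so the order matters in the last,
  incomplete one alone.\<close>

lemma gen_perms_sum_previous:
  assumes \<sigma>: "\<sigma> \<in> gen_perms r"
  shows "(\<Sum>i\<in>{1..<2 ^ r}. a (\<sigma> i)) = (\<Sum>i\<in>{1..<2 ^ r}. a i)"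
proof (rule sum.reindex_bij_betw)
  have p: "\<sigma> permutes Tr r" by (rule gen_perms_permutes[OF \<sigma>])
  have eq: "{1..<2 ^ r} = Tr r - Gen r" by (auto simp: Tr_eq Gen_def)
  have "\<sigma> ` (Tr r - Gen r) = \<sigma> ` Tr r - \<sigma> ` Gen r"
    by (rule image_set_diff) (rule permutes_inj[OF p])
  also have "\<dots> = Tr r - Gen r"
    using \<sigma> permutes_image[OF p] by (auto simp: gen_perms_def bij_betw_def)
  finally show "bij_betw \<sigma> {1..<2 ^ r} {1..<2 ^ r}"
    unfolding eq bij_betw_def using permutes_inj[OF p] by (auto intro: inj_on_subset)
qed

locale bmc_perm = bmc M P X \<nu> + random_perm M X \<pi>
  for M :: "'w measure" and P :: "'a::metric_space \<Rightarrow> ('a \<times> 'a) measure"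
    and X :: "nat \<Rightarrow> 'w \<Rightarrow> 'a" and \<nu> and \<pi>
begin

text \<open>The first \<open>n\<close> values of the permutation are determined by its restriction
  to \<open>Tr (rgen n)\<close>, which takes finitely many values.\<close>

lemma measurable_perm_sum:
  assumes F: "F \<in> borel_measurable S3"
  shows "(\<lambda>\<omega>. \<Sum>i=1..n. F (Delta X (\<pi> \<omega> i) \<omega>) :: real) \<in> borel_measurable M"
proof -
  let ?r = "rgen n"
  let ?h = "\<lambda>\<sigma> \<omega>. \<Sum>i=1..n. F (Delta X (\<sigma> i) \<omega>)"
  have n: "i \<in> Tr ?r" if "i \<in> {1..n}" for i
    using rgen_bounds(2)[of n] that by (auto simp: Tr_eq)
  have "(\<lambda>\<omega>. ?h (restrict_perm ?r (\<pi> \<omega>)) \<omega>) \<in> borel_measurable M"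
  proof (rule measurable_perm)
    fix \<sigma> assume "\<sigma> \<in> gen_perms ?r"
    then have "\<sigma> i \<in> Tr ?r" if "i \<in> {1..n}" for i
      using permutes_in_image[OF gen_perms_permutes] n[OF that] by blast
    then show "?h \<sigma> \<in> borel_measurable M"
      by (intro borel_measurable_sum measurable_compose[OF Delta_measurable' F]) (auto simp: Tr_eq)
  qed
  also have "(\<lambda>\<omega>. ?h (restrict_perm ?r (\<pi> \<omega>)) \<omega>) = (\<lambda>\<omega>. ?h (\<pi> \<omega>) \<omega>)"
    using n by (auto simp: restrict_perm_def fun_eq_iff intro!: sum.cong)
  finally show ?thesis .
qed

lemma expectation_prod_perm_eq_1:
  assumes \<phi>: "bounded_meas S3 \<phi>" and P1: "\<And>x. Pop P \<phi> x = 1"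
  shows "expectation (\<lambda>\<omega>. \<Prod>i=1..n. \<phi> (Delta X (\<pi> \<omega> i) \<omega>)) = 1"
proof -
  let ?r = "rgen n"
  let ?h = "\<lambda>\<sigma> \<omega>. \<Prod>i=1..n. \<phi> (Delta X (\<sigma> i) \<omega>)"
  obtain B where B: "\<And>t. \<bar>\<phi> t\<bar> \<le> B" "\<phi> \<in> borel_measurable S3" by (rule bounded_measE[OF \<phi>]) blast
  have n: "i \<in> Tr ?r" if "i \<in> {1..n}" for i
    using rgen_bounds(2)[of n] that by (auto simp: Tr_eq)
  have \<sigma>n: "\<sigma> i \<in> Tr ?r" if "\<sigma> \<in> gen_perms ?r" "i \<in> {1..n}" for i \<sigma>
    using permutes_in_image[OF gen_perms_permutes[OF that(1)]] n[OF that(2)] by blast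
  have "(\<lambda>\<omega>. ?h (\<pi> \<omega>) \<omega>) = (\<lambda>\<omega>. ?h (restrict_perm ?r (\<pi> \<omega>)) \<omega>)"
    using n by (auto simp: restrict_perm_def fun_eq_iff intro!: prod.cong)
  then have "expectation (\<lambda>\<omega>. ?h (\<pi> \<omega>) \<omega>) = expectation (\<lambda>\<omega>. ?h (restrict_perm ?r (\<pi> \<omega>)) \<omega>)" by simp
  also have "\<dots> = (\<Sum>\<sigma>\<in>gen_perms ?r. expectation (?h \<sigma>)) / card (gen_perms ?r)"
  proof (rule expectation_perm)
    fix \<sigma> assume "\<sigma> \<in> gen_perms ?r"
    then show "?h \<sigma> \<in> borel_measurable (gen_sigma M X {1..})"
      using \<sigma>n[of \<sigma>] by (intro borel_measurable_prod measurable_compose[OF Delta_measurable B(2)]) (force simp: Tr_eq)+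
  next
    show "\<bar>?h \<sigma> \<omega>\<bar> \<le> (\<Prod>i=1..n. B)" for \<sigma> \<omega> unfolding abs_prod using B by (intro prod_mono) auto
  qed
  also have "(\<Sum>\<sigma>\<in>gen_perms ?r. expectation (?h \<sigma>)) = (\<Sum>\<sigma>\<in>gen_perms ?r. 1)"
  proof (rule sum.cong[OF refl])
    fix \<sigma> assume \<sigma>: "\<sigma> \<in> gen_perms ?r"
    have "inj_on \<sigma> {1..n}" using permutes_inj[OF gen_perms_permutes[OF \<sigma>]] by (auto intro: inj_on_subset)
    then have "expectation (?h \<sigma>) = expectation (\<lambda>\<omega>. \<Prod>i\<in>\<sigma> ` {1..n}. \<phi> (Delta X i \<omega>))"
      by (simp add: prod.reindex)
    also have "\<dots> = 1" using \<sigma>n[OF \<sigma>] by (intro expectation_prod_Delta_eq_1[OF \<phi> P1, where r="Suc ?r"]) (auto simp: Tr_eq)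
    finally show "expectation (?h \<sigma>) = 1" .
  qed
  finally show ?thesis using card_gen_perms_pos[of ?r] by (simp add: card_gt_0_iff)
qed

text \<open>The three terms are the sampling error in the last generation, the mean propagated to
  the root, and the Hoeffding costs along the tree. All of them are made proportional to
  \<open>n\<close>, for later comparison with the speed.\<close>

lemma perm_exp_bound:
  assumes g: "bounded_meas borel g" and B: "\<And>x. \<bar>g x\<bar> \<le> B"
    and c: "\<And>l x. \<bar>(Qop P ^^ l) g x\<bar> \<le> c * \<beta> ^ l" and \<beta>: "1/2 < \<beta>" and n: "n \<ge> 1"
  defines "c' \<equiv> c * 2 * \<beta> / (2 * \<beta> - 1)"
  shows "expectation (\<lambda>\<omega>. exp (\<kappa> * (\<Sum>i=1..n. g (X (\<pi> \<omega> i) \<omega>))))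
    \<le> exp (real n * (\<kappa>\<^sup>2 * B\<^sup>2 / 2 + \<bar>\<kappa>\<bar> * c' * \<beta> ^ rgen n + \<kappa>\<^sup>2 * c'\<^sup>2 * (\<Sum>j<rgen n. (2 * \<beta>\<^sup>2) ^ j)))"
proof -
  define r where "r = rgen n"
  \<comment> \<open>The number of draws from the last generation: positions \<open>2 ^ r\<close> to
    \<open>n\<close>, both included.\<close>
  define k where "k = Suc n - 2 ^ r"
  have r: "2 ^ r \<le> n" "n < 2 ^ Suc r" using rgen_bounds[OF n] by (auto simp: r_def)
  have k: "k \<le> 2 ^ r" "{1..n} = {1..<2^r} \<union> {2^r..<2^r+k}" "k \<le> n"
    using r n by (auto simp: k_def)
  have gm: "g \<in> borel_measurable borel" using g by (simp add: bounded_meas_def)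
  have c0: "c \<ge> 0" using c[of 0 undefined] by simp
  then have c'0: "c' \<ge> 0" using \<beta> by (simp add: c'_def)
  have nT: "i \<in> Tr r" if "i \<in> {1..n}" for i
    using r that by (auto simp: Tr_eq)
  have \<sigma>n: "\<sigma> i \<ge> 1" if "\<sigma> \<in> gen_perms r" "i \<in> {1..n}" for i \<sigma>
    using permutes_in_image[OF gen_perms_permutes[OF that(1)]] nT[OF that(2)] by (auto simp: Tr_eq)
  let ?h = "\<lambda>\<sigma> \<omega>. exp (\<kappa> * (\<Sum>i=1..n. g (X (\<sigma> i) \<omega>)))"
  let ?T = "\<lambda>\<omega>. \<Sum>i\<in>{1..<2^r}. g (X i \<omega>)" and ?N = "\<lambda>\<omega>. \<Sum>i\<in>Gen r. g (X i \<omega>)"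
  let ?E = "\<lambda>\<omega>. exp (\<kappa> * ?T \<omega> + \<kappa> * (k / 2 ^ r) * ?N \<omega>)"
  let ?c = "real (card (gen_perms r))"
  have cpos: "?c > 0" using card_gen_perms_pos by simp
  have hB: "\<bar>?h \<sigma> \<omega>\<bar> \<le> exp (\<bar>\<kappa>\<bar> * (n * B))" for \<sigma> \<omega>
  proof -
    have "\<bar>\<Sum>i=1..n. g (X (\<sigma> i) \<omega>)\<bar> \<le> (\<Sum>i=1..n. B)" using B by (intro order_trans[OF sum_abs] sum_mono)
    then have "\<bar>\<kappa> * (\<Sum>i=1..n. g (X (\<sigma> i) \<omega>))\<bar> \<le> \<bar>\<kappa>\<bar> * (n * B)"
      unfolding abs_mult by (intro mult_left_mono) auto
    then show ?thesis by (simp add: abs_le_iff)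
  qed
  have hm: "?h \<sigma> \<in> borel_measurable (gen_sigma M X {1..})" if "\<sigma> \<in> gen_perms r" for \<sigma>
    using \<sigma>n[OF that]
    by (intro borel_measurable_exp[THEN measurable_compose[rotated]] borel_measurable_times borel_measurable_const
        borel_measurable_sum measurable_compose[OF measurable_gen_sigma gm]) auto
  have hint: "integrable M (?h \<sigma>)" if "\<sigma> \<in> gen_perms r" for \<sigma>
    using measurable_from_subalg[OF sub_all hm[OF that]] hB[of \<sigma>]
    by (intro integrable_const_bound[where B="exp (\<bar>\<kappa>\<bar> * (n * B))"]) auto
  have Eint: "integrable M ?E"
  proof (rule integrable_const_bound)
    have B0: "B \<ge> 0" using B[of undefined] by linarith
    show "?E \<in> borel_measurable M"
      by (intro borel_measurable_exp[THEN measurable_compose[rotated]] borel_measurable_add borel_measurable_times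
          borel_measurable_const borel_measurable_sum measurable_compose[OF X_measurable gm]) (auto simp: Gen_def Suc_le_eq)
    have "\<kappa> * ?T \<omega> + \<kappa> * (k / 2 ^ r) * ?N \<omega> \<le> \<bar>\<kappa>\<bar> * (\<Sum>i\<in>{1..<2^r::nat}. B) + \<bar>\<kappa> * (k / 2 ^ r)\<bar> * (\<Sum>i\<in>Gen r. B)" for \<omega>
    proof (rule add_mono)
      show "\<kappa> * ?T \<omega> \<le> \<bar>\<kappa>\<bar> * (\<Sum>i\<in>{1..<2^r::nat}. B)"
        by (rule order_trans[OF abs_ge_self]) (unfold abs_mult, intro mult_left_mono order_trans[OF sum_abs] sum_mono B abs_ge_zero)
      show "\<kappa> * (k / 2 ^ r) * ?N \<omega> \<le> \<bar>\<kappa> * (k / 2 ^ r)\<bar> * (\<Sum>i\<in>Gen r. B)"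
        by (rule order_trans[OF abs_ge_self], subst abs_mult, intro mult_left_mono order_trans[OF sum_abs] sum_mono B abs_ge_zero)
    qed
    then show "AE \<omega> in M. norm (?E \<omega>) \<le> exp (\<bar>\<kappa>\<bar> * (\<Sum>i\<in>{1..<2^r::nat}. B) + \<bar>\<kappa> * (k / 2 ^ r)\<bar> * (\<Sum>i\<in>Gen r. B))"
      by (intro AE_I2) (simp only: real_norm_def abs_exp_cancel exp_le_cancel_iff)
  qed
  \<comment> \<open>The average over \<open>\<sigma>\<close> is bounded for each fixed realisation
    of the chain. This trades the partial last generation for the whole one with weight
    \<open>k / 2 ^ r\<close>, which the tree bound can handle.\<close>
  have pw: "(\<Sum>\<sigma>\<in>gen_perms r. ?h \<sigma> \<omega>) \<le> ?c * (exp (k * \<kappa>\<^sup>2 * B\<^sup>2 / 2) * ?E \<omega>)" for \<omega>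
  proof -
    have "(\<Sum>\<sigma>\<in>gen_perms r. ?h \<sigma> \<omega>)
      = (\<Sum>\<sigma>\<in>gen_perms r. exp (\<kappa> * ?T \<omega>) * exp (\<kappa> * (\<Sum>i=2^r..<2^r+k. g (X (\<sigma> i) \<omega>))))"
    proof (rule sum.cong[OF refl])
      fix \<sigma> assume \<sigma>: "\<sigma> \<in> gen_perms r"
      have "(\<Sum>i=1..n. g (X (\<sigma> i) \<omega>)) = (\<Sum>i\<in>{1..<2^r}. g (X (\<sigma> i) \<omega>)) + (\<Sum>i=2^r..<2^r+k. g (X (\<sigma> i) \<omega>))"
        unfolding k(2) by (rule sum.union_disjoint) auto
      also have "(\<Sum>i\<in>{1..<2^r}. g (X (\<sigma> i) \<omega>)) = ?T \<omega>" by (rule gen_perms_sum_previous[OF \<sigma>])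
      finally show "?h \<sigma> \<omega> = exp (\<kappa> * ?T \<omega>) * exp (\<kappa> * (\<Sum>i=2^r..<2^r+k. g (X (\<sigma> i) \<omega>)))"
        by (simp only: distrib_left exp_add)
    qed
    also have "\<dots> = exp (\<kappa> * ?T \<omega>) * (\<Sum>\<sigma>\<in>gen_perms r. exp (\<kappa> * (\<Sum>i=2^r..<2^r+k. g (X (\<sigma> i) \<omega>))))"
      by (simp only: sum_distrib_left)
    also have "\<dots> \<le> exp (\<kappa> * ?T \<omega>) * (?c * exp (\<kappa> * (k / 2 ^ r) * ?N \<omega> + k * \<kappa>\<^sup>2 * B\<^sup>2 / 2))"
      using B k(1) by (intro mult_left_mono gen_perms_exp_sum) auto
    also have "\<dots> = ?c * (exp (k * \<kappa>\<^sup>2 * B\<^sup>2 / 2) * ?E \<omega>)" by (simp only: exp_add mult_ac)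
    finally show ?thesis .
  qed
  have "(\<Sum>\<sigma>\<in>gen_perms r. expectation (?h \<sigma>)) = expectation (\<lambda>\<omega>. \<Sum>\<sigma>\<in>gen_perms r. ?h \<sigma> \<omega>)"
    using hint by (intro Bochner_Integration.integral_sum[symmetric]) auto
  also have "\<dots> \<le> expectation (\<lambda>\<omega>. ?c * (exp (k * \<kappa>\<^sup>2 * B\<^sup>2 / 2) * ?E \<omega>))"
    using pw hint Eint
    by (intro integral_mono Bochner_Integration.integrable_sum integrable_mult_right) auto
  also have "\<dots> = ?c * (exp (k * \<kappa>\<^sup>2 * B\<^sup>2 / 2) * expectation ?E)" by simp
  finally have sum_le: "(\<Sum>\<sigma>\<in>gen_perms r. expectation (?h \<sigma>)) / ?c \<le> exp (k * \<kappa>\<^sup>2 * B\<^sup>2 / 2) * expectation ?E"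
    using cpos by (simp only: pos_divide_le_eq mult.commute)
  have "(\<lambda>\<omega>. ?h (\<pi> \<omega>) \<omega>) = (\<lambda>\<omega>. ?h (restrict_perm r (\<pi> \<omega>)) \<omega>)"
    using nT by (auto simp: restrict_perm_def fun_eq_iff intro!: sum.cong)
  then have "expectation (\<lambda>\<omega>. ?h (\<pi> \<omega>) \<omega>) = expectation (\<lambda>\<omega>. ?h (restrict_perm r (\<pi> \<omega>)) \<omega>)" by simp
  also have "\<dots> = (\<Sum>\<sigma>\<in>gen_perms r. expectation (?h \<sigma>)) / ?c"
    by (rule expectation_perm[OF hm hB])
  also note sum_le
  also have "expectation ?E \<le> exp (\<bar>\<kappa>\<bar> * c' * (2 * \<beta>) ^ r + \<kappa>\<^sup>2 * c'\<^sup>2 * 2 ^ r * (\<Sum>j<r. (2 * \<beta>\<^sup>2) ^ j))"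
    unfolding c'_def using k(1)
    by (intro tree_exp_bound_geometric g c \<beta>) (auto simp: divide_le_eq_1 simp flip: of_nat_le_iff)
  also have "exp (k * \<kappa>\<^sup>2 * B\<^sup>2 / 2) * \<dots>
      = exp (k * (\<kappa>\<^sup>2 * B\<^sup>2 / 2) + 2 ^ r * (\<bar>\<kappa>\<bar> * c' * \<beta> ^ r) + 2 ^ r * (\<kappa>\<^sup>2 * c'\<^sup>2 * (\<Sum>j<r. (2 * \<beta>\<^sup>2) ^ j)))"
    by (simp add: power_mult_distrib mult_ac flip: exp_add)
  also have "\<dots> \<le> exp (n * (\<kappa>\<^sup>2 * B\<^sup>2 / 2) + n * (\<bar>\<kappa>\<bar> * c' * \<beta> ^ r) + n * (\<kappa>\<^sup>2 * c'\<^sup>2 * (\<Sum>j<r. (2 * \<beta>\<^sup>2) ^ j)))"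
  proof -
    have "2 ^ r \<le> real n" using r(1) by (simp flip: of_nat_le_iff)
    then show ?thesis
      unfolding exp_le_cancel_iff using k(3) c'0 \<beta> by (intro add_mono mult_right_mono mult_nonneg_nonneg sum_nonneg) auto
  qed
  finally show ?thesis by (simp add: r_def distrib_left)
qed

end

section \<open>Hoelder's inequality and the limit of the log-Laplace transform\<close>

lemma (in prob_space) exp_Holder:
  fixes x y :: "'a \<Rightarrow> real" and p q a c :: real
  assumes p: "p > 1" and q: "1 / p + 1 / q = 1"
    and int: "integrable M (\<lambda>\<omega>. exp (x \<omega> + y \<omega>))" "integrable M (\<lambda>\<omega>. exp (p * x \<omega>))" "integrable M (\<lambda>\<omega>. exp (q * y \<omega>))"
    and a: "expectation (\<lambda>\<omega>. exp (p * x \<omega>)) \<le> exp (p * a)"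
    and c: "expectation (\<lambda>\<omega>. exp (q * y \<omega>)) \<le> exp (q * c)"
  shows "expectation (\<lambda>\<omega>. exp (x \<omega> + y \<omega>)) \<le> exp (a + c)"
proof -
  have q0: "q > 0"
  proof -
    have "1 / q = 1 - 1 / p" using q by simp
    also have "\<dots> > 0" using p by simp
    finally show ?thesis by simp
  qed
  \<comment> \<open>Young's inequality, from convexity of \<open>exp\<close> at weight
    \<open>1 / q\<close>. It is applied to exponents shifted by \<open>a\<close> and
    \<open>c\<close>: each shifted moment is at most 1, and the weights \<open>1 / p\<close> and
    \<open>1 / q\<close> add up to 1.\<close>
  have conv: "exp (u + w) \<le> (1/p) * exp (p * u) + (1/q) * exp (q * w)" for u w :: real
  proof -
    have "1 / p > 0" using p by simp
    with q have pq: "1 - 1 / q = 1 / p" "1 / q \<le> 1" by linarith+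
    have "exp ((1 - 1 / q) * (p * u) + (1 / q) * (q * w)) \<le> (1 - 1 / q) * exp (p * u) + (1 / q) * exp (q * w)"
      using convex_onD[OF convex_on_exp[of 1], of "1/q" "p * u" "q * w"] pq(2) q0 by simp
    moreover have "(1 / p) * (p * u) + (1 / q) * (q * w) = u + w" using p q0 by simp
    ultimately show ?thesis unfolding pq(1) by simp
  qed
  have "expectation (\<lambda>\<omega>. exp (x \<omega> + y \<omega>))
    \<le> expectation (\<lambda>\<omega>. exp (a + c) * ((1/p) * exp (- (p * a)) * exp (p * x \<omega>) + (1/q) * exp (- (q * c)) * exp (q * y \<omega>)))"
  proof (rule integral_mono)
    show "integrable M (\<lambda>\<omega>. exp (a + c) * ((1/p) * exp (- (p * a)) * exp (p * x \<omega>) + (1/q) * exp (- (q * c)) * exp (q * y \<omega>)))"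
      using int by (intro integrable_mult_right Bochner_Integration.integrable_add)
    fix \<omega>
    have "exp (x \<omega> + y \<omega>) = exp (a + c) * exp ((x \<omega> - a) + (y \<omega> - c))" by (simp flip: exp_add)
    also have "\<dots> \<le> exp (a + c) * ((1/p) * exp (p * (x \<omega> - a)) + (1/q) * exp (q * (y \<omega> - c)))"
      by (intro mult_left_mono conv) simp
    also have "p * (x \<omega> - a) = - (p * a) + p * x \<omega>" by (simp add: algebra_simps)
    also have "q * (y \<omega> - c) = - (q * c) + q * y \<omega>" by (simp add: algebra_simps)
    finally show "exp (x \<omega> + y \<omega>) \<le> exp (a + c) * ((1/p) * exp (- (p * a)) * exp (p * x \<omega>) + (1/q) * exp (- (q * c)) * exp (q * y \<omega>))"
      by (simp only: exp_add mult.assoc)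
  qed fact
  also have "\<dots> = exp (a + c) * ((1/p) * exp (- (p * a)) * expectation (\<lambda>\<omega>. exp (p * x \<omega>)) + (1/q) * exp (- (q * c)) * expectation (\<lambda>\<omega>. exp (q * y \<omega>)))"
    using int by simp
  also have "\<dots> \<le> exp (a + c) * ((1/p) * exp (- (p * a)) * exp (p * a) + (1/q) * exp (- (q * c)) * exp (q * c))"
    using p q0 a c by (intro mult_left_mono add_mono) auto
  also have "\<dots> = exp (a + c)" using q by (simp add: exp_minus)
  finally show ?thesis .
qed

text \<open>In \<open>mart\<close>, \<open>A\<close> is the compensator of the exponential; in
  \<open>conc\<close>, \<open>Y n\<close> is negligible at the exponential scale \<open>v n\<close>
  for every slope. The exponent \<open>p\<close> is fixed before \<open>n\<close> grows, so the
  large conjugate \<open>q\<close> merely selects another slope in \<open>conc\<close>.\<close>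

lemma (in prob_space) log_laplace_tendsto:
  fixes Z Y :: "nat \<Rightarrow> 'a \<Rightarrow> real" and v :: "nat \<Rightarrow> real" and s l :: real
  assumes v: "eventually (\<lambda>n. v n > 0) sequentially"
    and Z[measurable]: "\<And>n. Z n \<in> borel_measurable M" and ZB: "\<And>n. \<exists>B. \<forall>\<omega>. \<bar>Z n \<omega>\<bar> \<le> B"
    and Y[measurable]: "\<And>n. Y n \<in> borel_measurable M" and YB: "\<And>n. \<exists>B. \<forall>\<omega>. \<bar>Y n \<omega>\<bar> \<le> B"
    and s: "s \<ge> 0"
    and mart: "\<And>l \<epsilon>. \<epsilon> > 0 \<Longrightarrow> eventually (\<lambda>n. \<exists>A\<in>borel_measurable M.
        expectation (\<lambda>\<omega>. exp (l * v n * Z n \<omega> - A \<omega>)) = 1 \<and>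
        (\<forall>\<omega>. \<bar>A \<omega> - l\<^sup>2 / 2 * v n * (s + Y n \<omega>)\<bar> \<le> \<epsilon> * v n)) sequentially"
    and conc: "\<And>t \<epsilon>. \<epsilon> > 0 \<Longrightarrow> eventually (\<lambda>n. expectation (\<lambda>\<omega>. exp (t * v n * Y n \<omega>)) \<le> exp (\<epsilon> * v n)) sequentially"
  shows "(\<lambda>n. ln (expectation (\<lambda>\<omega>. exp (l * v n * Z n \<omega>))) / v n) \<longlonglongrightarrow> l\<^sup>2 * s / 2"
proof (rule tendstoI)
  fix e :: real assume "e > 0"
  define \<epsilon> where "\<epsilon> = e / 2"
  have \<epsilon>: "\<epsilon> > 0" using \<open>e > 0\<close> by (simp add: \<epsilon>_def)
  \<comment> \<open>Multiplying or dividing \<open>l\<^sup>2 * s / 2\<close> by \<open>p\<close>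
    then moves it by at most \<open>\<epsilon> / 2\<close>; the summand 1 covers
    \<open>l\<^sup>2 * s = 0\<close>.\<close>
  define \<eta> where "\<eta> = \<epsilon> / (l\<^sup>2 * s + 1)"
  define p where "p = 1 + \<eta>"
  define q where "q = p / (p - 1)"
  have ls: "l\<^sup>2 * s \<ge> 0" using s by simp
  then have \<eta>: "\<eta> > 0" "\<eta> * (l\<^sup>2 * s) \<le> \<epsilon>"
    using \<epsilon> by (auto simp: \<eta>_def field_simps intro: add_nonneg_pos)
  then have p: "p > 1" by (simp add: p_def)
  have q: "1 / p + 1 / q = 1" "q > 1" using p by (auto simp: q_def field_simps)
  have p1: "p * l\<^sup>2 * s / 2 \<le> l\<^sup>2 * s / 2 + \<epsilon> / 2"
    using \<eta>(2) by (simp add: p_def algebra_simps)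
  have p2: "l\<^sup>2 * s / (2 * p) \<ge> l\<^sup>2 * s / 2 - \<epsilon> / 2"
  proof -
    have "l\<^sup>2 * s \<le> (l\<^sup>2 * s) / p + \<eta> * (l\<^sup>2 * s)"
    proof -
      have "1 \<le> 1 / p + \<eta>" using p \<eta>(1) by (simp add: p_def field_simps)
      from mult_right_mono[OF this ls] show ?thesis by (simp add: algebra_simps)
    qed
    with \<eta>(2) have "l\<^sup>2 * s / 2 - \<epsilon> / 2 \<le> (l\<^sup>2 * s) / p / 2" by simp
    then show ?thesis by (simp add: field_simps)
  qed
  have Zint: "integrable M (\<lambda>\<omega>. exp (c * Z n \<omega>))" for c n
    using ZB[of n] integrable_exp_cmult[OF Z[of n]] by blast
  have Yint: "integrable M (\<lambda>\<omega>. exp (c * Y n \<omega>))" for c n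
    using YB[of n] integrable_exp_cmult[OF Y[of n]] by blast
  have Epos: "expectation (\<lambda>\<omega>. exp (c * Z n \<omega>)) > 0" for c n
    by (rule expectation_exp_pos[OF Zint])
  have e8: "\<epsilon> / 8 > 0" and e8p: "\<epsilon> / (8 * p) > 0" using \<epsilon> p by auto
  text \<open>Hoelder against the exponential martingale at slope \<open>p l\<close> gives the upper bound,
    and at slope \<open>l / p\<close> (where it bounds the constant 1) the lower bound.\<close>
  have upper: "eventually (\<lambda>n. ln (expectation (\<lambda>\<omega>. exp (l * v n * Z n \<omega>))) \<le> (p * l\<^sup>2 * s / 2 + \<epsilon> / 4) * v n) sequentially"
    using v mart[of "\<epsilon> / 8" "p * l", OF e8] conc[of "\<epsilon> / 8" "p\<^sup>2 * l\<^sup>2 / (2 * (p - 1))", OF e8]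
  proof eventually_elim
    case (elim n)
    note E = elim(2,3)
    from E(1) obtain A where [measurable]: "A \<in> borel_measurable M"
      and A1: "expectation (\<lambda>\<omega>. exp (p * l * v n * Z n \<omega> - A \<omega>)) = 1"
      and A2: "\<And>\<omega>. \<bar>A \<omega> - (p * l)\<^sup>2 / 2 * v n * (s + Y n \<omega>)\<bar> \<le> \<epsilon> / 8 * v n" by blast
    let ?t = "p\<^sup>2 * l\<^sup>2 / (2 * (p - 1))"
    have Ale: "A \<omega> / (p - 1) \<le> (?t * s + \<epsilon> / 8 / (p - 1)) * v n + ?t * v n * Y n \<omega>" for \<omega>
    proof -
      have "A \<omega> / (p - 1) \<le> ((p * l)\<^sup>2 / 2 * v n * (s + Y n \<omega>) + \<epsilon> / 8 * v n) / (p - 1)"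
        using p by (intro divide_right_mono) (use A2[of \<omega>] in \<open>unfold abs_le_iff, linarith+\<close>)
      also have "\<dots> = (?t * s + \<epsilon> / 8 / (p - 1)) * v n + ?t * v n * Y n \<omega>"
      proof -
        have "((p * l)\<^sup>2 / 2 * v n * (s + Y n \<omega>) + \<epsilon> / 8 * v n) * d
          = ((p\<^sup>2 * l\<^sup>2 / 2 * d) * s + \<epsilon> / 8 * d) * v n + (p\<^sup>2 * l\<^sup>2 / 2 * d) * v n * Y n \<omega>" for d
          by (simp add: power_mult_distrib algebra_simps)
        from this[of "1 / (p - 1)"] show ?thesis by simp
      qed
      finally show ?thesis .
    qed
    \<comment> \<open>Raised to the power \<open>p\<close>, the first factor is the compensated
      exponential at slope \<open>p * l\<close>, with expectation 1; the remainder
      \<open>A / p\<close> depends on \<open>Y n\<close> up to a small error.\<close>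
    let ?x = "\<lambda>\<omega>. l * v n * Z n \<omega> - A \<omega> / p" and ?y = "\<lambda>\<omega>. A \<omega> / p"
    let ?c = "(p - 1) / p * ((?t * s + \<epsilon> / 8 / (p - 1)) + \<epsilon> / 8) * v n"
    have px: "p * ?x \<omega> = p * l * v n * Z n \<omega> - A \<omega>" for \<omega> using p by (simp add: field_simps)
    have qy: "q * ?y \<omega> = A \<omega> / (p - 1)" for \<omega> using p by (simp add: q_def)
    have "expectation (\<lambda>\<omega>. exp (?x \<omega> + ?y \<omega>)) \<le> exp (0 + ?c)"
    proof (rule exp_Holder[OF p q(1)])
      show "integrable M (\<lambda>\<omega>. exp (?x \<omega> + ?y \<omega>))" using Zint[of "l * v n" n] by simp
      \<comment> \<open>Integrability follows from the value 1, as the integral of a non-integrable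
        function is 0.\<close>
      show "integrable M (\<lambda>\<omega>. exp (p * ?x \<omega>))" unfolding px using A1 not_integrable_integral_eq by fastforce
      have maj: "integrable M (\<lambda>\<omega>. exp ((?t * s + \<epsilon> / 8 / (p - 1)) * v n) * exp (?t * v n * Y n \<omega>))"
        by (intro integrable_mult_right Yint)
      show int: "integrable M (\<lambda>\<omega>. exp (q * ?y \<omega>))" unfolding qy
        by (rule Bochner_Integration.integrable_bound[OF maj]) (use Ale in \<open>auto simp flip: exp_add\<close>)
      show "expectation (\<lambda>\<omega>. exp (p * ?x \<omega>)) \<le> exp (p * 0)" unfolding px A1 by simp
      have "expectation (\<lambda>\<omega>. exp (q * ?y \<omega>)) \<le> expectation (\<lambda>\<omega>. exp ((?t * s + \<epsilon> / 8 / (p - 1)) * v n) * exp (?t * v n * Y n \<omega>))"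
        unfolding qy using Ale by (intro integral_mono int[unfolded qy] maj) (simp flip: exp_add)
      also have "\<dots> \<le> exp ((?t * s + \<epsilon> / 8 / (p - 1)) * v n) * exp (\<epsilon> / 8 * v n)"
        using E(2) by simp
      also have "\<dots> = exp (q * ?c)"
        unfolding exp_add[symmetric] using p by (simp add: q_def) (simp add: algebra_simps)
      finally show "expectation (\<lambda>\<omega>. exp (q * ?y \<omega>)) \<le> exp (q * ?c)" .
    qed
    then have "expectation (\<lambda>\<omega>. exp (l * v n * Z n \<omega>)) \<le> exp ?c" by simp
    then have "ln (expectation (\<lambda>\<omega>. exp (l * v n * Z n \<omega>))) \<le> ln (exp ?c)"
      using Epos[of "l * v n" n] by (subst ln_le_cancel_iff) auto
    then have "ln (expectation (\<lambda>\<omega>. exp (l * v n * Z n \<omega>))) \<le> ?c" by (simp only: ln_exp)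
    also have "(p - 1) / p * ((?t * s + \<epsilon> / 8 / (p - 1)) + \<epsilon> / 8) = p * l\<^sup>2 * s / 2 + \<epsilon> / 8"
    proof -
      have "w / (w + 1) * (((w + 1)\<^sup>2 * l\<^sup>2 / (2 * w) * s + \<epsilon> / 8 / w) + \<epsilon> / 8) = (w + 1) * l\<^sup>2 * s / 2 + \<epsilon> / 8"
        if "w > 0" for w using that by (simp add: divide_simps) (simp add: algebra_simps power2_eq_square)
      from this[of "p - 1"] p show ?thesis by simp
    qed
    also have "(p * l\<^sup>2 * s / 2 + \<epsilon> / 8) * v n \<le> (p * l\<^sup>2 * s / 2 + \<epsilon> / 4) * v n"
      using elim(1) \<epsilon> by (intro mult_right_mono) auto
    finally show ?case .
  qed
  have lower: "eventually (\<lambda>n. (l\<^sup>2 * s / (2 * p) - \<epsilon> / 4) * v n \<le> ln (expectation (\<lambda>\<omega>. exp (l * v n * Z n \<omega>)))) sequentially"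
    using v mart[of "\<epsilon> / (8 * p)" "l / p", OF e8p] conc[of "\<epsilon> / (8 * p)" "- q * l\<^sup>2 / (2 * p\<^sup>2)", OF e8p]
  proof eventually_elim
    case (elim n)
    note E = elim(2,3)
    from E(1) obtain A where [measurable]: "A \<in> borel_measurable M"
      and A1: "expectation (\<lambda>\<omega>. exp (l / p * v n * Z n \<omega> - A \<omega>)) = 1"
      and A2: "\<And>\<omega>. \<bar>A \<omega> - (l / p)\<^sup>2 / 2 * v n * (s + Y n \<omega>)\<bar> \<le> \<epsilon> / (8 * p) * v n" by blast
    let ?t = "- q * l\<^sup>2 / (2 * p\<^sup>2)"
    have Ale: "q * - A \<omega> \<le> (?t * s + q * (\<epsilon> / (8 * p))) * v n + ?t * v n * Y n \<omega>" for \<omega>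
    proof -
      have "q * - A \<omega> \<le> q * (\<epsilon> / (8 * p) * v n - (l / p)\<^sup>2 / 2 * v n * (s + Y n \<omega>))"
        using q(2) by (intro mult_left_mono) (use A2[of \<omega>] in \<open>unfold abs_le_iff, linarith+\<close>)
      also have "\<dots> = (?t * s + q * (\<epsilon> / (8 * p))) * v n + ?t * v n * Y n \<omega>"
        by (simp add: power_divide algebra_simps add_divide_distrib diff_divide_distrib)
      finally show ?thesis .
    qed
    \<comment> \<open>The compensated exponential at slope \<open>l / p\<close> has expectation 1.
      Its factor in \<open>Z n\<close>, raised to the power \<open>p\<close>, is the moment to be
      bounded from below; the factor in \<open>A\<close> needs only an upper bound.\<close>
    let ?x = "\<lambda>\<omega>. l / p * v n * Z n \<omega>" and ?y = "\<lambda>\<omega>. - A \<omega>"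
    let ?a = "ln (expectation (\<lambda>\<omega>. exp (l * v n * Z n \<omega>))) / p"
    let ?c = "((?t * s + q * (\<epsilon> / (8 * p))) + \<epsilon> / (8 * p)) * v n / q"
    have qc: "q * ?c = ((?t * s + q * (\<epsilon> / (8 * p))) + \<epsilon> / (8 * p)) * v n" using q(2) by simp
    have px: "p * ?x \<omega> = l * v n * Z n \<omega>" for \<omega> using p by simp
    have "expectation (\<lambda>\<omega>. exp (?x \<omega> + ?y \<omega>)) \<le> exp (?a + ?c)"
    proof (rule exp_Holder[OF p q(1)])
      show "integrable M (\<lambda>\<omega>. exp (?x \<omega> + ?y \<omega>))" using A1 not_integrable_integral_eq by fastforce
      show "integrable M (\<lambda>\<omega>. exp (p * ?x \<omega>))" unfolding px by (rule Zint)
      have maj: "integrable M (\<lambda>\<omega>. exp ((?t * s + q * (\<epsilon> / (8 * p))) * v n) * exp (?t * v n * Y n \<omega>))"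
        by (intro integrable_mult_right Yint)
      show int: "integrable M (\<lambda>\<omega>. exp (q * ?y \<omega>))"
        by (rule Bochner_Integration.integrable_bound[OF maj]) (use Ale in \<open>auto simp flip: exp_add\<close>)
      show "expectation (\<lambda>\<omega>. exp (p * ?x \<omega>)) \<le> exp (p * ?a)" unfolding px using p Epos[of "l * v n" n] by simp
      have "expectation (\<lambda>\<omega>. exp (q * ?y \<omega>)) \<le> expectation (\<lambda>\<omega>. exp ((?t * s + q * (\<epsilon> / (8 * p))) * v n) * exp (?t * v n * Y n \<omega>))"
        using Ale by (intro integral_mono int maj) (simp flip: exp_add)
      also have "\<dots> \<le> exp ((?t * s + q * (\<epsilon> / (8 * p))) * v n) * exp (\<epsilon> / (8 * p) * v n)"
        using E(2) by simp
      also have "\<dots> = exp (q * ?c)"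
        unfolding qc by (simp only: exp_add distrib_right)
      finally show "expectation (\<lambda>\<omega>. exp (q * ?y \<omega>)) \<le> exp (q * ?c)" .
    qed
    then have "exp 0 \<le> exp (?a + ?c)" using A1 by simp
    then have "0 \<le> ?a + ?c" by (simp only: exp_le_cancel_iff)
    then have "p * - ?c \<le> p * ?a" using p by (intro mult_left_mono) auto
    also have "p * ?a = ln (expectation (\<lambda>\<omega>. exp (l * v n * Z n \<omega>)))" using p by simp
    also have "p * - ?c = (l\<^sup>2 * s / (2 * p) - \<epsilon> / 8 - \<epsilon> / (8 * q)) * v n"
      using p q(2) by (simp add: field_simps power2_eq_square)
    finally have "(l\<^sup>2 * s / (2 * p) - \<epsilon> / 8 - \<epsilon> / (8 * q)) * v n \<le> ln (expectation (\<lambda>\<omega>. exp (l * v n * Z n \<omega>)))" .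
    moreover have "\<epsilon> / (8 * q) \<le> \<epsilon> / 8" using q(2) \<epsilon> by (simp add: field_simps)
    then have "(l\<^sup>2 * s / (2 * p) - \<epsilon> / 4) * v n \<le> (l\<^sup>2 * s / (2 * p) - \<epsilon> / 8 - \<epsilon> / (8 * q)) * v n"
      using elim(1) by (intro mult_right_mono) auto
    ultimately show ?case by linarith
  qed
  show "eventually (\<lambda>n. dist (ln (expectation (\<lambda>\<omega>. exp (l * v n * Z n \<omega>))) / v n) (l\<^sup>2 * s / 2) < e) sequentially"
    using v upper lower
  proof eventually_elim
    case (elim n)
    let ?L = "ln (expectation (\<lambda>\<omega>. exp (l * v n * Z n \<omega>))) / v n"
    have "?L \<le> p * l\<^sup>2 * s / 2 + \<epsilon> / 4" using elim by (simp add: pos_divide_le_eq)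
    moreover have "l\<^sup>2 * s / (2 * p) - \<epsilon> / 4 \<le> ?L" using elim by (simp add: pos_le_divide_eq)
    ultimately have "\<bar>?L - l\<^sup>2 * s / 2\<bar> \<le> \<epsilon>" using p1 p2 \<epsilon> unfolding abs_le_iff by linarith
    also have "\<epsilon> < e" using \<open>e > 0\<close> by (simp add: \<epsilon>_def)
    finally show ?case by (simp add: dist_real_def)
  qed
qed

section \<open>Small-parameter expansion and the growth conditions\<close>

lemma exp_minus_taylor2_le:
  fixes y :: real assumes "\<bar>y\<bar> \<le> 1" shows "\<bar>exp y - (1 + y + y\<^sup>2 / 2)\<bar> \<le> \<bar>y\<bar> ^ 3"
proof -
  obtain t where t: "\<bar>t\<bar> \<le> \<bar>y\<bar>" "exp y = (\<Sum>m<3. y ^ m / fact m) + exp t / fact 3 * y ^ 3"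
    using Maclaurin_exp_le[of y 3] by blast
  have "exp t \<le> exp 1" using t(1) assms by simp
  also have "exp 1 \<le> (3::real)" by (rule exp_le)
  finally have et: "exp t / 6 \<le> 1" by simp
  have "exp y - (1 + y + y\<^sup>2 / 2) = exp t / 6 * y ^ 3"
    using t(2) by (simp add: eval_nat_numeral)
  then have "\<bar>exp y - (1 + y + y\<^sup>2 / 2)\<bar> = exp t / 6 * \<bar>y\<bar> ^ 3" by (simp only: abs_mult power_abs) simp
  also have "\<dots> \<le> 1 * \<bar>y\<bar> ^ 3" using et by (intro mult_right_mono) auto
  finally show ?thesis by simp
qed

text \<open>\<open>Pf\<close> kills the first-order term, and both the Taylor remainder of
  \<open>exp\<close> and that of \<open>ln\<close> are at most the cube of
  \<open>\<bar>\<theta>\<bar> * F\<close>, uniformly in the starting point.\<close>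

lemma (in transition) ln_Pop_exp_expansion:
  assumes f: "bounded_meas S3 f" and Pf: "\<And>x. Pop P f x = 0" and \<epsilon>: "\<epsilon> > 0"
  obtains \<eta> where "\<eta> > 0"
    "\<And>\<theta> x. \<bar>\<theta>\<bar> \<le> \<eta> \<Longrightarrow>
      \<bar>ln (Pop P (\<lambda>t. exp (\<theta> * f t)) x) - \<theta>\<^sup>2 / 2 * Pop P (\<lambda>t. (f t)\<^sup>2) x\<bar> \<le> \<epsilon> * \<theta>\<^sup>2"
proof -
  obtain F0 where F0: "\<And>t. \<bar>f t\<bar> \<le> F0" "f \<in> borel_measurable S3" by (rule bounded_measE[OF f]) blast
  define F where "F = max 1 F0"
  have F: "F \<ge> 1" "\<And>t. \<bar>f t\<bar> \<le> F" using F0 by (auto simp: F_def le_max_iff_disj)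
  have f2B: "\<bar>(f t)\<^sup>2\<bar> \<le> F\<^sup>2" for t using power_mono[OF F(2)[of t], of 2] by simp
  have f2: "bounded_meas S3 (\<lambda>t. (f t)\<^sup>2)"
    using F0(2) f2B by (intro bounded_measI[where B="F\<^sup>2"]) auto
  \<comment> \<open>The first bound keeps the arguments of \<open>exp\<close> and \<open>ln\<close>
    in the range of the two remainder estimates; the second makes the cubic error at most
    \<open>\<epsilon> * \<theta>\<^sup>2\<close>, with room to spare.\<close>
  define \<eta> where "\<eta> = min (1 / (2 * F)) (\<epsilon> / (6 * F ^ 3))"
  have \<eta>: "\<eta> > 0" using F \<epsilon> by (simp add: \<eta>_def)
  show thesis
  proof (rule that[OF \<eta>])
    fix \<theta> x assume \<theta>: "\<bar>\<theta>\<bar> \<le> \<eta>"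
    then have "\<bar>\<theta>\<bar> \<le> 1 / (2 * F)" "\<bar>\<theta>\<bar> \<le> \<epsilon> / (6 * F ^ 3)" by (auto simp: \<eta>_def)
    then have b1: "\<bar>\<theta>\<bar> * F \<le> 1 / 2" and b2: "6 * (\<bar>\<theta>\<bar> * F ^ 3) \<le> \<epsilon>" using F by (auto simp: field_simps)
    define a where "a = \<bar>\<theta>\<bar> * F"
    have a: "0 \<le> a" "a \<le> 1 / 2" using b1 F by (auto simp: a_def)
    have yB: "\<bar>\<theta> * f t\<bar> \<le> a" for t unfolding a_def abs_mult by (intro mult_left_mono F) auto
    define R where "R t = exp (\<theta> * f t) - (1 + \<theta> * f t + (\<theta> * f t)\<^sup>2 / 2)" for t
    have RB: "\<bar>R t\<bar> \<le> a ^ 3" for t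
    proof -
      have "\<bar>R t\<bar> \<le> \<bar>\<theta> * f t\<bar> ^ 3" unfolding R_def using yB[of t] a by (intro exp_minus_taylor2_le) linarith
      also have "\<dots> \<le> a ^ 3" using yB by (intro power_mono) auto
      finally show ?thesis .
    qed
    have Rb: "bounded_meas S3 R"
      unfolding R_def[abs_def] using F0(2) RB by (intro bounded_measI[where B="a ^ 3"]) (auto simp: R_def)
    have "Pop P (\<lambda>t. exp (\<theta> * f t)) x = Pop P (\<lambda>t. ((1 + \<theta> * f t) + \<theta>\<^sup>2 / 2 * (f t)\<^sup>2) + R t) x"
      by (simp add: R_def power_mult_distrib)
    also have "\<dots> = (1 + \<theta> * Pop P f x) + \<theta>\<^sup>2 / 2 * Pop P (\<lambda>t. (f t)\<^sup>2) x + Pop P R x"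
      by (simp only: Pop_add[OF bounded_meas_add[OF bounded_meas_add[OF bounded_meas_const bounded_meas_cmult[OF f]] bounded_meas_cmult[OF f2]] Rb]
        Pop_add[OF bounded_meas_add[OF bounded_meas_const bounded_meas_cmult[OF f]] bounded_meas_cmult[OF f2]]
        Pop_add[OF bounded_meas_const bounded_meas_cmult[OF f]] Pop_cmult Pop_const)
    finally have eq: "Pop P (\<lambda>t. exp (\<theta> * f t)) x = 1 + (\<theta>\<^sup>2 / 2 * Pop P (\<lambda>t. (f t)\<^sup>2) x + Pop P R x)"
      by (simp add: Pf)
    define u where "u = \<theta>\<^sup>2 / 2 * Pop P (\<lambda>t. (f t)\<^sup>2) x + Pop P R x"
    have PR: "\<bar>Pop P R x\<bar> \<le> a ^ 3" by (rule Pop_bound[OF Rb RB])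
    have Pf2: "\<bar>\<theta>\<^sup>2 / 2 * Pop P (\<lambda>t. (f t)\<^sup>2) x\<bar> \<le> a\<^sup>2 / 2"
    proof -
      have "\<theta>\<^sup>2 / 2 * \<bar>Pop P (\<lambda>t. (f t)\<^sup>2) x\<bar> \<le> \<theta>\<^sup>2 / 2 * F\<^sup>2"
        by (intro mult_left_mono Pop_bound[OF f2 f2B]) auto
      then show ?thesis by (simp add: a_def abs_mult power_mult_distrib)
    qed
    have a3: "a ^ 3 \<le> a\<^sup>2 / 2"
      using mult_left_mono[OF a(2), of "a\<^sup>2"] by (simp add: power3_eq_cube power2_eq_square)
    have u: "\<bar>u\<bar> \<le> a\<^sup>2" using PR Pf2 a3 unfolding u_def by linarith
    have a2: "a\<^sup>2 \<le> 1 / 4" using power_mono[OF a(2) a(1), of 2] by (simp add: power2_eq_square)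
    have "\<bar>ln (1 + u) - u\<bar> \<le> 2 * u\<^sup>2" using u a2 by (intro abs_ln_one_plus_x_minus_x_bound) linarith
    also have "u\<^sup>2 \<le> (a\<^sup>2)\<^sup>2" using u by (metis abs_ge_zero power2_abs power_mono)
    also have "(a\<^sup>2)\<^sup>2 \<le> a ^ 3 / 2"
      using mult_left_mono[OF a(2), of "a ^ 3"] a(1) by (simp add: power3_eq_cube power2_eq_square)
    finally have ln: "\<bar>ln (1 + u) - u\<bar> \<le> a ^ 3" by simp
    have "\<bar>ln (1 + u) - \<theta>\<^sup>2 / 2 * Pop P (\<lambda>t. (f t)\<^sup>2) x\<bar> \<le> 2 * a ^ 3"
      using ln PR unfolding u_def by linarith
    also have "\<dots> = \<theta>\<^sup>2 * (2 * (\<bar>\<theta>\<bar> * F ^ 3))"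
      by (simp add: a_def power3_eq_cube power2_eq_square)
    also have "\<dots> \<le> \<theta>\<^sup>2 * \<epsilon>"
    proof (intro mult_left_mono)
      have "0 \<le> \<bar>\<theta>\<bar> * F ^ 3" using F by simp
      with b2 show "2 * (\<bar>\<theta>\<bar> * F ^ 3) \<le> \<epsilon>" by linarith
    qed simp
    finally show "\<bar>ln (Pop P (\<lambda>t. exp (\<theta> * f t)) x) - \<theta>\<^sup>2 / 2 * Pop P (\<lambda>t. (f t)\<^sup>2) x\<bar> \<le> \<epsilon> * \<theta>\<^sup>2"
      by (simp add: eq u_def mult.commute)
  qed
qed

text \<open>A probability average stays between the extreme values of its integrand. Positivity lets
  the exponential be normalised by its mean; the bound keeps the compensator bounded.\<close>

lemma (in transition) ln_Pop_exp_bound: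
  assumes f: "bounded_meas S3 f" and F: "\<And>t. \<bar>f t\<bar> \<le> F"
  shows "Pop P (\<lambda>t. exp (f t)) x > 0" and "\<bar>ln (Pop P (\<lambda>t. exp (f t)) x)\<bar> \<le> F"
proof -
  have e: "bounded_meas S3 (\<lambda>t. exp (f t))" by (rule bounded_meas_exp[OF f])
  have "Pop P (\<lambda>t. exp (- F)) x \<le> Pop P (\<lambda>t. exp (f t)) x"
    using F by (intro Pop_mono e bounded_meas_const) (metis abs_le_iff exp_le_cancel_iff minus_le_iff)
  then have lo: "exp (- F) \<le> Pop P (\<lambda>t. exp (f t)) x" by simp
  have "Pop P (\<lambda>t. exp (f t)) x \<le> Pop P (\<lambda>t. exp F) x"
    using F by (intro Pop_mono e bounded_meas_const) (metis abs_le_iff exp_le_cancel_iff)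
  then have up: "Pop P (\<lambda>t. exp (f t)) x \<le> exp F" by simp
  show pos: "Pop P (\<lambda>t. exp (f t)) x > 0" using lo exp_gt_zero less_le_trans by blast
  have "ln (exp (- F)) \<le> ln (Pop P (\<lambda>t. exp (f t)) x)" using lo pos by (subst ln_le_cancel_iff) auto
  moreover have "ln (Pop P (\<lambda>t. exp (f t)) x) \<le> ln (exp F)" using up pos by (subst ln_le_cancel_iff) auto
  ultimately show "\<bar>ln (Pop P (\<lambda>t. exp (f t)) x)\<bar> \<le> F" by (simp add: abs_le_iff)
qed

text \<open>The three regimes of the hypothesis merge into one once the rate is enlarged to some
  \<open>\<beta> > 1/2\<close>.\<close>

lemma growth_condition:
  fixes b :: "nat \<Rightarrow> real" and \<alpha> :: real
  assumes \<alpha>: "0 < \<alpha>" "\<alpha> < 1" and b: "\<And>n. b n > 0"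
    and lt: "\<alpha>\<^sup>2 < 1/2 \<Longrightarrow> (\<lambda>n. b n / real n) \<longlonglongrightarrow> 0"
    and eq: "\<alpha>\<^sup>2 = 1/2 \<Longrightarrow> (\<lambda>n. b n * ln (real n) / real n) \<longlonglongrightarrow> 0"
    and gt: "\<alpha>\<^sup>2 > 1/2 \<Longrightarrow> (\<lambda>n. b n * \<alpha> ^ (rgen n + 1) / sqrt (real n)) \<longlonglongrightarrow> 0"
  obtains \<beta> where "\<alpha> \<le> \<beta>" "1/2 < \<beta>" "\<beta> < 1"
    "(\<lambda>n. (b n / n)\<^sup>2 * (\<Sum>j\<le>rgen n. (2 * \<beta>\<^sup>2) ^ j)) \<longlonglongrightarrow> 0"
proof -
  let ?S = "\<lambda>\<beta> n. \<Sum>j\<le>rgen n. (2 * \<beta>\<^sup>2) ^ j"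
  consider "\<alpha>\<^sup>2 < 1/2" | "\<alpha>\<^sup>2 = 1/2" | "\<alpha>\<^sup>2 > 1/2" by linarith
  then show thesis
  proof cases
    case 1
    \<comment> \<open>Any number strictly between 1/2 and 1 / sqrt 2 would serve: 3/5 exceeds 1/2,
      and 2 (3/5)^2 = 18/25 is below 1.\<close>
    define \<beta> where "\<beta> = max \<alpha> (3/5)"
    have \<beta>: "\<alpha> \<le> \<beta>" "1/2 < \<beta>" "\<beta> < 1" "2 * \<beta>\<^sup>2 < 1" using \<alpha> 1 by (auto simp: \<beta>_def max_def power2_eq_square)
    have S: "?S \<beta> n \<le> 1 / (1 - 2 * \<beta>\<^sup>2)" for n
    proof -
      have "?S \<beta> n = (1 - (2 * \<beta>\<^sup>2) ^ Suc (rgen n)) / (1 - 2 * \<beta>\<^sup>2)"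
        using \<beta>(4) sum_gp0[of "2 * \<beta>\<^sup>2" "rgen n"] by (simp del: power_Suc)
      also have "\<dots> \<le> 1 / (1 - 2 * \<beta>\<^sup>2)" using \<beta> by (intro divide_right_mono) auto
      finally show ?thesis .
    qed
    have "(\<lambda>n. (b n / n)\<^sup>2 * (1 / (1 - 2 * \<beta>\<^sup>2))) \<longlonglongrightarrow> 0\<^sup>2 * (1 / (1 - 2 * \<beta>\<^sup>2))"
      by (intro tendsto_intros lt 1)
    then have "(\<lambda>n. (b n / n)\<^sup>2 * (1 / (1 - 2 * \<beta>\<^sup>2))) \<longlonglongrightarrow> 0" by simp
    then have "(\<lambda>n. (b n / n)\<^sup>2 * ?S \<beta> n) \<longlonglongrightarrow> 0"
    proof (rule Lim_null_comparison[rotated], intro eventuallyI)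
      fix n
      have "0 \<le> ?S \<beta> n" by (intro sum_nonneg) auto
      then show "norm ((b n / n)\<^sup>2 * ?S \<beta> n) \<le> (b n / n)\<^sup>2 * (1 / (1 - 2 * \<beta>\<^sup>2))"
        using mult_left_mono[OF S[of n], of "(b n / n)\<^sup>2"] by (simp add: abs_mult)
    qed
    with \<beta> show thesis by (intro that)
  next
    case 2
    have h: "1/2 < \<alpha>"
    proof (rule ccontr)
      assume "\<not> 1/2 < \<alpha>"
      then have "\<alpha>\<^sup>2 \<le> (1/2)\<^sup>2" using \<alpha> by (intro power_mono) auto
      then show False using 2 by (simp add: power2_eq_square)
    qed
    note bln = eq[OF 2]
    have bn: "(\<lambda>n. b n / real n) \<longlonglongrightarrow> 0"
    proof (rule Lim_null_comparison[OF _ bln])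
      show "eventually (\<lambda>n. norm (b n / real n) \<le> b n * ln (real n) / real n) sequentially"
        using eventually_ge_at_top[of 3]
      proof eventually_elim
        case (elim n)
        have "exp 1 \<le> real n" using exp_le elim by linarith
        then have "1 \<le> ln (real n)" using elim by (subst ln_ge_iff) auto
        then show ?case using b[of n] elim by (simp add: divide_right_mono)
      qed
    qed
    \<comment> \<open>With ratio 1 the sum has \<open>rgen n + 1\<close> terms, at most
      \<open>ln (real n) / ln 2 + 1\<close>; one factor \<open>b n / n\<close> absorbs the
      logarithm, the other tends to 0.\<close>
    have "(\<lambda>n. b n / n * (b n * ln (real n) / real n / ln 2 + b n / n)) \<longlonglongrightarrow> 0 * (0 / ln 2 + 0)"
      by (intro tendsto_intros bn bln) simp
    then have lim: "(\<lambda>n. b n / n * (b n * ln (real n) / real n / ln 2 + b n / n)) \<longlonglongrightarrow> 0" by simp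
    have "(\<lambda>n. (b n / n)\<^sup>2 * ?S \<alpha> n) \<longlonglongrightarrow> 0"
    proof (rule Lim_null_comparison[OF _ lim])
      show "eventually (\<lambda>n. norm ((b n / n)\<^sup>2 * ?S \<alpha> n) \<le> b n / n * (b n * ln (real n) / real n / ln 2 + b n / n)) sequentially"
        using eventually_ge_at_top[of 1]
      proof eventually_elim
        case (elim n)
        have S: "?S \<alpha> n = rgen n + 1" by (simp add: 2)
        have "2 ^ rgen n \<le> real n" using rgen_bounds(1)[OF elim] by (simp flip: of_nat_le_iff)
        then have "ln (2 ^ rgen n) \<le> ln (real n)" using elim by (subst ln_le_cancel_iff) auto
        then have "rgen n \<le> ln (real n) / ln 2" by (simp add: ln_realpow field_simps)
        then have "(b n / n)\<^sup>2 * ?S \<alpha> n \<le> (b n / n)\<^sup>2 * (ln (real n) / ln 2 + 1)"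
          unfolding S by (intro mult_left_mono) auto
        also have "\<dots> = b n / n * (b n * ln (real n) / real n / ln 2 + b n / n)"
          by (simp add: power2_eq_square algebra_simps add_divide_distrib)
        finally show ?case using S by (simp add: abs_mult)
      qed
    qed
    with h \<alpha> show thesis by (intro that[of \<alpha>]) auto
  next
    case 3
    have h: "1/2 < \<alpha>"
    proof (rule ccontr)
      assume "\<not> 1/2 < \<alpha>"
      then have "\<alpha>\<^sup>2 \<le> (1/2)\<^sup>2" using \<alpha> by (intro power_mono) auto
      then show False using 3 by (simp add: power2_eq_square)
    qed
    let ?C = "2 / (2 * \<alpha>\<^sup>2 - 1)"
    have "(\<lambda>n. ?C * (b n * \<alpha> ^ (rgen n + 1) / sqrt (real n))\<^sup>2) \<longlonglongrightarrow> ?C * 0\<^sup>2"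
      by (intro tendsto_intros gt 3)
    then have lim: "(\<lambda>n. ?C * (b n * \<alpha> ^ (rgen n + 1) / sqrt (real n))\<^sup>2) \<longlonglongrightarrow> 0" by simp
    have "(\<lambda>n. (b n / n)\<^sup>2 * ?S \<alpha> n) \<longlonglongrightarrow> 0"
    proof (rule Lim_null_comparison[OF _ lim])
      show "eventually (\<lambda>n. norm ((b n / n)\<^sup>2 * ?S \<alpha> n) \<le> ?C * (b n * \<alpha> ^ (rgen n + 1) / sqrt (real n))\<^sup>2) sequentially"
        using eventually_ge_at_top[of 1]
      proof eventually_elim
        case (elim n)
        let ?r = "Suc (rgen n)"
        have S0: "0 \<le> ?S \<alpha> n" by (intro sum_nonneg) auto
        \<comment> \<open>With ratio above 1 the sum is of the order of its last term, and
          \<open>2 ^ ?r \<le> 2 * real n\<close> turns the whole product into the square of the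
          assumed null sequence.\<close>
        have "?S \<alpha> n = ((2 * \<alpha>\<^sup>2) ^ ?r - 1) / (2 * \<alpha>\<^sup>2 - 1)"
          using 3 geometric_sum[of "2 * \<alpha>\<^sup>2" ?r] by (simp add: lessThan_Suc_atMost del: power_Suc)
        also have "\<dots> \<le> (2 * \<alpha>\<^sup>2) ^ ?r / (2 * \<alpha>\<^sup>2 - 1)"
          using 3 by (intro divide_right_mono) auto
        also have "(2 * \<alpha>\<^sup>2) ^ ?r = 2 ^ ?r * (\<alpha> ^ ?r)\<^sup>2"
          by (simp only: power_mult_distrib power_mult[symmetric] mult.commute)
        also have "2 ^ ?r * (\<alpha> ^ ?r)\<^sup>2 / (2 * \<alpha>\<^sup>2 - 1) \<le> 2 * real n * (\<alpha> ^ ?r)\<^sup>2 / (2 * \<alpha>\<^sup>2 - 1)"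
        proof (intro divide_right_mono mult_right_mono)
          have "2 ^ rgen n \<le> real n" using rgen_bounds(1)[OF elim] by (simp flip: of_nat_le_iff)
          then show "2 ^ ?r \<le> 2 * real n" by simp
        qed (use 3 in auto)
        also have "\<dots> = ?C * real n * (\<alpha> ^ ?r)\<^sup>2" by simp
        finally have "(b n / n)\<^sup>2 * ?S \<alpha> n \<le> (b n / n)\<^sup>2 * (?C * real n * (\<alpha> ^ ?r)\<^sup>2)"
          by (rule mult_left_mono) simp
        also have "\<dots> = ?C * (b n * \<alpha> ^ (rgen n + 1) / sqrt (real n))\<^sup>2"
        proof -
          have "(b n / n)\<^sup>2 * (C * real n * x\<^sup>2) = C * (b n * x / sqrt (real n))\<^sup>2" for C x
            using elim by (simp add: power_mult_distrib power_divide) (simp add: power2_eq_square)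
          from this[of ?C "\<alpha> ^ ?r"] show ?thesis by simp
        qed
        finally show ?case using S0 by (simp add: abs_mult)
      qed
    qed
    with h \<alpha> show thesis by (intro that[of \<alpha>]) auto
  qed
qed

theorem theorem3p6:
  fixes M :: "'w measure"
    and X :: "nat \<Rightarrow> 'w \<Rightarrow> 'a::metric_space"
    and \<pi> :: "'w \<Rightarrow> nat \<Rightarrow> nat"
    and \<nu> \<mu> :: "'a measure"
    and P :: "'a \<Rightarrow> ('a \<times> 'a) measure"
    and f :: "'a \<times> 'a \<times> 'a \<Rightarrow> real"
    and b :: "nat \<Rightarrow> real"
    and \<alpha> :: real
  assumes "prob_space M"
    and "T_transition P"
    and "BMC M X \<nu> P"
    and "random_gen_perm M X \<pi>"
    and "prob_space \<mu>" and "sets \<mu> = sets borel"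
    and "H2 P \<mu> \<alpha>"
    and "bounded_meas S3 f"
    and "\<forall>x. Pop P f x = 0"
    and "incseq b" and "\<forall>n. b n > 0"
    and "filterlim (\<lambda>n. b n / sqrt (real n)) at_top sequentially"
    and "\<alpha>^2 < 1/2 \<Longrightarrow> (\<lambda>n. b n / real n) \<longlonglongrightarrow> 0"
    and "\<alpha>^2 = 1/2 \<Longrightarrow> (\<lambda>n. b n * ln (real n) / real n) \<longlonglongrightarrow> 0"
    and "\<alpha>^2 > 1/2 \<Longrightarrow> (\<lambda>n. b n * \<alpha> ^ (rgen n + 1) / sqrt (real n)) \<longlonglongrightarrow> 0"
  shows "dev_principle M (\<lambda>n \<omega>. Mpi X \<pi> n f \<omega> / b n) (\<lambda>n. (b n)^2 / real n)
           (gauss_rate (\<integral>x. Pop P (\<lambda>t. (f t)^2) x \<partial>\<mu>))"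
proof -
  interpret M: prob_space M by fact
  interpret bmc M P X \<nu> by unfold_locales fact+
  interpret bmc_perm M P X \<nu> \<pi>
    by unfold_locales (use assms(4) X_measurable in auto)
  interpret \<mu>: prob_space \<mu> by fact
  have b: "b n > 0" for n using assms(11) by simp
  define v where "v n = (b n)\<^sup>2 / real n" for n
  define s where "s = (\<integral>x. Pop P (\<lambda>t. (f t)\<^sup>2) x \<partial>\<mu>)"
  \<comment> \<open>Centred under \<open>\<mu>\<close>, so that (H2) applies to it.\<close>
  define g where "g x = Pop P (\<lambda>t. (f t)\<^sup>2) x - s" for x
  define Z where "Z n \<omega> = Mpi X \<pi> n f \<omega> / b n" for n \<omega>
  define Y where "Y n \<omega> = (\<Sum>i=1..n. g (X (\<pi> \<omega> i) \<omega>)) / n" for n \<omega>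
  note f = assms(8)
  obtain F where F: "\<And>t. \<bar>f t\<bar> \<le> F" "f \<in> borel_measurable S3" by (rule bounded_measE[OF f]) blast
  have f2B: "\<bar>(f t)\<^sup>2\<bar> \<le> F\<^sup>2" for t using power_mono[OF F(1)[of t], of 2] by simp
  have f2: "bounded_meas S3 (\<lambda>t. (f t)\<^sup>2)"
    using F(2) f2B by (intro bounded_measI[where B="F\<^sup>2"]) auto
  have Pf2: "bounded_meas borel (Pop P (\<lambda>t. (f t)\<^sup>2))" by (rule bounded_meas_Pop[OF f2])
  have Pf2int: "integrable \<mu> (Pop P (\<lambda>t. (f t)\<^sup>2))"
  proof (rule \<mu>.integrable_const_bound)
    show "AE x in \<mu>. norm (Pop P (\<lambda>t. (f t)\<^sup>2) x) \<le> F\<^sup>2" using Pop_bound[OF f2 f2B] by simp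
    show "Pop P (\<lambda>t. (f t)\<^sup>2) \<in> borel_measurable \<mu>"
      using Pf2 assms(6) by (simp add: bounded_meas_def cong: measurable_cong_sets)
  qed
  have s: "s \<ge> 0" unfolding s_def Pop_def by simp
  have g: "bounded_meas borel g"
    using bounded_meas_add[OF Pf2 bounded_meas_const[of _ "- s"]] by (simp add: g_def[abs_def])
  have g0: "(\<integral>x. g x \<partial>\<mu>) = 0" using Pf2int by (simp add: g_def s_def \<mu>.prob_space)
  have gm: "g \<in> borel_measurable borel" using g by (simp add: bounded_meas_def)
  obtain B where B: "\<And>x. \<bar>g x\<bar> \<le> B" "B \<ge> 0" by (rule bounded_measE[OF g]) blast
  have \<alpha>: "0 < \<alpha>" "\<alpha> < 1" using assms(7) by (auto simp: H2_def)
  have "\<exists>c>0. \<forall>r x. \<bar>(Qop P ^^ r) g x\<bar> \<le> c * \<alpha> ^ r"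
    using assms(7) g g0 by (simp add: H2_def)
  then obtain c where c: "c > 0" "\<And>r x. \<bar>(Qop P ^^ r) g x\<bar> \<le> c * \<alpha> ^ r" by auto
  obtain \<beta> where \<beta>: "\<alpha> \<le> \<beta>" "1/2 < \<beta>" "\<beta> < 1"
    and growth: "(\<lambda>n. (b n / n)\<^sup>2 * (\<Sum>j\<le>rgen n. (2 * \<beta>\<^sup>2) ^ j)) \<longlonglongrightarrow> 0"
    by (rule growth_condition[OF \<alpha> b assms(13-15)])
  have c\<beta>: "\<bar>(Qop P ^^ r) g x\<bar> \<le> c * \<beta> ^ r" for r x
    using \<alpha> \<beta> c(1) by (intro order_trans[OF c(2)] mult_left_mono power_mono) auto
  have bn2: "(\<lambda>n. (b n / n)\<^sup>2) \<longlonglongrightarrow> 0"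
  proof (rule Lim_null_comparison[OF _ growth], intro eventuallyI)
    fix n
    \<comment> \<open>The sum includes \<open>j = 0\<close> even when \<open>rgen n = 0\<close>, so
      it is at least 1 and the merged growth condition contains \<open>b n / n\<close> tending to
      0.\<close>
    have "(2 * \<beta>\<^sup>2) ^ 0 \<le> (\<Sum>j\<le>rgen n. (2 * \<beta>\<^sup>2) ^ j)" by (intro member_le_sum) auto
    then show "norm ((b n / n)\<^sup>2) \<le> (b n / n)\<^sup>2 * (\<Sum>j\<le>rgen n. (2 * \<beta>\<^sup>2) ^ j)"
      using mult_left_mono[of 1 "\<Sum>j\<le>rgen n. (2 * \<beta>\<^sup>2) ^ j" "(b n / n)\<^sup>2"] by simp
  qed
  then have bn: "(\<lambda>n. b n / n) \<longlonglongrightarrow> 0" by simp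
  have v_top: "filterlim v at_top sequentially"
  proof -
    have "filterlim (\<lambda>n. (b n / sqrt (real n)) * (b n / sqrt (real n))) at_top sequentially"
      by (rule filterlim_at_top_mult_at_top[OF assms(12) assms(12)])
    then show ?thesis by (simp add: v_def[abs_def] power2_eq_square)
  qed
  have vpos: "eventually (\<lambda>n. v n > 0) sequentially"
    using eventually_gt_at_top[of 0] by eventually_elim (auto simp: v_def intro!: divide_pos_pos zero_less_power b)
  have ZB: "\<exists>B. \<forall>\<omega>. \<bar>Z n \<omega>\<bar> \<le> B" for n
  proof (intro exI allI)
    fix \<omega>
    have "\<bar>Mpi X \<pi> n f \<omega>\<bar> \<le> (\<Sum>i=1..n. F)" unfolding Mpi_def using F by (intro order_trans[OF sum_abs] sum_mono)
    then show "\<bar>Z n \<omega>\<bar> \<le> (\<Sum>i=1..n. F) / b n"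
      using b[of n] by (simp add: Z_def divide_right_mono)
  qed
  have YB: "\<exists>B. \<forall>\<omega>. \<bar>Y n \<omega>\<bar> \<le> B" for n
  proof (intro exI allI)
    fix \<omega>
    have "\<bar>\<Sum>i=1..n. g (X (\<pi> \<omega> i) \<omega>)\<bar> \<le> (\<Sum>i=1..n. B)" using B by (intro order_trans[OF sum_abs] sum_mono)
    then show "\<bar>Y n \<omega>\<bar> \<le> (\<Sum>i=1..n. B) / n"
      by (simp only: Y_def abs_divide abs_of_nat divide_right_mono of_nat_0_le_iff)
  qed
  have Zm: "Z n \<in> borel_measurable M" for n
    unfolding Z_def[abs_def] Mpi_def by (intro borel_measurable_divide measurable_perm_sum F borel_measurable_const)
  have parent: "(\<lambda>\<omega>. \<Sum>i=1..n. h (X (\<pi> \<omega> i) \<omega>) :: real) \<in> borel_measurable M"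
    if [measurable]: "h \<in> borel_measurable borel" for h n
  proof -
    have "(\<lambda>t. h (fst t)) \<in> borel_measurable S3" by measurable
    from measurable_perm_sum[OF this, of n] show ?thesis by (simp add: Delta_def)
  qed
  have Ym: "Y n \<in> borel_measurable M" for n
    unfolding Y_def[abs_def] by (intro borel_measurable_divide parent gm borel_measurable_const)
  have mart: "eventually (\<lambda>n. \<exists>A\<in>borel_measurable M.
        M.expectation (\<lambda>\<omega>. exp (l * v n * Z n \<omega> - A \<omega>)) = 1 \<and>
        (\<forall>\<omega>. \<bar>A \<omega> - l\<^sup>2 / 2 * v n * (s + Y n \<omega>)\<bar> \<le> \<epsilon> * v n)) sequentially"
    if \<epsilon>: "\<epsilon> > 0" for l \<epsilon>
  proof -
    \<comment> \<open>The error summed over \<open>n\<close> vertices is this constant times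
      \<open>l\<^sup>2 * v n\<close>, hence at most \<open>\<epsilon> * v n\<close>; the summand 1
      allows \<open>l = 0\<close>.\<close>
    have "\<epsilon> / (l\<^sup>2 + 1) > 0" using \<epsilon> by (simp add: add_nonneg_pos)
    then obtain \<eta> where \<eta>: "\<eta> > 0" "\<And>\<theta> x. \<bar>\<theta>\<bar> \<le> \<eta> \<Longrightarrow>
      \<bar>ln (Pop P (\<lambda>t. exp (\<theta> * f t)) x) - \<theta>\<^sup>2 / 2 * Pop P (\<lambda>t. (f t)\<^sup>2) x\<bar> \<le> \<epsilon> / (l\<^sup>2 + 1) * \<theta>\<^sup>2"
      by (rule ln_Pop_exp_expansion[OF f assms(9)[rule_format]]) blast
    have "(\<lambda>n. \<bar>l * (b n / n)\<bar>) \<longlonglongrightarrow> \<bar>l * 0\<bar>" by (intro tendsto_intros bn)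
    then have "eventually (\<lambda>n. \<bar>l * (b n / n)\<bar> < \<eta>) sequentially"
      using \<eta>(1) by (intro order_tendstoD(2)) auto
    then show ?thesis using eventually_gt_at_top[of 0]
    proof eventually_elim
      case (elim n)
      define \<theta> where "\<theta> = l * (b n / n)"
      define \<psi> where "\<psi> x = ln (Pop P (\<lambda>t. exp (\<theta> * f t)) x)" for x
      define A where "A \<omega> = (\<Sum>i=1..n. \<psi> (X (\<pi> \<omega> i) \<omega>))" for \<omega>
      have \<theta>v: "n * \<theta>\<^sup>2 = l\<^sup>2 * v n"
        using elim(2) by (simp add: \<theta>_def v_def power_mult_distrib power_divide power2_eq_square)
      have lvZ: "l * v n * Z n \<omega> = \<theta> * Mpi X \<pi> n f \<omega>" for \<omega>
        using b[of n] by (simp add: \<theta>_def v_def Z_def power2_eq_square)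
      have \<theta>f: "bounded_meas S3 (\<lambda>t. \<theta> * f t)" by (rule bounded_meas_cmult[OF f])
      have \<theta>F: "\<bar>\<theta> * f t\<bar> \<le> \<bar>\<theta>\<bar> * F" for t unfolding abs_mult by (intro mult_left_mono F) auto
      have e\<theta>f: "bounded_meas S3 (\<lambda>t. exp (\<theta> * f t))" by (rule bounded_meas_exp[OF \<theta>f])
      have [measurable]: "Pop P (\<lambda>t. exp (\<theta> * f t)) \<in> borel_measurable borel"
        using e\<theta>f by (intro Pop_measurable) (simp add: bounded_meas_def)
      have \<psi>m: "\<psi> \<in> borel_measurable borel" unfolding \<psi>_def[abs_def] by measurable
      have \<psi>b: "bounded_meas borel \<psi>"
        using ln_Pop_exp_bound(2)[OF \<theta>f \<theta>F] by (intro bounded_measI[where B="\<bar>\<theta>\<bar> * F"] \<psi>m) (simp add: \<psi>_def)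
      \<comment> \<open>Normalising by a function of the mother makes the one-step mean exactly 1,
        whatever the state.\<close>
      let ?\<phi> = "\<lambda>t. exp (- \<psi> (fst t)) * exp (\<theta> * f t)"
      have "bounded_meas S3 (\<lambda>t. exp (-1 * \<psi> (fst t) + \<theta> * f t))"
        by (intro bounded_meas_exp bounded_meas_add bounded_meas_cmult bounded_meas_daughters(3) \<psi>b f)
      then have \<phi>: "bounded_meas S3 ?\<phi>" by (simp flip: exp_add)
      have \<phi>1: "Pop P ?\<phi> x = 1" for x
      proof -
        have "Pop P ?\<phi> x = exp (- \<psi> x) * Pop P (\<lambda>t. exp (\<theta> * f t)) x"
          by (rule Pop_parent_mult[of "\<lambda>x. exp (- \<psi> x)"])
        then show ?thesis using ln_Pop_exp_bound(1)[OF \<theta>f \<theta>F, of x] by (simp add: \<psi>_def exp_minus)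
      qed
      have "M.expectation (\<lambda>\<omega>. exp (l * v n * Z n \<omega> - A \<omega>)) = M.expectation (\<lambda>\<omega>. \<Prod>i=1..n. ?\<phi> (Delta X (\<pi> \<omega> i) \<omega>))"
        unfolding lvZ A_def Mpi_def sum_distrib_left sum_subtractf[symmetric] exp_sum[OF finite_atLeastAtMost]
        by (simp add: Delta_def exp_diff exp_minus field_simps)
      also have "\<dots> = 1" by (rule expectation_prod_perm_eq_1[OF \<phi> \<phi>1])
      finally have E1: "M.expectation (\<lambda>\<omega>. exp (l * v n * Z n \<omega> - A \<omega>)) = 1" .
      have "\<bar>A \<omega> - l\<^sup>2 / 2 * v n * (s + Y n \<omega>)\<bar> \<le> \<epsilon> * v n" for \<omega>
      proof -
        have "real n * (s + Y n \<omega>) = (\<Sum>i=1..n. s + g (X (\<pi> \<omega> i) \<omega>))"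
          using elim(2) by (simp add: Y_def sum.distrib distrib_left)
        also have "\<dots> = (\<Sum>i=1..n. Pop P (\<lambda>t. (f t)\<^sup>2) (X (\<pi> \<omega> i) \<omega>))" by (simp add: g_def)
        finally have nsY: "real n * (s + Y n \<omega>) = (\<Sum>i=1..n. Pop P (\<lambda>t. (f t)\<^sup>2) (X (\<pi> \<omega> i) \<omega>))" .
        have "l\<^sup>2 / 2 * v n * (s + Y n \<omega>) = (l\<^sup>2 * v n) / 2 * (s + Y n \<omega>)" by simp
        also have "\<dots> = \<theta>\<^sup>2 / 2 * (real n * (s + Y n \<omega>))" unfolding \<theta>v[symmetric] by simp
        also have "\<dots> = (\<Sum>i=1..n. \<theta>\<^sup>2 / 2 * Pop P (\<lambda>t. (f t)\<^sup>2) (X (\<pi> \<omega> i) \<omega>))"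
          unfolding nsY sum_distrib_left ..
        finally have "\<bar>A \<omega> - l\<^sup>2 / 2 * v n * (s + Y n \<omega>)\<bar>
          = \<bar>\<Sum>i=1..n. \<psi> (X (\<pi> \<omega> i) \<omega>) - \<theta>\<^sup>2 / 2 * Pop P (\<lambda>t. (f t)\<^sup>2) (X (\<pi> \<omega> i) \<omega>)\<bar>"
          by (simp add: A_def sum_subtractf)
        also have "\<dots> \<le> (\<Sum>i=1..n. \<epsilon> / (l\<^sup>2 + 1) * \<theta>\<^sup>2)"
          unfolding \<psi>_def using elim(1)[folded \<theta>_def]
          by (intro order_trans[OF sum_abs] sum_mono \<eta>(2)) simp
        also have "\<dots> = \<epsilon> / (l\<^sup>2 + 1) * (n * \<theta>\<^sup>2)" by simp
        also have "\<dots> = (l\<^sup>2 / (l\<^sup>2 + 1)) * (\<epsilon> * v n)" unfolding \<theta>v by simp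
        also have "\<dots> \<le> 1 * (\<epsilon> * v n)"
        proof (rule mult_right_mono)
          have "l\<^sup>2 + 1 > 0" by (simp add: add_nonneg_pos)
          then show "l\<^sup>2 / (l\<^sup>2 + 1) \<le> 1" by (simp add: divide_le_eq)
        qed (use \<epsilon> in \<open>simp add: v_def\<close>)
        finally show ?thesis by simp
      qed
      moreover have "A \<in> borel_measurable M" unfolding A_def[abs_def] by (rule parent[OF \<psi>m])
      ultimately show ?case using E1 by blast
    qed
  qed
  have conc: "eventually (\<lambda>n. M.expectation (\<lambda>\<omega>. exp (t * v n * Y n \<omega>)) \<le> exp (\<epsilon> * v n)) sequentially"
    if \<epsilon>: "\<epsilon> > 0" for t \<epsilon>
  proof -
    define c' where "c' = c * 2 * \<beta> / (2 * \<beta> - 1)"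
    let ?S = "\<lambda>n. \<Sum>j\<le>rgen n. (2 * \<beta>\<^sup>2) ^ j"
    \<comment> \<open>The exponent of \<open>perm_exp_bound\<close> divided by \<open>v n\<close>,
      for the weight \<open>\<kappa>\<close> below, with the sum extended by one term to match the
      growth condition.\<close>
    let ?e = "\<lambda>n. t\<^sup>2 * B\<^sup>2 / 2 * (b n / n)\<^sup>2 + \<bar>t\<bar> * c' * \<beta> ^ rgen n + t\<^sup>2 * c'\<^sup>2 * ((b n / n)\<^sup>2 * ?S n)"
    have "(\<lambda>n. \<beta> ^ rgen n) \<longlonglongrightarrow> 0"
      using \<alpha> \<beta> by (intro filterlim_compose[OF LIMSEQ_power_zero rgen_at_top]) auto
    then have "?e \<longlonglongrightarrow> t\<^sup>2 * B\<^sup>2 / 2 * 0 + \<bar>t\<bar> * c' * 0 + t\<^sup>2 * c'\<^sup>2 * 0"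
      by (intro tendsto_intros bn2 growth)
    then have "eventually (\<lambda>n. ?e n < \<epsilon>) sequentially" using \<epsilon> by (intro order_tendstoD(2)) auto
    then show ?thesis using eventually_ge_at_top[of 1]
    proof eventually_elim
      case (elim n)
      \<comment> \<open>As \<open>v n / n\<close> is the square of \<open>b n / n\<close>, terms
        quadratic in \<open>\<kappa>\<close> gain that square relative to the speed, while the
        linear one gains nothing and relies on \<open>\<beta> ^ rgen n\<close>.\<close>
      define \<kappa> where "\<kappa> = t * v n / n"
      have n0: "real n > 0" using elim(2) by simp
      have v0: "v n \<ge> 0" by (simp add: v_def)
      have vn: "v n / n = (b n / n)\<^sup>2" by (simp add: v_def power2_eq_square)
      have n\<kappa>: "real n * \<kappa>\<^sup>2 = v n * (t\<^sup>2 * (b n / n)\<^sup>2)" "real n * \<bar>\<kappa>\<bar> = v n * \<bar>t\<bar>"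
        using n0 v0 unfolding vn[symmetric] by (auto simp: \<kappa>_def power2_eq_square abs_mult)
      have S: "(\<Sum>j<rgen n. (2 * \<beta>\<^sup>2) ^ j) \<le> ?S n" by (intro sum_mono2) auto
      have "M.expectation (\<lambda>\<omega>. exp (t * v n * Y n \<omega>)) = M.expectation (\<lambda>\<omega>. exp (\<kappa> * (\<Sum>i=1..n. g (X (\<pi> \<omega> i) \<omega>))))"
        by (simp add: Y_def \<kappa>_def)
      also have "\<dots> \<le> exp (real n * (\<kappa>\<^sup>2 * B\<^sup>2 / 2 + \<bar>\<kappa>\<bar> * c' * \<beta> ^ rgen n + \<kappa>\<^sup>2 * c'\<^sup>2 * (\<Sum>j<rgen n. (2 * \<beta>\<^sup>2) ^ j)))"
        unfolding c'_def by (rule perm_exp_bound[OF g B(1) c\<beta> \<beta>(2) elim(2)])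
      also have "\<dots> \<le> exp (real n * (\<kappa>\<^sup>2 * B\<^sup>2 / 2 + \<bar>\<kappa>\<bar> * c' * \<beta> ^ rgen n + \<kappa>\<^sup>2 * c'\<^sup>2 * ?S n))"
        using S by (auto intro!: mult_left_mono)
      also have "real n * (\<kappa>\<^sup>2 * B\<^sup>2 / 2 + \<bar>\<kappa>\<bar> * c' * \<beta> ^ rgen n + \<kappa>\<^sup>2 * c'\<^sup>2 * ?S n)
        = (real n * \<kappa>\<^sup>2) * (B\<^sup>2 / 2) + (real n * \<bar>\<kappa>\<bar>) * (c' * \<beta> ^ rgen n) + (real n * \<kappa>\<^sup>2) * (c'\<^sup>2 * ?S n)"
        by (simp add: distrib_left)
      also have "\<dots> = v n * ?e n" unfolding n\<kappa> by (simp add: distrib_left mult_ac)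
      also have "exp (v n * ?e n) \<le> exp (\<epsilon> * v n)"
        using mult_left_mono[OF less_imp_le[OF elim(1)] v0] by (simp add: mult.commute)
      finally show ?case .
    qed
  qed
  have "dev_principle M Z v (gauss_rate s)"
  proof (rule M.gauss_dev_principle[OF v_top Zm _ s])
    show "integrable M (\<lambda>\<omega>. exp (k * Z n \<omega>))" for n k
      using ZB[of n] M.integrable_exp_cmult[OF Zm[of n]] by blast
    show "(\<lambda>n. ln (M.expectation (\<lambda>\<omega>. exp (l * v n * Z n \<omega>))) / v n) \<longlonglongrightarrow> l\<^sup>2 * s / 2" for l
      by (rule M.log_laplace_tendsto[OF vpos Zm ZB Ym YB s mart conc])
  qed
  then show ?thesis by (simp add: Z_def[abs_def] v_def[abs_def] s_def)
qed

end
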